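(* Let $\Omega\subset\mathbb R^2$ be an open set of finite area with Lipschitz boundary. Then $\lambda_1^B(\Omega)\ge\lambda_1^S(\Omega)$, with equality if $\Omega$ is simply connected.
   Context: The first eigenvalue of the buckling problem for a clamped plate is \[ \lambda_1^B(\Omega)=\min_{\psi\in H^2_0(\Omega)\setminus\{0\}}\frac{\int_\Omega(\Delta\psi)^2\,dx}{\int_\Omega|\nabla\psi|^2\,dx}, \] and the first eigenvalue of the Stokes operator is \[ \lambda_1^S(\Omega)=\min\left\{\frac{\int_\Omega|\nabla u|^2\,dx}{\int_\Omega|u|^2\,dx}\ :\ u\in H^1_0(\Omega;\mathbb R^2)\setminus\{0\},\ \nabla\cdot u=0\text{ in }\Omega\right\}. \] *)

theory Defs
  imports "HOL-Analysis.Analysis"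
begin

definition pderiv_at :: "'n \<Rightarrow> (real^'n \<Rightarrow> real) \<Rightarrow> real^'n \<Rightarrow> real" where
  "pderiv_at i f x = frechet_derivative f (at x) (axis i 1)"

text \<open>The value of \<^const>\<open>frechet_derivative\<close> is unspecified at points of non-differentiability,
  so differentiability is demanded alongside every use of the partial derivatives.\<close>

primrec C_diff :: "nat \<Rightarrow> (real^'n \<Rightarrow> real) \<Rightarrow> bool" where
  "C_diff 0 f \<longleftrightarrow> continuous_on UNIV f"
| "C_diff (Suc k) f \<longleftrightarrow> (\<forall>x. f differentiable (at x)) \<and> (\<forall>i. C_diff k (pderiv_at i f))"

definition test_functions :: "(real^'n) set \<Rightarrow> (real^'n \<Rightarrow> real) set" where
  "test_functions \<Omega> =
     {\<phi>. (\<forall>k. C_diff k \<phi>) \<and> compact (closure {x. \<phi> x \<noteq> 0}) \<and> closure {x. \<phi> x \<noteq> 0} \<subseteq> \<Omega>}"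

text \<open>Elements of function spaces on \<open>\<Omega>\<close> are represented by total functions; only their values
  on \<open>\<Omega>\<close>, up to Lebesgue null sets, are relevant.\<close>

definition locally_integrable :: "(real^'n) set \<Rightarrow> (real^'n \<Rightarrow> real) \<Rightarrow> bool" where
  "locally_integrable \<Omega> f \<longleftrightarrow> (\<forall>K. compact K \<and> K \<subseteq> \<Omega> \<longrightarrow> integrable (lebesgue_on K) f)"

definition has_weak_pderiv ::
  "(real^'n) set \<Rightarrow> 'n \<Rightarrow> (real^'n \<Rightarrow> real) \<Rightarrow> (real^'n \<Rightarrow> real) \<Rightarrow> bool" where
  "has_weak_pderiv \<Omega> i f g \<longleftrightarrow>
     locally_integrable \<Omega> f \<and> locally_integrable \<Omega> g \<and>
     (\<forall>\<phi>\<in>test_functions \<Omega>.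
        (LINT x|lebesgue_on \<Omega>. f x * pderiv_at i \<phi> x) = - (LINT x|lebesgue_on \<Omega>. g x * \<phi> x))"

text \<open>A representative of the weak partial derivative, which is unique up to null sets for
  open \<open>\<Omega>\<close>; unspecified if there is no weak derivative.\<close>

definition weak_pderiv ::
  "(real^'n) set \<Rightarrow> 'n \<Rightarrow> (real^'n \<Rightarrow> real) \<Rightarrow> (real^'n \<Rightarrow> real)" where
  "weak_pderiv \<Omega> i f = (SOME g. has_weak_pderiv \<Omega> i f g)"

definition L2 :: "(real^'n) set \<Rightarrow> (real^'n \<Rightarrow> real) set" where
  "L2 \<Omega> = {u. u \<in> borel_measurable (lebesgue_on \<Omega>) \<and> integrable (lebesgue_on \<Omega>) (\<lambda>x. (u x)\<^sup>2)}"

text \<open>\<open>H\<^sup>k(\<Omega>)\<close> with its squared norm. For \<open>k = 2\<close> the latter is the integral of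
  \<open>|u|\<^sup>2 + |\<nabla>u|\<^sup>2 + |D\<^sup>2u|\<^sup>2\<close>, where \<open>D\<^sup>2u\<close> is the full Hessian.\<close>

primrec sobolev :: "(real^'n) set \<Rightarrow> nat \<Rightarrow> (real^'n \<Rightarrow> real) set" where
  "sobolev \<Omega> 0 = L2 \<Omega>"
| "sobolev \<Omega> (Suc k) = {u \<in> L2 \<Omega>. \<forall>i. \<exists>g\<in>sobolev \<Omega> k. has_weak_pderiv \<Omega> i u g}"

primrec sobolev_sqnorm :: "(real^'n) set \<Rightarrow> nat \<Rightarrow> (real^'n \<Rightarrow> real) \<Rightarrow> real" where
  "sobolev_sqnorm \<Omega> 0 u = (LINT x|lebesgue_on \<Omega>. (u x)\<^sup>2)"
| "sobolev_sqnorm \<Omega> (Suc k) u =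
     (LINT x|lebesgue_on \<Omega>. (u x)\<^sup>2) + (\<Sum>i\<in>UNIV. sobolev_sqnorm \<Omega> k (weak_pderiv \<Omega> i u))"

text \<open>\<open>H\<^sup>k\<^sub>0(\<Omega>)\<close>: the closure of the test functions in \<open>H\<^sup>k(\<Omega>)\<close>.\<close>

definition sobolev0 :: "(real^'n) set \<Rightarrow> nat \<Rightarrow> (real^'n \<Rightarrow> real) set" where
  "sobolev0 \<Omega> k =
     {u \<in> sobolev \<Omega> k. \<forall>\<epsilon>>0. \<exists>\<phi>\<in>test_functions \<Omega>. sobolev_sqnorm \<Omega> k (\<lambda>x. u x - \<phi> x) < \<epsilon>}"

definition weak_laplacian :: "(real^'n) set \<Rightarrow> (real^'n \<Rightarrow> real) \<Rightarrow> real^'n \<Rightarrow> real" where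
  "weak_laplacian \<Omega> \<psi> x = (\<Sum>i\<in>UNIV. weak_pderiv \<Omega> i (weak_pderiv \<Omega> i \<psi>) x)"

definition weak_divergence :: "(real^'n) set \<Rightarrow> (real^'n \<Rightarrow> real^'n) \<Rightarrow> real^'n \<Rightarrow> real" where
  "weak_divergence \<Omega> u x = (\<Sum>i\<in>UNIV. weak_pderiv \<Omega> i (\<lambda>y. u y $ i) x)"

definition buckling_quotient :: "(real^2) set \<Rightarrow> (real^2 \<Rightarrow> real) \<Rightarrow> real" where
  "buckling_quotient \<Omega> \<psi> =
     (LINT x|lebesgue_on \<Omega>. (weak_laplacian \<Omega> \<psi> x)\<^sup>2) /
     (LINT x|lebesgue_on \<Omega>. (\<Sum>i\<in>UNIV. (weak_pderiv \<Omega> i \<psi> x)\<^sup>2))"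

definition stokes_quotient :: "(real^2) set \<Rightarrow> (real^2 \<Rightarrow> real^2) \<Rightarrow> real" where
  "stokes_quotient \<Omega> u =
     (LINT x|lebesgue_on \<Omega>. (\<Sum>j\<in>UNIV. \<Sum>i\<in>UNIV. (weak_pderiv \<Omega> i (\<lambda>y. u y $ j) x)\<^sup>2)) /
     (LINT x|lebesgue_on \<Omega>. (norm (u x))\<^sup>2)"

text \<open>The minima of the Rayleigh quotients are rendered as infima. For nonempty \<open>\<Omega>\<close> of finite
  area both infima are attained, since \<open>H\<^sup>1\<^sub>0(\<Omega>)\<close> embeds compactly into \<open>L\<^sup>2(\<Omega>)\<close>.\<close>

definition buckling_eigenvalue :: "(real^2) set \<Rightarrow> real" where
  "buckling_eigenvalue \<Omega> =
     Inf {buckling_quotient \<Omega> \<psi> |\<psi>.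
            \<psi> \<in> sobolev0 \<Omega> 2 \<and> \<not> (AE x in lebesgue_on \<Omega>. \<psi> x = 0)}"

definition stokes_eigenvalue :: "(real^2) set \<Rightarrow> real" where
  "stokes_eigenvalue \<Omega> =
     Inf {stokes_quotient \<Omega> u |u.
            (\<forall>j. (\<lambda>x. u x $ j) \<in> sobolev0 \<Omega> 1) \<and> \<not> (AE x in lebesgue_on \<Omega>. u x = 0) \<and>
            (AE x in lebesgue_on \<Omega>. weak_divergence \<Omega> u x = 0)}"

text \<open>Near each boundary point, and after an orthogonal change of coordinates, \<open>\<Omega>\<close> is the region
  strictly above the graph of a Lipschitz function. Boundedness of \<open>\<Omega>\<close> and uniformity of the radii
  or Lipschitz constants are not required.\<close>

definition lipschitz_boundary :: "(real^2) set \<Rightarrow> bool" where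
  "lipschitz_boundary \<Omega> \<longleftrightarrow>
     (\<forall>p\<in>frontier \<Omega>. \<exists>r>0. \<exists>Q :: real^2 \<Rightarrow> real^2. \<exists>L. \<exists>g :: real \<Rightarrow> real.
        orthogonal_transformation Q \<and> L-lipschitz_on UNIV g \<and>
        ball p r \<inter> \<Omega> = {x \<in> ball p r. g (Q x $ 1) < Q x $ 2})"

end

theory Submission
  imports Defs "HOL-Complex_Analysis.Riemann_Mapping"
begin

text \<open>
  The two minimisation problems are related by the perpendicular gradient, which sends a function \<open>\<psi>\<close> to
  the field \<open>u = (- \<partial>\<^sub>2\<psi>, \<partial>\<^sub>1\<psi>)\<close>. If \<open>\<psi>\<close> belongs to \<open>H\<^sup>2\<^sub>0(\<Omega>)\<close>, then the components of \<open>u\<close> belong to \<open>H\<^sup>1\<^sub>0(\<Omega>)\<close>, the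
  divergence of \<open>u\<close> vanishes because mixed second derivatives agree, and pointwise \<open>\<bar>u\<bar> = \<bar>\<nabla>\<psi>\<bar>\<close> and
  \<open>\<bar>\<nabla>u\<bar> = \<bar>D\<^sup>2\<psi>\<bar>\<close>. Integration by parts for test functions and density give \<open>\<integral>\<bar>D\<^sup>2\<psi>\<bar>\<^sup>2 = \<integral>(\<Delta>\<psi>)\<^sup>2\<close>
  (\<open>H2_0_jet_energy_identity\<close>), so the Stokes quotient of \<open>u\<close> is the buckling quotient of \<open>\<psi>\<close>. Finally \<open>u\<close> is not
  zero if \<open>\<psi>\<close> is not, since the value of \<open>\<psi>\<close> at a point is the integral of \<open>\<partial>\<^sub>2\<partial>\<^sub>1\<psi>\<close> over the quadrant to the left
  of and below that point. Hence every buckling quotient is a Stokes quotient (\<open>buckling_values_subset\<close>), and the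
  infimum of the latter is not larger.

  For equality the perpendicular gradient must be inverted: a divergence-free field \<open>u\<close> with components in \<open>H\<^sup>1\<^sub>0(\<Omega>)\<close>
  has a stream function in \<open>H\<^sup>2\<^sub>0(\<Omega>)\<close> (\<open>stream_function\<close>). Since \<open>\<Omega>\<close> has finite area, the derivatives of the extension
  of \<open>u\<close> by zero are integrable over the plane, and the integral of \<open>\<partial>\<^sub>2u\<^sub>2 = - \<partial>\<^sub>1u\<^sub>1\<close> over quadrants is a continuous
  function \<open>\<psi>\<close> of their corner. It is a uniform limit of integrals of test functions along horizontal half-lines,
  and also along vertical ones. This yields its weak gradient \<open>(u\<^sub>2, - u\<^sub>1)\<close>, and it shows that \<open>\<psi>\<close> tends to zero at
  infinity and is locally constant in the exterior of \<open>\<Omega>\<close>. As the boundary is locally a Lipschitz graph, \<open>\<psi>\<close> is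
  constant on each component of the complement (\<open>locally_constant_complement_lipschitz\<close>), and these components are
  unbounded because \<open>\<Omega>\<close> is simply connected. So \<open>\<psi>\<close> vanishes outside \<open>\<Omega>\<close>.

  It remains to approximate \<open>\<psi>\<close> by test functions (\<open>H2_0_jet_if_inward\<close>). After localisation by smooth cutoff functions,
  \<open>\<psi>\<close> is convolved with mollifiers whose supports lie on the inner side of the origin with respect to the boundary.
  The cone condition satisfied by Lipschitz graphs (\<open>inward_at_lipschitz_boundary\<close>) makes the convolutions vanish near
  the boundary, and they converge together with their first and second derivatives.

  Weak derivatives are unique by the fundamental lemma of the calculus of variations, which makes it possible to
  describe the spaces \<open>H\<^sup>1\<^sub>0\<close> and \<open>H\<^sup>2\<^sub>0\<close> by convergent sequences of test functions (\<open>sobolev0_1_iff\<close>,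
  \<open>sobolev0_2_iff\<close>).
\<close>

section \<open>Smooth functions and test functions\<close>

definition smooth :: "(real^'n \<Rightarrow> real) \<Rightarrow> bool" where
  "smooth f \<longleftrightarrow> (\<forall>k. C_diff k f)"

lemma pderiv_at_eq: "(f has_derivative f') (at x) \<Longrightarrow> pderiv_at i f x = f' (axis i 1)"
  unfolding pderiv_at_def by (metis frechet_derivative_at)

lemma C_diff_continuous: "C_diff k f \<Longrightarrow> continuous_on UNIV f"
  by (cases k) (auto intro: differentiable_imp_continuous_on simp: differentiable_on_def)

lemma C_diff_Suc_imp: "C_diff (Suc k) f \<Longrightarrow> C_diff k f"
proof (induction k arbitrary: f)
  case 0
  then show ?case using C_diff_continuous[of "Suc 0" f] by simp
qed auto

lemma pderiv_at_add:
  assumes "f differentiable (at x)" "g differentiable (at x)"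
  shows "pderiv_at i (\<lambda>x. f x + g x) x = pderiv_at i f x + pderiv_at i g x"
  using pderiv_at_eq[OF has_derivative_add[OF assms[unfolded frechet_derivative_works]], of i]
  by (simp add: pderiv_at_def)

lemma pderiv_at_mult:
  assumes "f differentiable (at x)" "g differentiable (at x)"
  shows "pderiv_at i (\<lambda>x. f x * g x) x = f x * pderiv_at i g x + pderiv_at i f x * g x"
  using pderiv_at_eq[OF has_derivative_mult[OF assms[unfolded frechet_derivative_works]], of i]
  by (simp add: pderiv_at_def)

lemma pderiv_at_cmult:
  assumes "f differentiable (at x)"
  shows "pderiv_at i (\<lambda>x. c * f x) x = c * pderiv_at i f x"
  using pderiv_at_eq[OF has_derivative_mult_right[OF assms[unfolded frechet_derivative_works], of c], of i]
  by (simp add: pderiv_at_def)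

lemma pderiv_at_const: "pderiv_at i (\<lambda>x. c) x = 0"
  by (rule pderiv_at_eq[OF has_derivative_const])

lemma has_derivative_reflect:
  fixes f :: "'a::real_normed_vector \<Rightarrow> 'b::real_normed_vector"
  assumes "(f has_derivative f') (at (a - x))"
  shows "((\<lambda>x. f (a - x)) has_derivative (\<lambda>h. f' (- h))) (at x)"
proof -
  have "((\<lambda>x. a - x) has_derivative (\<lambda>h. - h)) (at x)"
    by (auto intro!: derivative_eq_intros)
  from has_derivative_compose[OF this assms] show ?thesis by simp
qed

lemma C_diff_add: "C_diff k f \<Longrightarrow> C_diff k g \<Longrightarrow> C_diff k (\<lambda>x. f x + g x)"
proof (induction k arbitrary: f g)
  case 0
  then show ?case by (auto intro: continuous_on_add)
next
  case (Suc k)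
  then have "pderiv_at i (\<lambda>x. f x + g x) = (\<lambda>x. pderiv_at i f x + pderiv_at i g x)" for i
    by (auto simp: pderiv_at_add)
  with Suc show ?case by auto
qed

lemma C_diff_const: "C_diff k (\<lambda>x. c)"
proof (induction k arbitrary: c)
  case (Suc k)
  have "pderiv_at i (\<lambda>x::real^'a. c) = (\<lambda>x. 0)" for i by (auto simp: pderiv_at_const)
  with Suc show ?case by auto
qed auto

lemma C_diff_mult: "C_diff k f \<Longrightarrow> C_diff k g \<Longrightarrow> C_diff k (\<lambda>x. f x * g x)"
proof (induction k arbitrary: f g)
  case 0
  then show ?case by (auto intro: continuous_on_mult)
next
  case (Suc k)
  then have "pderiv_at i (\<lambda>x. f x * g x) = (\<lambda>x. f x * pderiv_at i g x + pderiv_at i f x * g x)" for i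
    by (auto simp: pderiv_at_mult)
  moreover have "C_diff k f" "C_diff k g" using Suc.prems by (auto intro: C_diff_Suc_imp simp del: C_diff.simps)
  ultimately show ?case using Suc by (auto intro!: C_diff_add Suc.IH)
qed

lemma pderiv_at_reflect:
  assumes "f differentiable (at (a - x))"
  shows "pderiv_at i (\<lambda>x. f (a - x)) x = - pderiv_at i f (a - x)"
proof -
  have "linear (frechet_derivative f (at (a - x)))"
    using assms by (simp add: linear_frechet_derivative)
  then show ?thesis
    using pderiv_at_eq[OF has_derivative_reflect[OF assms[unfolded frechet_derivative_works]], of i]
    by (simp add: pderiv_at_def linear_neg)
qed

lemma C_diff_reflect: "C_diff k f \<Longrightarrow> C_diff k (\<lambda>x. f (a - x))"
proof (induction k arbitrary: f)
  case 0
  then show ?case by (auto intro!: continuous_on_compose2[of UNIV f] continuous_intros)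
next
  case (Suc k)
  then have "pderiv_at i (\<lambda>x. f (a - x)) = (\<lambda>x. - 1 * pderiv_at i f (a - x))" for i
    by (auto simp: pderiv_at_reflect)
  moreover have "C_diff k (\<lambda>x. - 1 * pderiv_at i f (a - x))" for i
    using Suc by (intro C_diff_mult C_diff_const) auto
  moreover have "(\<lambda>x. f (a - x)) differentiable (at x)" for x
    using Suc.prems has_derivative_reflect unfolding differentiable_def C_diff.simps by metis
  ultimately show ?case by auto
qed

lemma smooth_add: "smooth f \<Longrightarrow> smooth g \<Longrightarrow> smooth (\<lambda>x. f x + g x)"
  and smooth_mult: "smooth f \<Longrightarrow> smooth g \<Longrightarrow> smooth (\<lambda>x. f x * g x)"
  and smooth_const: "smooth (\<lambda>x. c)"
  and smooth_reflect: "smooth f \<Longrightarrow> smooth (\<lambda>x. f (a - x))"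
  unfolding smooth_def
  by (auto intro: C_diff_add C_diff_mult C_diff_const C_diff_reflect)

lemma smooth_cmult: "smooth f \<Longrightarrow> smooth (\<lambda>x. c * f x)"
  by (intro smooth_mult smooth_const)

lemma smooth_minus: "smooth f \<Longrightarrow> smooth (\<lambda>x. - f x)"
  using smooth_cmult[of f "-1"] by simp

lemma smooth_diff: "smooth f \<Longrightarrow> smooth g \<Longrightarrow> smooth (\<lambda>x. f x - g x)"
  using smooth_add[of f "\<lambda>x. - g x"] smooth_minus by auto

lemma smooth_prod:
  assumes "\<And>i. i \<in> A \<Longrightarrow> smooth (f i)"
  shows "smooth (\<lambda>x. \<Prod>i\<in>A. f i x)"
  using assms by (induction A rule: infinite_finite_induct) (auto intro: smooth_const smooth_mult)

lemma smooth_pderiv_at: "smooth f \<Longrightarrow> smooth (pderiv_at i f)"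
  unfolding smooth_def by (metis C_diff.simps(2))

lemma smooth_differentiable: "smooth f \<Longrightarrow> f differentiable (at x)"
  unfolding smooth_def by (metis C_diff.simps(2))

lemma smooth_continuous: "smooth f \<Longrightarrow> continuous_on UNIV f"
  unfolding smooth_def using C_diff_continuous by blast

lemma smooth_borel: "smooth f \<Longrightarrow> f \<in> borel_measurable borel"
  using borel_measurable_continuous_onI smooth_continuous by blast

lemma pderiv_at_vanish:
  assumes "closed K" "\<And>x. x \<notin> K \<Longrightarrow> f x = 0" "x \<notin> K"
  shows "pderiv_at i f x = 0"
proof -
  have "(f has_derivative (\<lambda>x. 0)) (at x)"
    by (rule has_derivative_transform_within_open[of "\<lambda>x. 0" _ x UNIV "- K"])
       (use assms in \<open>auto intro: open_Compl\<close>)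
  then show ?thesis by (simp add: pderiv_at_eq)
qed

lemma test_functionsI:
  assumes "smooth f" "compact K" "K \<subseteq> \<Omega>" "\<And>x. x \<notin> K \<Longrightarrow> f x = 0"
  shows "f \<in> test_functions \<Omega>"
proof -
  have "closure {x. f x \<noteq> 0} \<subseteq> K"
    using assms by (intro closure_minimal) (auto simp: compact_imp_closed)
  moreover from this have "compact (closure {x. f x \<noteq> 0})"
    using \<open>compact K\<close> by (meson bounded_subset closed_closure compact_eq_bounded_closed)
  ultimately show ?thesis
    using assms unfolding test_functions_def smooth_def by blast
qed

lemma test_functionsE:
  assumes "f \<in> test_functions \<Omega>"
  obtains K where "smooth f" "compact K" "K \<subseteq> \<Omega>" "\<And>x. x \<notin> K \<Longrightarrow> f x = 0"
proof
  show "smooth f" "compact (closure {x. f x \<noteq> 0})" "closure {x. f x \<noteq> 0} \<subseteq> \<Omega>"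
    using assms by (auto simp: test_functions_def smooth_def)
  show "f x = 0" if "x \<notin> closure {x. f x \<noteq> 0}" for x
    using that closure_subset[of "{x. f x \<noteq> 0}"] by auto
qed

lemma test_smooth: "f \<in> test_functions \<Omega> \<Longrightarrow> smooth f"
  by (auto simp: test_functions_def smooth_def)

lemma test_vanish: "f \<in> test_functions \<Omega> \<Longrightarrow> x \<notin> \<Omega> \<Longrightarrow> f x = 0"
  by (metis subsetD test_functionsE)

lemma test_mono: "f \<in> test_functions \<Omega> \<Longrightarrow> \<Omega> \<subseteq> \<Omega>' \<Longrightarrow> f \<in> test_functions \<Omega>'"
  by (auto simp: test_functions_def)

lemma test_pderiv_at: "f \<in> test_functions \<Omega> \<Longrightarrow> pderiv_at i f \<in> test_functions \<Omega>"
  by (elim test_functionsE, rule test_functionsI)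
     (auto intro: smooth_pderiv_at pderiv_at_vanish compact_imp_closed)

lemma test_smooth_mult:
  assumes "smooth g" "f \<in> test_functions \<Omega>"
  shows "(\<lambda>x. g x * f x) \<in> test_functions \<Omega>"
  using assms by (elim test_functionsE, intro test_functionsI) (auto intro: smooth_mult)

lemma test_cmult: "f \<in> test_functions \<Omega> \<Longrightarrow> (\<lambda>x. c * f x) \<in> test_functions \<Omega>"
  by (intro test_smooth_mult smooth_const)

lemma test_minus: "f \<in> test_functions \<Omega> \<Longrightarrow> (\<lambda>x. - f x) \<in> test_functions \<Omega>"
  using test_cmult[of f \<Omega> "-1"] by simp

lemma test_add:
  assumes "f \<in> test_functions \<Omega>" "g \<in> test_functions \<Omega>"
  shows "(\<lambda>x. f x + g x) \<in> test_functions \<Omega>"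
proof -
  obtain K where K: "compact K" "K \<subseteq> \<Omega>" "\<And>x. x \<notin> K \<Longrightarrow> f x = 0" using assms(1) by (metis test_functionsE)
  obtain L where L: "compact L" "L \<subseteq> \<Omega>" "\<And>x. x \<notin> L \<Longrightarrow> g x = 0" using assms(2) by (metis test_functionsE)
  show ?thesis
    by (rule test_functionsI[of _ "K \<union> L"])
       (use K L assms in \<open>auto intro: smooth_add test_smooth\<close>)
qed

lemma test_reflect:
  assumes "f \<in> test_functions UNIV"
  shows "(\<lambda>x. f (a - x)) \<in> test_functions UNIV"
proof -
  obtain K where K: "smooth f" "compact K" "\<And>x. x \<notin> K \<Longrightarrow> f x = 0" using assms by (metis test_functionsE)
  have "f (a - x) = 0" if "x \<notin> (\<lambda>x. a - x) ` K" for x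
    using that by (intro K(3)) (metis diff_diff_eq2 add_diff_cancel_left' image_eqI)
  moreover have "compact ((\<lambda>x. a - x) ` K)"
    using K by (intro compact_continuous_image continuous_intros)
  ultimately show ?thesis using K by (intro test_functionsI[of _ "(\<lambda>x. a - x) ` K"] smooth_reflect) auto
qed

lemma continuous_vanish_bounded:
  fixes f :: "'a::euclidean_space \<Rightarrow> real"
  assumes "continuous_on UNIV f" "compact K" "\<And>x. x \<notin> K \<Longrightarrow> f x = 0"
  obtains B where "B > 0" "\<And>x. \<bar>f x\<bar> \<le> B"
proof -
  have "bounded (f ` K)"
    using compact_imp_bounded[OF compact_continuous_image[OF continuous_on_subset[OF assms(1)] assms(2)]] by simp
  then obtain B where "B > 0" "\<forall>y\<in>f ` K. norm y \<le> B" unfolding bounded_pos by blast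
  then have "\<bar>f x\<bar> \<le> B" for x using assms(3)[of x] by (cases "x \<in> K") auto
  then show ?thesis using that \<open>B > 0\<close> by blast
qed

lemma test_bounded:
  assumes "f \<in> test_functions \<Omega>"
  obtains B where "B > 0" "\<And>x. \<bar>f x\<bar> \<le> B"
  using test_functionsE[OF assms] continuous_vanish_bounded[OF smooth_continuous] that by metis

lemma continuous_vanish_integrable:
  fixes f :: "'a::euclidean_space \<Rightarrow> real"
  assumes "continuous_on UNIV f" "compact K" "\<And>x. x \<notin> K \<Longrightarrow> f x = 0"
  shows "integrable lborel f"
proof -
  have "integrable lborel (\<lambda>x. indicator K x *\<^sub>R f x)"
    using assms borel_integrable_compact continuous_on_subset by blast
  moreover have "(\<lambda>x. indicator K x *\<^sub>R f x) = f" using assms(3) by (force simp: indicator_def)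
  ultimately show ?thesis by simp
qed

lemma test_integrable: "f \<in> test_functions \<Omega> \<Longrightarrow> integrable lborel f"
  by (metis continuous_vanish_integrable smooth_continuous test_functionsE)

lemma continuous_vanish_unif_continuous:
  fixes f :: "'a::euclidean_space \<Rightarrow> real"
  assumes f: "continuous_on UNIV f" "compact K" "\<And>x. x \<notin> K \<Longrightarrow> f x = 0" and "e > 0"
  obtains d where "d > 0" "\<And>x y. dist x y < d \<Longrightarrow> \<bar>f x - f y\<bar> < e"
proof -
  obtain R where R: "K \<subseteq> cball 0 R" "R > 0"
    using bounded_subset_ballD[OF compact_imp_bounded[OF assms(2)], of 0] ball_subset_cball by blast
  have "uniformly_continuous_on (cball 0 (R + 1)) f"
    using f(1) by (meson compact_cball compact_uniformly_continuous continuous_on_subset top_greatest)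
  then obtain d where d: "d > 0" "\<forall>x\<in>cball 0 (R+1). \<forall>y\<in>cball 0 (R+1). dist y x < d \<longrightarrow> dist (f y) (f x) < e"
    unfolding uniformly_continuous_on_def using \<open>e > 0\<close> by blast
  have "\<bar>f x - f y\<bar> < e" if "dist x y < min d 1" for x y
  proof (cases "x \<in> K \<or> y \<in> K")
    case True
    have "norm x \<le> norm y + dist x y" "norm y \<le> norm x + dist x y"
      by (metis add.commute dist_0_norm dist_commute dist_triangle)+
    then have "norm x \<le> R + 1" "norm y \<le> R + 1"
      using True R that by (auto simp: subset_iff) 
    then show ?thesis using d(2) that by (auto simp: dist_real_def dist_commute)
  next
    case False
    then show ?thesis using f(3) \<open>e > 0\<close> by auto
  qed
  then show ?thesis using that[of "min d 1"] d(1) by auto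
qed

section \<open>Bump functions\<close>

text \<open>The functions \<open>p (1/t) exp (- 1/t)\<close> for \<open>t > 0\<close>, extended by zero, form a class that is closed under
  differentiation, so that differentiability of its members already gives derivatives of all orders.\<close>

definition exp_recip :: "real poly \<Rightarrow> real \<Rightarrow> real" where
  "exp_recip p t = (if t > 0 then poly p (1/t) * exp (- (1/t)) else 0)"

lemma poly_exp_minus_tendsto_0: "((\<lambda>x. poly p x * exp (- x)) \<longlongrightarrow> (0::real)) at_top"
proof -
  have "((\<lambda>x. \<Sum>i\<le>degree p. coeff p i * (x ^ i / exp x)) \<longlongrightarrow> (\<Sum>i\<le>degree p. coeff p i * 0)) at_top"
    by (intro tendsto_sum tendsto_mult tendsto_const tendsto_power_div_exp_0)
  moreover have "(\<lambda>x. \<Sum>i\<le>degree p. coeff p i * (x ^ i / exp x)) = (\<lambda>x. poly p x * exp (- x))"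
    by (simp add: poly_altdef sum_distrib_right exp_minus divide_inverse mult.assoc)
  ultimately show ?thesis by simp
qed

definition exp_recip_deriv :: "real poly \<Rightarrow> real poly" where
  "exp_recip_deriv p = monom 1 2 * (p - pderiv p)"

lemma exp_recip_deriv: "(exp_recip p has_real_derivative exp_recip (exp_recip_deriv p) t) (at t)"
proof (cases t "0::real" rule: linorder_cases)
  case less
  have "((\<lambda>t. 0) has_real_derivative 0) (at t)" by simp
  then have "((\<lambda>t. 0) has_real_derivative exp_recip (exp_recip_deriv p) t) (at t)"
    using less by (simp add: exp_recip_def)
  moreover have "\<forall>\<^sub>F s in nhds t. 0 = exp_recip p s"
    using eventually_nhds_in_open[of "{..<0}" t] less by (auto elim!: eventually_mono simp: exp_recip_def)
  ultimately show ?thesis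
    using DERIV_cong_ev[of t t "\<lambda>t. 0" "exp_recip p" "exp_recip (exp_recip_deriv p) t"] by simp
next
  case greater
  have "((\<lambda>t. poly p (1/t) * exp (- (1/t))) has_real_derivative exp_recip (exp_recip_deriv p) t) (at t)"
    using greater
    unfolding exp_recip_def exp_recip_deriv_def
    by (auto intro!: derivative_eq_intros DERIV_chain2[OF poly_DERIV]
        simp: poly_monom power2_eq_square divide_inverse algebra_simps)
  moreover have "\<forall>\<^sub>F s in nhds t. poly p (1/s) * exp (- (1/s)) = exp_recip p s"
    using eventually_nhds_in_open[of "{0<..}" t] greater by (auto elim!: eventually_mono simp: exp_recip_def)
  ultimately show ?thesis
    using DERIV_cong_ev[of t t "\<lambda>t. poly p (1/t) * exp (- (1/t))" "exp_recip p" "exp_recip (exp_recip_deriv p) t"]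
    by simp
next
  case equal
  have "((\<lambda>h. poly (pCons 0 p) (inverse h) * exp (- inverse h)) \<longlongrightarrow> 0) (at_right (0::real))"
    by (rule filterlim_compose[OF poly_exp_minus_tendsto_0 filterlim_inverse_at_top_right])
  then have "((\<lambda>h. exp_recip p h / h) \<longlongrightarrow> 0) (at_right 0)"
    by (rule Lim_transform_eventually)
       (auto simp: exp_recip_def eventually_at_filter divide_inverse)
  moreover have "((\<lambda>h. exp_recip p h / h) \<longlongrightarrow> 0) (at_left 0)"
    by (rule Lim_transform_eventually[OF tendsto_const])
       (auto simp: exp_recip_def eventually_at_filter)
  ultimately have "((\<lambda>h. exp_recip p h / h) \<longlongrightarrow> 0) (at 0)"
    using filterlim_split_at by blast
  then show ?thesis using equal by (simp add: DERIV_def exp_recip_def)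
qed

lemma smooth_exp_recip_coord: "smooth (\<lambda>x::real^'n. exp_recip p (c * x $ i + d))"
proof -
  have "C_diff k (\<lambda>x::real^'n. exp_recip p (c * x $ i + d))" for k
  proof (induction k arbitrary: p)
    case 0
    have "continuous_on UNIV (exp_recip p)"
      by (meson DERIV_isCont continuous_at_imp_continuous_on exp_recip_deriv)
    then show ?case
      by (auto intro!: continuous_on_compose2[of UNIV "exp_recip p"] continuous_intros)
  next
    case (Suc k)
    have d: "((\<lambda>x::real^'n. exp_recip p (c * x $ i + d)) has_derivative
        (\<lambda>h. exp_recip (exp_recip_deriv p) (c * x $ i + d) * (c * h $ i))) (at x)" for x
    proof -
      have a: "((\<lambda>x::real^'n. c * x $ i + d) has_derivative (\<lambda>h. c * h $ i)) (at x)"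
      proof -
        have "((\<lambda>x::real^'n. x $ i) has_derivative (\<lambda>h. h $ i)) (at x)"
          by (rule bounded_linear_imp_has_derivative[OF bounded_linear_vec_nth])
        then show ?thesis by (auto intro!: derivative_eq_intros)
      qed
      show ?thesis
        using has_derivative_compose[OF a, of "exp_recip p" "(*) (exp_recip (exp_recip_deriv p) (c * x $ i + d))"]
          exp_recip_deriv[of p "c * x $ i + d"]
        by (simp add: has_field_derivative_def)
    qed
    have "pderiv_at j (\<lambda>x::real^'n. exp_recip p (c * x $ i + d)) =
        (\<lambda>x. (if i = j then c else 0) * exp_recip (exp_recip_deriv p) (c * x $ i + d))" for j
      by (rule ext, subst pderiv_at_eq[OF d]) (auto simp: axis_def)
    moreover have "(\<lambda>x::real^'n. exp_recip p (c * x $ i + d)) differentiable (at x)" for x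
      using d unfolding differentiable_def by blast
    ultimately show ?case
      using Suc by (simp add: C_diff_mult C_diff_const)
  qed
  then show ?thesis by (simp add: smooth_def)
qed

text \<open>Products of the function \<open>exp (- 1/t)\<close> over the faces of a box. The steepness \<open>c\<close> is a parameter
  because the limit for \<open>c \<rightarrow> \<infinity>\<close> is the indicator function of the box, through which statements about
  test functions become statements about boxes.\<close>

definition box_bump :: "real \<Rightarrow> real^'n \<Rightarrow> real^'n \<Rightarrow> real^'n \<Rightarrow> real" where
  "box_bump c a b x = (\<Prod>i\<in>UNIV. exp_recip 1 (c * (x $ i - a $ i)) * exp_recip 1 (c * (b $ i - x $ i)))"

lemma exp_recip_1: "exp_recip 1 t = (if t > 0 then exp (- (1/t)) else 0)"
  by (simp add: exp_recip_def)

lemma smooth_box_bump: "smooth (box_bump c a b)"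
proof -
  have "box_bump c a b = (\<lambda>x. \<Prod>i\<in>UNIV. exp_recip 1 (c * x $ i + (- c * a $ i)) * exp_recip 1 ((- c) * x $ i + c * b $ i))"
    by (auto simp: box_bump_def algebra_simps fun_eq_iff)
  moreover have "smooth \<dots>" by (intro smooth_prod smooth_mult smooth_exp_recip_coord)
  ultimately show ?thesis by simp
qed

lemma box_bump_nonneg: "0 \<le> box_bump c a b x"
  by (auto simp: box_bump_def exp_recip_1 intro!: prod_nonneg)

lemma box_bump_le_1: "box_bump c a b x \<le> 1"
  unfolding box_bump_def by (intro prod_le_1) (auto simp: exp_recip_1 intro!: mult_le_one)

lemma box_bump_pos: "c > 0 \<Longrightarrow> x \<in> box a b \<Longrightarrow> 0 < box_bump c a b x"
  by (auto simp: box_bump_def exp_recip_1 mem_box_cart intro!: prod_pos)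

lemma box_bump_eq_0:
  assumes "c > 0" "x \<notin> box a b" shows "box_bump c a b x = 0"
proof -
  obtain i where "\<not> (a $ i < x $ i \<and> x $ i < b $ i)" using assms by (auto simp: mem_box_cart)
  then have "exp_recip 1 (c * (x $ i - a $ i)) * exp_recip 1 (c * (b $ i - x $ i)) = 0"
    using assms(1) by (auto simp: exp_recip_1 zero_less_mult_iff)
  then show ?thesis by (auto simp: box_bump_def intro!: prod_zero bexI[of _ i])
qed

lemma test_box_bump: "c > 0 \<Longrightarrow> cbox a b \<subseteq> \<Omega> \<Longrightarrow> box_bump c a b \<in> test_functions \<Omega>"
  by (rule test_functionsI[of _ "cbox a b"])
     (auto simp: smooth_box_bump intro: box_bump_eq_0 dest: subsetD[OF box_subset_cbox])

lemma box_bump_tendsto: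
  "(\<lambda>n. box_bump (real (Suc n)) a b x) \<longlonglongrightarrow> indicator (box a b) x"
proof (cases "x \<in> box a b")
  case True
  have "(\<lambda>n. exp_recip 1 (real (Suc n) * t)) \<longlonglongrightarrow> 1" if "t > 0" for t
  proof -
    have "(\<lambda>n. exp (- (inverse (real (Suc n)) * (1/t)))) \<longlonglongrightarrow> exp (- (0 * (1/t)))"
      by (intro tendsto_intros LIMSEQ_inverse_real_of_nat)
    moreover have "exp_recip 1 (real (Suc n) * t) = exp (- (inverse (real (Suc n)) * (1/t)))" for n
      using that by (simp add: exp_recip_1 divide_inverse)
    ultimately show ?thesis by simp
  qed
  then have "(\<lambda>n. box_bump (real (Suc n)) a b x) \<longlonglongrightarrow> (\<Prod>i\<in>(UNIV::'a set). 1 * 1)"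
    unfolding box_bump_def using True by (intro tendsto_prod tendsto_mult) (auto simp: mem_box_cart)
  then show ?thesis using True by simp
next
  case False
  then show ?thesis by (simp add: box_bump_eq_0)
qed

lemma mollifier_exists:
  assumes "r > 0"
  obtains \<rho> where "\<rho> \<in> test_functions UNIV" "\<And>x. \<rho> x \<ge> 0" "(\<integral>x. \<rho> x \<partial>lborel) = 1"
    "\<And>x. x \<notin> ball (p::real^'n) r \<Longrightarrow> \<rho> x = 0"
proof -
  obtain a b where ab: "p \<in> box a b" "box a b \<subseteq> ball p r"
    using rational_boxes[of r p] assms by metis
  define f where "f = box_bump 1 a b"
  have f: "f \<in> test_functions UNIV" unfolding f_def by (intro test_box_bump) auto
  have f0: "f x \<ge> 0" for x by (simp add: f_def box_bump_nonneg)
  have int: "integrable lborel f" using f by (rule test_integrable)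
  have "(\<integral>x. f x \<partial>lborel) \<noteq> 0"
  proof
    assume "(\<integral>x. f x \<partial>lborel) = 0"
    then have "AE x in lborel. f x = 0"
      using integral_nonneg_eq_0_iff_AE[OF int] f0 by simp
    then have "AE x in lborel. x \<notin> box a b"
      by eventually_elim (use box_bump_pos[of 1 _ a b] in \<open>force simp: f_def\<close>)
    then have "box a b \<in> null_sets lborel" by (auto simp: AE_iff_null_sets)
    then show False using ab(1) open_not_negligible[of "box a b"] 
      by (auto simp: negligible_iff_null_sets intro: null_sets_completionI)
  qed
  moreover have "(\<integral>x. f x \<partial>lborel) \<ge> 0" using f0 by (intro Bochner_Integration.integral_nonneg)
  ultimately have pos: "(\<integral>x. f x \<partial>lborel) > 0" by simp
  show ?thesis
  proof
    show "(\<lambda>x. (1 / (\<integral>x. f x \<partial>lborel)) * f x) \<in> test_functions UNIV" using f by (rule test_cmult)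
    show "(1 / (\<integral>x. f x \<partial>lborel)) * f x \<ge> 0" for x using pos f0 by simp
    show "(\<integral>x. (1 / (\<integral>x. f x \<partial>lborel)) * f x \<partial>lborel) = 1"
      using pos by (subst integral_mult_right_zero) simp
    show "(1 / (\<integral>x. f x \<partial>lborel)) * f x = 0" if "x \<notin> ball p r" for x
      using that ab box_bump_eq_0[of 1 x a b] by (metis f_def mult_zero_right subsetD zero_less_one)
  qed
qed

section \<open>Integration by parts against test functions\<close>

lemma nn_integral_lborel_shift:
  fixes f :: "'a::euclidean_space \<Rightarrow> ennreal"
  assumes [measurable]: "f \<in> borel_measurable borel"
  shows "(\<integral>\<^sup>+x. f (x + a) \<partial>lborel) = (\<integral>\<^sup>+x. f x \<partial>lborel)"
proof -
  have "(\<integral>\<^sup>+x. f x \<partial>lborel) = (\<integral>\<^sup>+x. f x \<partial>distr lborel borel ((+) a))"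
    by (simp add: lborel_distr_plus)
  also have "\<dots> = (\<integral>\<^sup>+x. f (x + a) \<partial>lborel)"
    by (subst nn_integral_distr) (auto simp: add.commute)
  finally show ?thesis by simp
qed

lemma integral_lborel_shift:
  fixes f :: "'a::euclidean_space \<Rightarrow> real"
  assumes [measurable]: "f \<in> borel_measurable borel"
  shows "(\<integral>x. f (x + a) \<partial>lborel) = (\<integral>x. f x \<partial>lborel)"
proof -
  have "(\<integral>x. f x \<partial>lborel) = (\<integral>x. f x \<partial>distr lborel borel ((+) a))"
    by (simp add: lborel_distr_plus)
  also have "\<dots> = (\<integral>x. f (x + a) \<partial>lborel)"
    by (subst integral_distr) (auto simp: add.commute)
  finally show ?thesis by simp
qed

lemma integrable_lborel_shift:
  fixes f :: "'a::euclidean_space \<Rightarrow> real"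
  assumes "integrable lborel f"
  shows "integrable lborel (\<lambda>x. f (x + a))"
proof -
  have "integrable (distr lborel borel ((+) a)) f" using assms by (simp add: lborel_distr_plus)
  then have "integrable lborel (\<lambda>x. f (a + x))" by (rule integrable_distr[rotated]) simp
  then show ?thesis by (simp only: add.commute)
qed

lemma lborel_distr_reflect:
  fixes a :: "'a::euclidean_space"
  shows "distr lborel borel (\<lambda>x. a - x) = lborel"
  using lborel_affine[of "-1" a] by (simp add: density_1)

lemma integral_lborel_reflect:
  fixes f :: "'a::euclidean_space \<Rightarrow> real"
  assumes [measurable]: "f \<in> borel_measurable borel"
  shows "(\<integral>x. f (a - x) \<partial>lborel) = (\<integral>x. f x \<partial>lborel)"
proof -
  have "(\<integral>x. f x \<partial>lborel) = (\<integral>x. f x \<partial>distr lborel borel (\<lambda>x. a - x))"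
    by (simp add: lborel_distr_reflect)
  also have "\<dots> = (\<integral>x. f (a - x) \<partial>lborel)"
    by (subst integral_distr) auto
  finally show ?thesis by simp
qed

text \<open>The integral of a difference quotient vanishes by translation invariance, and the quotients
  converge dominatedly to the directional derivative.\<close>

lemma integral_directional_derivative_eq_0:
  fixes f f' :: "'a::euclidean_space \<Rightarrow> real"
  assumes f: "continuous_on UNIV f" and f': "continuous_on UNIV f'"
    and K: "compact K" "\<And>x. x \<notin> K \<Longrightarrow> f x = 0" "\<And>x. x \<notin> K \<Longrightarrow> f' x = 0"
    and d: "\<And>x. ((\<lambda>t. f (x + t *\<^sub>R e)) has_real_derivative f' x) (at 0)"
  shows "(\<integral>x. f' x \<partial>lborel) = 0"
proof -
  have d': "((\<lambda>t. f (x + t *\<^sub>R e)) has_real_derivative f' (x + t *\<^sub>R e)) (at t)" for x t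
  proof -
    have "((\<lambda>s. f (x + (s + t) *\<^sub>R e)) has_real_derivative f' (x + t *\<^sub>R e)) (at 0)"
      using d[of "x + t *\<^sub>R e"] by (simp add: algebra_simps)
    then show ?thesis
      using DERIV_shift[of "\<lambda>t. f (x + t *\<^sub>R e)" "f' (x + t *\<^sub>R e)" 0 t] by simp
  qed
  obtain B where B: "B > 0" "\<And>x. \<bar>f' x\<bar> \<le> B"
    using continuous_vanish_bounded[OF f' K(1,3)] by metis
  obtain R where R: "K \<subseteq> cball 0 R" 
    using bounded_subset_ballD[OF compact_imp_bounded[OF K(1)], of 0] ball_subset_cball by blast
  have [measurable]: "f \<in> borel_measurable borel" "f' \<in> borel_measurable borel"
    using f f' by (auto intro: borel_measurable_continuous_onI)
  define h where "h n = inverse (real (Suc n))" for n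
  have h: "h n > 0" "h n \<le> 1" for n by (auto simp: h_def field_simps)
  define q where "q n x = (f (x + h n *\<^sub>R e) - f x) / h n" for n x
  define W where "W = cball (0::'a) (R + norm e)"
  have q_bound: "\<bar>q n x\<bar> \<le> B * indicator W x" for n x
  proof (cases "x \<in> W")
    case True
    obtain t where "0 < t" "t < h n" "f (x + h n *\<^sub>R e) - f (x + 0 *\<^sub>R e) = (h n - 0) * f' (x + t *\<^sub>R e)"
      using MVT2[of 0 "h n" "\<lambda>t. f (x + t *\<^sub>R e)" "\<lambda>t. f' (x + t *\<^sub>R e)"] h d' by blast
    then have "q n x = f' (x + t *\<^sub>R e)" using h[of n] by (simp add: q_def)
    then show ?thesis using B True by simp
  next
    case False
    have "norm x \<le> norm (x + h n *\<^sub>R e) + norm (h n *\<^sub>R e)"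
      using norm_triangle_ineq4[of "x + h n *\<^sub>R e" "h n *\<^sub>R e"] by simp
    moreover have "norm (h n *\<^sub>R e) \<le> norm e" using h[of n] by (simp add: mult_left_le_one_le)
    ultimately have "norm x > R" "norm (x + h n *\<^sub>R e) > R"
      using False norm_ge_zero[of e] unfolding W_def mem_cball dist_0_norm by linarith+
    then have "x \<notin> K" "x + h n *\<^sub>R e \<notin> K" using R by (auto simp: subset_iff)
    then show ?thesis using K(2) B(1) by (simp add: q_def)
  qed
  have h0: "h \<longlonglongrightarrow> 0" unfolding h_def by (rule LIMSEQ_inverse_real_of_nat)
  have "(\<lambda>n. q n x) \<longlonglongrightarrow> f' x" for x
  proof -
    have "((\<lambda>t. (f (x + t *\<^sub>R e) - f x) / t) \<longlongrightarrow> f' x) (at 0)"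
      using d[of x] by (simp add: DERIV_def)
    moreover have "filterlim h (at 0) sequentially"
      using h0 h(1) by (auto simp: filterlim_at intro!: always_eventually) (metis less_irrefl)
    ultimately show ?thesis unfolding q_def by (rule filterlim_compose)
  qed
  then have "(\<lambda>n. \<integral>x. q n x \<partial>lborel) \<longlonglongrightarrow> (\<integral>x. f' x \<partial>lborel)"
    using q_bound
    by (intro integral_dominated_convergence[where w="\<lambda>x. B * indicator W x"])
       (auto simp: q_def W_def intro!: integrable_mult_right integrable_real_indicator emeasure_lborel_cball_finite)
  moreover have "(\<integral>x. q n x \<partial>lborel) = 0" for n
  proof -
    have int: "integrable lborel f" using continuous_vanish_integrable[OF f K(1,2)] .
    have "integrable lborel (\<lambda>x. f (x + h n *\<^sub>R e))"
      by (rule integrable_lborel_shift[OF int])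
    then have "(\<integral>x. f (x + h n *\<^sub>R e) - f x \<partial>lborel) = 0"
      using int integral_lborel_shift[of f "h n *\<^sub>R e"] by (subst Bochner_Integration.integral_diff) auto
    then show ?thesis by (simp add: q_def)
  qed
  ultimately show ?thesis by (simp add: LIMSEQ_const_iff)
qed

lemma smooth_directional_derivative:
  assumes "smooth f"
  shows "((\<lambda>t. f (x + t *\<^sub>R axis i 1)) has_real_derivative pderiv_at i f (x + t *\<^sub>R axis i 1)) (at t)"
proof -
  have a: "((\<lambda>t. x + t *\<^sub>R axis i 1) has_derivative (\<lambda>h. h *\<^sub>R axis i 1)) (at t)"
    by (auto intro!: derivative_eq_intros)
  have b: "(f has_derivative frechet_derivative f (at (x + t *\<^sub>R axis i 1))) (at (x + t *\<^sub>R axis i 1))"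
    using smooth_differentiable[OF assms] frechet_derivative_works by blast
  have "linear (frechet_derivative f (at (x + t *\<^sub>R axis i 1)))"
    using smooth_differentiable[OF assms] by (rule linear_frechet_derivative)
  then have "(\<lambda>h. frechet_derivative f (at (x + t *\<^sub>R axis i 1)) (h *\<^sub>R axis i 1)) = (*) (pderiv_at i f (x + t *\<^sub>R axis i 1))"
    by (auto simp: pderiv_at_def linear_scale mult.commute)
  then show ?thesis
    using has_derivative_compose[OF a b] by (simp add: has_field_derivative_def)
qed

lemma integral_by_parts_test:
  assumes u: "continuous_on UNIV u" and g: "continuous_on UNIV g"
    and d: "\<And>x. ((\<lambda>t. u (x + t *\<^sub>R axis i 1)) has_real_derivative g x) (at 0)"
    and \<eta>: "\<eta> \<in> test_functions UNIV"
  shows "(\<integral>x. u x * pderiv_at i \<eta> x \<partial>lborel) = - (\<integral>x. g x * \<eta> x \<partial>lborel)"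
proof -
  obtain K where K: "smooth \<eta>" "compact K" "\<And>x. x \<notin> K \<Longrightarrow> \<eta> x = 0"
    using \<eta> by (metis test_functionsE)
  have K': "pderiv_at i \<eta> x = 0" if "x \<notin> K" for x
    by (rule pderiv_at_vanish[OF compact_imp_closed[OF K(2)] _ that]) (rule K(3))
  have c: "continuous_on UNIV \<eta>" "continuous_on UNIV (pderiv_at i \<eta>)"
    using K by (auto intro: smooth_continuous smooth_pderiv_at)
  have "(\<integral>x. u x * pderiv_at i \<eta> x + g x * \<eta> x \<partial>lborel) = 0"
  proof (rule integral_directional_derivative_eq_0[where f="\<lambda>x. u x * \<eta> x" and K=K])
    show "((\<lambda>t. u (x + t *\<^sub>R axis i 1) * \<eta> (x + t *\<^sub>R axis i 1)) has_real_derivative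
        u x * pderiv_at i \<eta> x + g x * \<eta> x) (at 0)" for x
      using DERIV_mult[OF d smooth_directional_derivative[OF K(1), of x i 0], of x]
      by (simp add: algebra_simps)
  qed (use u g c K K' in \<open>auto intro!: continuous_intros\<close>)
  moreover have "integrable lborel (\<lambda>x. u x * pderiv_at i \<eta> x)" "integrable lborel (\<lambda>x. g x * \<eta> x)"
    by (rule continuous_vanish_integrable[OF _ K(2)]; use u g c K K' in \<open>auto intro!: continuous_intros\<close>)+
  ultimately show ?thesis by simp
qed

lemma integral_by_parts_smooth:
  assumes "smooth u" "\<eta> \<in> test_functions UNIV"
  shows "(\<integral>x. u x * pderiv_at i \<eta> x \<partial>lborel) = - (\<integral>x. pderiv_at i u x * \<eta> x \<partial>lborel)"
  using smooth_directional_derivative[OF assms(1), of _ i 0]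
  by (intro integral_by_parts_test) (auto intro: assms smooth_continuous smooth_pderiv_at)

section \<open>Convergence in the mean\<close>

text \<open>Convergence is always expressed by the integral of the squared difference, for functions and not for
  equivalence classes, which is the form in which the Sobolev norms are given.\<close>

definition l2 :: "'a measure \<Rightarrow> ('a \<Rightarrow> real) set" where
  "l2 M = {f \<in> borel_measurable M. integrable M (\<lambda>x. (f x)\<^sup>2)}"

definition l2_lim :: "'a measure \<Rightarrow> (nat \<Rightarrow> 'a \<Rightarrow> real) \<Rightarrow> ('a \<Rightarrow> real) \<Rightarrow> bool" where
  "l2_lim M F f \<longleftrightarrow> (\<forall>n. F n \<in> l2 M) \<and> f \<in> l2 M \<and> (\<lambda>n. \<integral>x. (f x - F n x)\<^sup>2 \<partial>M) \<longlonglongrightarrow> 0"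

lemma l2_measurable: "f \<in> l2 M \<Longrightarrow> f \<in> borel_measurable M"
  by (simp add: l2_def)

lemma l2_mult_integrable:
  assumes "f \<in> l2 M" "g \<in> l2 M"
  shows "integrable M (\<lambda>x. f x * g x)"
proof (rule Bochner_Integration.integrable_bound[where f="\<lambda>x. (f x)\<^sup>2 + (g x)\<^sup>2"])
  have "2 * (\<bar>a\<bar> * \<bar>b\<bar>) \<le> a\<^sup>2 + b\<^sup>2" for a b :: real
    using sum_squares_bound[of "\<bar>a\<bar>" "\<bar>b\<bar>"] by simp
  then have "\<bar>a\<bar> * \<bar>b\<bar> \<le> a\<^sup>2 + b\<^sup>2" for a b :: real
    using mult_nonneg_nonneg[OF abs_ge_zero[of a] abs_ge_zero[of b]] by (smt (verit, best))
  then show "AE x in M. norm (f x * g x) \<le> norm ((f x)\<^sup>2 + (g x)\<^sup>2)"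
    by (auto simp: abs_mult)
qed (use assms in \<open>auto simp: l2_def\<close>)

lemma l2_add: "f \<in> l2 M \<Longrightarrow> g \<in> l2 M \<Longrightarrow> (\<lambda>x. f x + g x) \<in> l2 M"
  using l2_mult_integrable[of f M g] by (auto simp: l2_def power2_sum mult.assoc)

lemma l2_cmult: "f \<in> l2 M \<Longrightarrow> (\<lambda>x. c * f x) \<in> l2 M"
  by (auto simp: l2_def power_mult_distrib)

lemma l2_minus: "f \<in> l2 M \<Longrightarrow> (\<lambda>x. - f x) \<in> l2 M"
  by (auto simp: l2_def)

lemma l2_diff: "f \<in> l2 M \<Longrightarrow> g \<in> l2 M \<Longrightarrow> (\<lambda>x. f x - g x) \<in> l2 M"
  using l2_add[of f M "\<lambda>x. - g x"] l2_minus by auto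

lemma l2_zero: "(\<lambda>x. 0) \<in> l2 M"
  by (auto simp: l2_def)

lemma l2_bounded_mult:
  assumes "f \<in> l2 M" "h \<in> borel_measurable M" "\<And>x. \<bar>h x\<bar> \<le> B"
  shows "(\<lambda>x. h x * f x) \<in> l2 M"
proof -
  have "integrable M (\<lambda>x. (h x * f x)\<^sup>2)"
  proof (rule Bochner_Integration.integrable_bound[where f="\<lambda>x. B\<^sup>2 * (f x)\<^sup>2"])
    have "(h x * f x)\<^sup>2 \<le> B\<^sup>2 * (f x)\<^sup>2" for x
      using assms(3)[of x] by (auto simp: power_mult_distrib abs_le_square_iff[symmetric] intro!: mult_right_mono)
    then show "AE x in M. norm ((h x * f x)\<^sup>2) \<le> norm (B\<^sup>2 * (f x)\<^sup>2)" by auto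
  qed (use assms in \<open>auto simp: l2_def\<close>)
  then show ?thesis using assms by (auto simp: l2_def)
qed

text \<open>The quadratic polynomial \<open>t \<mapsto> \<integral>(f - t g)\<^sup>2\<close> is nonnegative, hence its discriminant is not positive.\<close>

lemma l2_cauchy_schwarz:
  assumes f: "f \<in> l2 M" and g: "g \<in> l2 M"
  shows "(\<integral>x. f x * g x \<partial>M)\<^sup>2 \<le> (\<integral>x. (f x)\<^sup>2 \<partial>M) * (\<integral>x. (g x)\<^sup>2 \<partial>M)"
proof -
  define A B C where "A = (\<integral>x. (f x)\<^sup>2 \<partial>M)" and "B = (\<integral>x. (g x)\<^sup>2 \<partial>M)" and "C = (\<integral>x. f x * g x \<partial>M)"
  have q: "A - 2 * t * C + t\<^sup>2 * B \<ge> 0" for t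
  proof -
    have "0 \<le> (\<integral>x. (f x - t * g x)\<^sup>2 \<partial>M)" by simp
    also have "(\<lambda>x. (f x - t * g x)\<^sup>2) = (\<lambda>x. (f x)\<^sup>2 - 2 * t * (f x * g x) + t\<^sup>2 * (g x)\<^sup>2)"
      by (auto simp: power2_eq_square algebra_simps)
    also have "(\<integral>x. (f x)\<^sup>2 - 2 * t * (f x * g x) + t\<^sup>2 * (g x)\<^sup>2 \<partial>M) = A - 2 * t * C + t\<^sup>2 * B"
      using l2_mult_integrable[OF f g] f g by (simp add: A_def B_def C_def l2_def)
    finally show ?thesis .
  qed
  have "B \<ge> 0" by (simp add: B_def)
  show ?thesis unfolding A_def[symmetric] B_def[symmetric] C_def[symmetric]
  proof (cases "B = 0")
    case True
    have "C = 0"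
    proof (rule ccontr)
      assume "C \<noteq> 0"
      then show False using q[of "(A + 1) / (2 * C)"] True by simp
    qed
    then show "C\<^sup>2 \<le> A * B" using True by simp
  next
    case False
    then have "B > 0" using \<open>B \<ge> 0\<close> by simp
    have "A - 2 * (C/B) * C + (C/B)\<^sup>2 * B = A - C\<^sup>2 / B"
      using \<open>B > 0\<close> by (simp add: field_simps power2_eq_square)
    then have "C\<^sup>2 / B \<le> A" using q[of "C/B"] by simp
    then show "C\<^sup>2 \<le> A * B" using \<open>B > 0\<close> by (simp add: pos_divide_le_eq)
  qed
qed

lemma l2_lim_const: "f \<in> l2 M \<Longrightarrow> l2_lim M (\<lambda>n. f) f"
  by (simp add: l2_lim_def)

lemma square_sum_le: "(a + b)\<^sup>2 \<le> 2 * a\<^sup>2 + 2 * (b::real)\<^sup>2"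
  using sum_squares_bound[of a b] by (simp add: power2_sum)

lemma integral_square_sum_le:
  assumes "f \<in> l2 M" "g \<in> l2 M"
  shows "(\<integral>x. (f x + g x)\<^sup>2 \<partial>M) \<le> 2 * (\<integral>x. (f x)\<^sup>2 \<partial>M) + 2 * (\<integral>x. (g x)\<^sup>2 \<partial>M)"
proof -
  have "(\<integral>x. (f x + g x)\<^sup>2 \<partial>M) \<le> (\<integral>x. 2 * (f x)\<^sup>2 + 2 * (g x)\<^sup>2 \<partial>M)"
    using assms l2_add[OF assms] by (intro integral_mono) (auto simp: l2_def square_sum_le)
  also have "\<dots> = 2 * (\<integral>x. (f x)\<^sup>2 \<partial>M) + 2 * (\<integral>x. (g x)\<^sup>2 \<partial>M)"
    using assms by (simp add: l2_def)
  finally show ?thesis .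
qed

lemma l2_lim_add:
  assumes "l2_lim M F f" "l2_lim M G g"
  shows "l2_lim M (\<lambda>n x. F n x + G n x) (\<lambda>x. f x + g x)"
proof -
  have F: "F n \<in> l2 M" "f \<in> l2 M" "G n \<in> l2 M" "g \<in> l2 M" for n using assms by (auto simp: l2_lim_def)
  have "(\<lambda>n. \<integral>x. ((f x + g x) - (F n x + G n x))\<^sup>2 \<partial>M) \<longlonglongrightarrow> 0"
  proof (rule tendsto_sandwich[OF _ _ tendsto_const])
    show "(\<lambda>n. 2 * (\<integral>x. (f x - F n x)\<^sup>2 \<partial>M) + 2 * (\<integral>x. (g x - G n x)\<^sup>2 \<partial>M)) \<longlonglongrightarrow> 0"
      using assms by (auto simp: l2_lim_def intro!: tendsto_eq_intros)
    have "(\<integral>x. ((f x + g x) - (F n x + G n x))\<^sup>2 \<partial>M) \<le>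
        2 * (\<integral>x. (f x - F n x)\<^sup>2 \<partial>M) + 2 * (\<integral>x. (g x - G n x)\<^sup>2 \<partial>M)" for n
      using integral_square_sum_le[OF l2_diff[OF F(2,1)] l2_diff[OF F(4,3)], of n n] by (simp add: algebra_simps)
    then show "\<forall>\<^sub>F n in sequentially. (\<integral>x. ((f x + g x) - (F n x + G n x))\<^sup>2 \<partial>M) \<le>
        2 * (\<integral>x. (f x - F n x)\<^sup>2 \<partial>M) + 2 * (\<integral>x. (g x - G n x)\<^sup>2 \<partial>M)" by simp
  qed simp
  then show ?thesis using F by (auto simp: l2_lim_def intro: l2_add)
qed

lemma l2_lim_cmult:
  assumes "l2_lim M F f"
  shows "l2_lim M (\<lambda>n x. c * F n x) (\<lambda>x. c * f x)"
proof -
  have "(\<lambda>n. c\<^sup>2 * (\<integral>x. (f x - F n x)\<^sup>2 \<partial>M)) \<longlonglongrightarrow> c\<^sup>2 * 0"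
    using assms by (intro tendsto_intros) (auto simp: l2_lim_def)
  moreover have "(\<integral>x. (c * f x - c * F n x)\<^sup>2 \<partial>M) = c\<^sup>2 * (\<integral>x. (f x - F n x)\<^sup>2 \<partial>M)" for n
    by (simp add: right_diff_distrib[symmetric] power_mult_distrib)
  ultimately show ?thesis using assms by (auto simp: l2_lim_def intro: l2_cmult)
qed

lemma l2_lim_minus: "l2_lim M F f \<Longrightarrow> l2_lim M (\<lambda>n x. - F n x) (\<lambda>x. - f x)"
  using l2_lim_cmult[of M F f "-1"] by simp

lemma l2_lim_diff: "l2_lim M F f \<Longrightarrow> l2_lim M G g \<Longrightarrow> l2_lim M (\<lambda>n x. F n x - G n x) (\<lambda>x. f x - g x)"
  using l2_lim_add[of M F f "\<lambda>n x. - G n x" "\<lambda>x. - g x"] l2_lim_minus[of M G g] by simp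

lemma l2_lim_inner:
  assumes "l2_lim M F f" "l2_lim M G g"
  shows "(\<lambda>n. \<integral>x. F n x * G n x \<partial>M) \<longlonglongrightarrow> (\<integral>x. f x * g x \<partial>M)"
proof -
  have F: "F n \<in> l2 M" "f \<in> l2 M" "G n \<in> l2 M" "g \<in> l2 M" for n using assms by (auto simp: l2_lim_def)
  have *: "(\<lambda>n. \<integral>x. H n x * K n x \<partial>M) \<longlonglongrightarrow> 0"
    if "(\<lambda>n. (\<integral>x. (H n x)\<^sup>2 \<partial>M) * (\<integral>x. (K n x)\<^sup>2 \<partial>M)) \<longlonglongrightarrow> 0" "\<And>n. H n \<in> l2 M" "\<And>n. K n \<in> l2 M" for H K
  proof -
    have "(\<lambda>n. (\<integral>x. H n x * K n x \<partial>M)\<^sup>2) \<longlonglongrightarrow> 0"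
      by (rule tendsto_sandwich[OF _ _ tendsto_const that(1)]) (auto simp: l2_cauchy_schwarz that)
    then show ?thesis by simp
  qed
  have D: "(\<lambda>x. f x - F n x) \<in> l2 M" "(\<lambda>x. g x - G n x) \<in> l2 M" for n using F by (auto intro: l2_diff)
  have t: "(\<lambda>n. \<integral>x. (f x - F n x)\<^sup>2 \<partial>M) \<longlonglongrightarrow> 0" "(\<lambda>n. \<integral>x. (g x - G n x)\<^sup>2 \<partial>M) \<longlonglongrightarrow> 0"
    using assms by (auto simp: l2_lim_def)
  have "(\<lambda>n. (\<integral>x. f x * g x \<partial>M) - (\<integral>x. (f x - F n x) * g x \<partial>M) - (\<integral>x. f x * (g x - G n x) \<partial>M)
        + (\<integral>x. (f x - F n x) * (g x - G n x) \<partial>M)) \<longlonglongrightarrow> (\<integral>x. f x * g x \<partial>M) - 0 - 0 + 0"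
    by (intro tendsto_intros *; (rule F D)?)
       (use t in \<open>auto intro!: tendsto_eq_intros\<close>)
  moreover have "(\<integral>x. f x * g x \<partial>M) - (\<integral>x. (f x - F n x) * g x \<partial>M) - (\<integral>x. f x * (g x - G n x) \<partial>M)
        + (\<integral>x. (f x - F n x) * (g x - G n x) \<partial>M) = (\<integral>x. F n x * G n x \<partial>M)" for n
  proof -
    have "F n x * G n x = f x * g x - (f x - F n x) * g x - f x * (g x - G n x) + (f x - F n x) * (g x - G n x)" for x
      by (simp add: algebra_simps)
    then have "(\<integral>x. F n x * G n x \<partial>M) = (\<integral>x. f x * g x - (f x - F n x) * g x - f x * (g x - G n x) + (f x - F n x) * (g x - G n x) \<partial>M)"
      by simp
    then show ?thesis
      using F D by (simp add: l2_mult_integrable)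
  qed
  ultimately show ?thesis by simp
qed

lemma l2_lim_square:
  "l2_lim M F f \<Longrightarrow> (\<lambda>n. \<integral>x. (F n x)\<^sup>2 \<partial>M) \<longlonglongrightarrow> (\<integral>x. (f x)\<^sup>2 \<partial>M)"
  using l2_lim_inner[of M F f F f] by (simp add: power2_eq_square)

lemma l2_integral_square_eq_0:
  assumes "f \<in> l2 M" "(\<integral>x. (f x)\<^sup>2 \<partial>M) = 0"
  shows "AE x in M. f x = 0"
  using assms integral_nonneg_eq_0_iff_AE[of M "\<lambda>x. (f x)\<^sup>2"] by (auto simp: l2_def)

lemma l2_lim_unique:
  assumes "l2_lim M F f" "l2_lim M F g"
  shows "AE x in M. f x = g x"
proof -
  have "l2_lim M (\<lambda>n x. 0) (\<lambda>x. f x - g x)" using l2_lim_diff[OF assms] by simp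
  then have "(\<lambda>x. f x - g x) \<in> l2 M" "(\<integral>x. (f x - g x)\<^sup>2 \<partial>M) = 0"
    by (auto simp: l2_lim_def LIMSEQ_const_iff)
  from l2_integral_square_eq_0[OF this] show ?thesis by eventually_elim simp
qed

lemma l2_cong_AE:
  assumes "f \<in> l2 M" "AE x in M. f x = g x" "g \<in> borel_measurable M"
  shows "g \<in> l2 M"
proof -
  have "integrable M (\<lambda>x. (g x)\<^sup>2)"
    by (rule integrable_cong_AE_imp[of M "\<lambda>x. (f x)\<^sup>2"]) (use assms in \<open>auto simp: l2_def\<close>)
  then show ?thesis using assms by (simp add: l2_def)
qed

lemma l2_lim_cong_AE:
  assumes "l2_lim M F f" "AE x in M. f x = g x" "g \<in> borel_measurable M"
  shows "l2_lim M F g"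
proof -
  have "f \<in> l2 M" "F n \<in> l2 M" for n using assms by (auto simp: l2_lim_def)
  then have [measurable]: "f \<in> borel_measurable M" "F n \<in> borel_measurable M" for n by (auto intro: l2_measurable)
  note [measurable] = assms(3)
  have "(\<integral>x. (f x - F n x)\<^sup>2 \<partial>M) = (\<integral>x. (g x - F n x)\<^sup>2 \<partial>M)" for n
    using assms(2) by (intro integral_cong_AE) auto
  then show ?thesis using assms l2_cong_AE[of f M g] by (auto simp: l2_lim_def)
qed

text \<open>On a set of finite measure convergence in the quadratic mean implies convergence in the mean, by
  testing against the indicator function of the set.\<close>

lemma l2_lim_tendsto_L1:
  assumes "l2_lim M F f" "S \<in> sets M" "emeasure M S < \<infinity>"
  shows "(\<lambda>n. \<integral>x. indicator S x * \<bar>f x - F n x\<bar> \<partial>M) \<longlonglongrightarrow> 0"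
proof -
  have "(\<lambda>x. (indicator S x)\<^sup>2) = (indicator S :: 'a \<Rightarrow> real)" by (auto simp: indicator_def)
  then have S: "indicator S \<in> l2 M"
    using assms by (auto simp: l2_def)
  have "l2_lim M (\<lambda>n x. f x - F n x) (\<lambda>x. f x - f x)"
    using assms by (intro l2_lim_diff l2_lim_const) (auto simp: l2_lim_def)
  then have "l2_lim M (\<lambda>n x. \<bar>f x - F n x\<bar>) (\<lambda>x. 0)"
    by (auto simp: l2_lim_def l2_def power2_commute[of "f _" "F _ _"] intro!: borel_measurable_abs)
  then show ?thesis using l2_lim_inner[OF l2_lim_const[OF S]] by force
qed

section \<open>The fundamental lemma of the calculus of variations\<close>

text \<open>The positive and the negative part of \<open>f\<close> are densities of finite measures which agree on all boxes.
  Boxes generate the Borel sets and are closed under intersection, so the measures and therefore the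
  densities coincide.\<close>

lemma AE_zero_if_integral_box_zero:
  fixes f :: "'a::euclidean_space \<Rightarrow> real"
  assumes f: "integrable lborel f" and z: "\<And>a b. (\<integral>x. indicator (box a b) x * f x \<partial>lborel) = 0"
  shows "AE x in lborel. f x = 0"
proof -
  have [measurable]: "f \<in> borel_measurable borel" using f by auto
  define p m where "p x = max (f x) 0" and "m x = max (- f x) 0" for x
  have pm [measurable]: "p \<in> borel_measurable borel" "m \<in> borel_measurable borel"
    unfolding p_def m_def by measurable
  have i: "integrable lborel p" "integrable lborel m"
    using f unfolding p_def m_def by (auto intro!: integrable_max)
  have nn: "p x \<ge> 0" "m x \<ge> 0" for x by (auto simp: p_def m_def)
  have box: "emeasure (density lborel p) (box a b) = emeasure (density lborel m) (box a b)" for a b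
  proof -
    have *: "(\<integral>\<^sup>+x. ennreal (g x) * indicator (box a b) x \<partial>lborel) = ennreal (\<integral>x. indicator (box a b) x * g x \<partial>lborel)"
      if "integrable lborel g" "\<And>x. g x \<ge> 0" for g
    proof -
      have "integrable lborel (\<lambda>x. indicator (box a b) x * g x)"
        using integrable_mult_indicator[OF _ that(1), of "box a b"] by simp
      then show ?thesis using that(2)
        by (subst nn_integral_eq_integral[symmetric])
           (auto intro!: nn_integral_cong simp: ennreal_mult' indicator_def)
    qed
    have "(\<integral>x. indicator (box a b) x * p x \<partial>lborel) - (\<integral>x. indicator (box a b) x * m x \<partial>lborel)
        = (\<integral>x. indicator (box a b) x * p x - indicator (box a b) x * m x \<partial>lborel)"
      using integrable_mult_indicator[OF _ i(1), of "box a b"] integrable_mult_indicator[OF _ i(2), of "box a b"]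
      by simp
    also have "\<dots> = (\<integral>x. indicator (box a b) x * f x \<partial>lborel)"
      by (intro Bochner_Integration.integral_cong) (auto simp: p_def m_def max_def indicator_def)
    finally show ?thesis
      using z[of a b] i nn by (simp add: emeasure_density *)
  qed
  have eq: "density lborel (\<lambda>x. ennreal (p x)) = density lborel (\<lambda>x. ennreal (m x))"
  proof (rule measure_eqI_generator_eq)
    let ?E = "range (\<lambda>(a, b). box a b::'a set)"
    show "Int_stable ?E" by (auto simp: Int_stable_def box_Int_box)
    show "?E \<subseteq> Pow UNIV" "sets (density lborel (\<lambda>x. ennreal (p x))) = sigma_sets UNIV ?E"
      "sets (density lborel (\<lambda>x. ennreal (m x))) = sigma_sets UNIV ?E"
      by (simp_all add: borel_eq_box)
    let ?A = "\<lambda>n::nat. box (- (real n *\<^sub>R One)) (real n *\<^sub>R One) :: 'a set"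
    show "range ?A \<subseteq> ?E" "(\<Union>i. ?A i) = UNIV" unfolding UN_box_eq_UNIV by auto
    show "emeasure (density lborel (\<lambda>x. ennreal (p x))) (?A k) \<noteq> \<infinity>" for k
    proof -
      have "emeasure (density lborel (\<lambda>x. ennreal (p x))) (?A k) \<le> emeasure (density lborel (\<lambda>x. ennreal (p x))) UNIV"
        by (intro emeasure_mono) auto
      also have "\<dots> = ennreal (\<integral>x. p x \<partial>lborel)"
        using nn_integral_eq_integral[OF i(1)] nn by (simp add: emeasure_density)
      finally show ?thesis by (auto simp: top_unique)
    qed
    show "emeasure (density lborel (\<lambda>x. ennreal (p x))) X = emeasure (density lborel (\<lambda>x. ennreal (m x))) X" if "X \<in> ?E" for X
      using that box by auto
  qed
  have "AE x in lborel. ennreal (p x) = ennreal (m x)"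
    by (rule sigma_finite_measure.density_unique[OF sigma_finite_lborel _ _ eq]) auto
  then show ?thesis
    by eventually_elim (use nn in \<open>auto simp: p_def m_def max_def split: if_splits\<close>)
qed

text \<open>Weak derivatives are determined up to null sets only. Lebesgue measure being complete, a change on
  a null set does not affect measurability.\<close>

lemma measurable_cong_AE_lebesgue_on:
  fixes f g :: "'a::euclidean_space \<Rightarrow> real"
  assumes S: "S \<in> sets lebesgue" and f: "f \<in> borel_measurable (lebesgue_on S)"
    and ae: "AE x in lebesgue_on S. f x = g x"
  shows "g \<in> borel_measurable (lebesgue_on S)"
proof -
  let ?f = "\<lambda>x. if x \<in> S then f x else 0" and ?g = "\<lambda>x. if x \<in> S then g x else 0"
  have f': "?f \<in> borel_measurable lebesgue" using f S by (simp add: borel_measurable_if)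
  have ae': "AE x in lebesgue. ?f x = ?g x"
    using ae S by (auto simp: AE_restrict_space_iff elim!: eventually_mono)
  have "?g \<in> borel_measurable lebesgue"
  proof (rule measurableI)
    fix A :: "real set" assume "A \<in> sets borel"
    with f' have A: "?f -` A \<inter> space lebesgue \<in> sets lebesgue" by (rule measurable_sets)
    have "AE x in lebesgue. x \<in> ?f -` A \<inter> space lebesgue \<longleftrightarrow> x \<in> ?g -` A \<inter> space lebesgue"
      using ae' by eventually_elim auto
    from completion.in_sets_AE[OF this A] show "?g -` A \<inter> space lebesgue \<in> sets lebesgue"
      by simp
  qed simp
  then show ?thesis using S by (simp add: borel_measurable_if)
qed

lemma integral_lebesgue_on_vanish:
  fixes f :: "'a::euclidean_space \<Rightarrow> real"
  assumes "S \<in> sets lebesgue" "f \<in> borel_measurable borel" "\<And>x. x \<notin> S \<Longrightarrow> f x = 0"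
  shows "(\<integral>x. f x \<partial>lebesgue_on S) = (\<integral>x. f x \<partial>lborel)"
    and "integrable (lebesgue_on S) f \<longleftrightarrow> integrable lborel f"
proof -
  have "(\<lambda>x. if x \<in> S then f x else 0) = f" using assms(3) by auto
  then show "(\<integral>x. f x \<partial>lebesgue_on S) = (\<integral>x. f x \<partial>lborel)"
    and "integrable (lebesgue_on S) f \<longleftrightarrow> integrable lborel f"
    using Lebesgue_Measure.integral_restrict_UNIV[OF assms(1), of f] Lebesgue_Measure.integrable_restrict_UNIV[OF assms(1), of f] assms(2)
    by (simp_all add: integral_completion integrable_completion)
qed

lemma continuous_measurable_lebesgue_on:
  fixes f :: "'a::euclidean_space \<Rightarrow> real"
  assumes "continuous_on UNIV f"
  shows "f \<in> borel_measurable (lebesgue_on S)"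
  using borel_measurable_continuous_onI[OF assms] by (intro measurable_restrict_space1 measurable_completion) simp

lemma continuous_vanish_l2:
  assumes "S \<in> sets lebesgue" "continuous_on UNIV f" "compact K" "K \<subseteq> S" "\<And>x. x \<notin> K \<Longrightarrow> f x = 0"
  shows "f \<in> l2 (lebesgue_on S)"
proof -
  have c: "continuous_on UNIV (\<lambda>x. (f x)\<^sup>2)" using assms by (intro continuous_intros)
  have "integrable lborel (\<lambda>x. (f x)\<^sup>2)"
    by (rule continuous_vanish_integrable[OF c assms(3)]) (simp add: assms)
  moreover have "(\<lambda>x. (f x)\<^sup>2) \<in> borel_measurable borel" using borel_measurable_continuous_onI[OF c] .
  moreover have "f x = 0" if "x \<notin> S" for x using that assms by blast
  ultimately have "integrable (lebesgue_on S) (\<lambda>x. (f x)\<^sup>2)"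
    by (subst integral_lebesgue_on_vanish(2)[OF assms(1)]) auto
  then show ?thesis using assms by (simp add: l2_def continuous_measurable_lebesgue_on)
qed

lemma test_l2: 
  assumes "open \<Omega>" "\<phi> \<in> test_functions \<Omega>" shows "\<phi> \<in> l2 (lebesgue_on \<Omega>)"
proof -
  obtain K where "smooth \<phi>" "compact K" "K \<subseteq> \<Omega>" "\<And>x. x \<notin> K \<Longrightarrow> \<phi> x = 0"
    using assms(2) by (metis test_functionsE)
  then show ?thesis using assms(1)
    by (intro continuous_vanish_l2[of _ _ K]) (auto intro: smooth_continuous)
qed

lemma locally_integrable_diff:
  "locally_integrable \<Omega> f \<Longrightarrow> locally_integrable \<Omega> g \<Longrightarrow> locally_integrable \<Omega> (\<lambda>x. f x - g x)"
  by (auto simp: locally_integrable_def)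

lemma l2_locally_integrable:
  assumes "open \<Omega>" "f \<in> l2 (lebesgue_on \<Omega>)"
  shows "locally_integrable \<Omega> f"
  unfolding locally_integrable_def
proof (intro allI impI, elim conjE)
  fix K assume K: "compact K" "K \<subseteq> \<Omega>"
  then have KL: "K \<in> lmeasurable" "K \<in> sets lebesgue" by (auto simp: lmeasurable_compact fmeasurableD)
  have O: "\<Omega> \<in> sets lebesgue" using assms(1) by auto
  have m: "f \<in> borel_measurable (lebesgue_on K)"
    using assms(2) K(2) by (auto simp: l2_def intro: measurable_restrict_mono)
  have "integrable lebesgue (\<lambda>x. indicator K x *\<^sub>R (if x \<in> \<Omega> then (f x)\<^sup>2 else 0))"
    using assms(2) O KL by (intro integrable_mult_indicator) (auto simp: l2_def Lebesgue_Measure.integrable_restrict_UNIV)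
  also have "(\<lambda>x. indicator K x *\<^sub>R (if x \<in> \<Omega> then (f x)\<^sup>2 else 0)) = (\<lambda>x. if x \<in> K then (f x)\<^sup>2 else 0)"
    using K(2) by (auto simp: fun_eq_iff indicator_def)
  finally have sq: "integrable (lebesgue_on K) (\<lambda>x. (f x)\<^sup>2)"
    using KL by (simp add: Lebesgue_Measure.integrable_restrict_UNIV)
  interpret finite_measure "lebesgue_on K" using KL finite_measure_lebesgue_on by blast
  show "integrable (lebesgue_on K) f"
  proof (rule Bochner_Integration.integrable_bound[where f="\<lambda>x. 1 + (f x)\<^sup>2"])
    have "\<bar>y\<bar> \<le> 1 + y\<^sup>2" for y :: real
      using sum_squares_bound[of 1 "\<bar>y\<bar>"] by simp
    then show "AE x in lebesgue_on K. norm (f x) \<le> norm (1 + (f x)\<^sup>2)" by (auto simp: abs_of_nonneg)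
  qed (use m sq in auto)
qed

lemma locally_integrable_test:
  assumes "open \<Omega>" "locally_integrable \<Omega> f" "\<phi> \<in> test_functions \<Omega>"
  shows "integrable (lebesgue_on \<Omega>) (\<lambda>x. f x * \<phi> x)"
proof -
  obtain K where K: "smooth \<phi>" "compact K" "K \<subseteq> \<Omega>" "\<And>x. x \<notin> K \<Longrightarrow> \<phi> x = 0"
    using assms(3) by (metis test_functionsE)
  obtain B where B: "\<And>x. \<bar>\<phi> x\<bar> \<le> B" using test_bounded[OF assms(3)] by metis
  have KL: "K \<in> sets lebesgue" using K by (simp add: lmeasurable_compact fmeasurableD)
  have "integrable (lebesgue_on K) f" using assms(2) K by (simp add: locally_integrable_def)
  then have i: "integrable lebesgue (\<lambda>x. if x \<in> K then f x else 0)"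
    using KL by (simp add: Lebesgue_Measure.integrable_restrict_UNIV)
  have "integrable lebesgue (\<lambda>x. \<phi> x * (if x \<in> K then f x else 0))"
  proof (rule Bochner_Integration.integrable_bound[where f="\<lambda>x. B * (if x \<in> K then f x else 0)"])
    show "(\<lambda>x. \<phi> x * (if x \<in> K then f x else 0)) \<in> borel_measurable lebesgue"
      using continuous_measurable_lebesgue_on[OF smooth_continuous[OF K(1)], of UNIV] i
      by (auto simp: lebesgue_on_UNIV_eq)
    have "\<bar>\<phi> x\<bar> \<le> \<bar>B\<bar>" for x using B[of x] by simp
    then show "AE x in lebesgue. norm (\<phi> x * (if x \<in> K then f x else 0)) \<le> norm (B * (if x \<in> K then f x else 0))"
      by (auto simp: abs_mult intro!: mult_right_mono)
  qed (use i in auto)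
  also have "(\<lambda>x. \<phi> x * (if x \<in> K then f x else 0)) = (\<lambda>x. if x \<in> \<Omega> then f x * \<phi> x else 0)"
    using K(3,4) by (auto simp: fun_eq_iff)
  finally show ?thesis using assms(1) by (subst (asm) Lebesgue_Measure.integrable_restrict_UNIV) auto
qed

text \<open>The bumps on a box inside the given one converge boundedly to its indicator function, so all
  integrals of \<open>f\<close> over such boxes vanish.\<close>

lemma AE_zero_on_cbox:
  fixes f :: "real^'n \<Rightarrow> real"
  assumes \<Omega>: "open \<Omega>" and f: "locally_integrable \<Omega> f"
    and z: "\<And>\<phi>. \<phi> \<in> test_functions \<Omega> \<Longrightarrow> (\<integral>x. f x * \<phi> x \<partial>lebesgue_on \<Omega>) = 0"
    and ab: "cbox a b \<subseteq> \<Omega>"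
  shows "AE x in lebesgue. x \<in> cbox a b \<longrightarrow> f x = 0"
proof -
  define G where "G x = (if x \<in> cbox a b then f x else 0)" for x
  have G: "integrable lebesgue G"
    using f ab unfolding locally_integrable_def G_def by (simp add: Lebesgue_Measure.integrable_restrict_UNIV)
  have z1: "(\<integral>x. indicator (box p q) x * G x \<partial>lebesgue) = 0" if pq: "cbox p q \<subseteq> cbox a b" for p q
  proof -
    have "(\<lambda>n. \<integral>x. box_bump (real (Suc n)) p q x * G x \<partial>lebesgue) \<longlonglongrightarrow> (\<integral>x. indicator (box p q) x * G x \<partial>lebesgue)"
    proof (rule integral_dominated_convergence[where w="\<lambda>x. \<bar>G x\<bar>"])
      have m: "box_bump c p q \<in> borel_measurable lebesgue" for c
        using continuous_measurable_lebesgue_on[OF smooth_continuous[OF smooth_box_bump], where S=UNIV]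
        by (simp add: lebesgue_on_UNIV_eq)
      show "(\<lambda>x. indicator (box p q) x * G x) \<in> borel_measurable lebesgue"
        using G by (intro borel_measurable_times borel_measurable_indicator) (auto intro: sets_completionI_sets)
      show "(\<lambda>x. box_bump (real (Suc n)) p q x * G x) \<in> borel_measurable lebesgue" for n using G m by auto
      show "AE x in lebesgue. (\<lambda>n. box_bump (real (Suc n)) p q x * G x) \<longlonglongrightarrow> indicator (box p q) x * G x"
        by (intro AE_I2 tendsto_mult box_bump_tendsto tendsto_const)
      show "AE x in lebesgue. norm (box_bump (real (Suc n)) p q x * G x) \<le> \<bar>G x\<bar>" for n
        by (intro AE_I2) (auto simp: abs_mult box_bump_nonneg box_bump_le_1 intro!: mult_left_le_one_le)
    qed (use G in auto)
    moreover have "(\<integral>x. box_bump (real (Suc n)) p q x * G x \<partial>lebesgue) = 0" for n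
    proof -
      have t: "box_bump (real (Suc n)) p q \<in> test_functions \<Omega>"
        using pq ab by (intro test_box_bump) auto
      have "box_bump (real (Suc n)) p q x = 0" if "x \<notin> cbox a b" for x
        using that pq box_subset_cbox[of p q] by (intro box_bump_eq_0) auto
      then have "(\<lambda>x. box_bump (real (Suc n)) p q x * G x) =
          (\<lambda>x. if x \<in> \<Omega> then f x * box_bump (real (Suc n)) p q x else 0)"
        using ab by (auto simp: G_def fun_eq_iff)
      then show ?thesis using z[OF t] \<Omega> by (simp add: Lebesgue_Measure.integral_restrict_UNIV)
    qed
    ultimately show ?thesis by (simp add: LIMSEQ_const_iff)
  qed
  obtain G' where G': "G' \<in> borel_measurable lborel" "AE x in lborel. G x = G' x"
    using completion_ex_borel_measurable_real[of G lborel] G by auto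
  have G'_le: "AE x in lebesgue. G x = G' x" using G'(2) by (rule AE_completion)
  define F where "F x = indicator (box a b) x * G' x" for x
  have [measurable]: "G' \<in> borel_measurable borel" using G'(1) by simp
  have [measurable]: "G \<in> borel_measurable lebesgue" using G by auto
  have [measurable]: "G' \<in> borel_measurable lebesgue" using measurable_completion[OF G'(1)] .
  have "integrable lebesgue G'"
    by (rule integrable_cong_AE_imp[OF G _ G'_le]) measurable
  then have iG': "integrable lborel G'" using G'(1) by (simp add: integrable_completion)
  have "AE x in lborel. F x = 0"
  proof (rule AE_zero_if_integral_box_zero)
    show "integrable lborel F"
      unfolding F_def using integrable_mult_indicator[OF _ iG', of "box a b"] by simp
    show "(\<integral>x. indicator (box c d) x * F x \<partial>lborel) = 0" for c d
    proof -
      obtain p q where pq: "box a b \<inter> box c d = box p q" "cbox a b \<inter> cbox c d = cbox p q"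
        unfolding box_Int_box Int_interval by blast
      have "(\<integral>x. indicator (box c d) x * F x \<partial>lborel) = (\<integral>x. indicator (box p q) x * G' x \<partial>lborel)"
        unfolding F_def pq(1)[symmetric] by (intro Bochner_Integration.integral_cong) (auto simp: indicator_def)
      also have "\<dots> = (\<integral>x. indicator (box p q) x * G' x \<partial>lebesgue)"
        by (rule integral_completion[symmetric]) measurable
      also have "\<dots> = (\<integral>x. indicator (box p q) x * G x \<partial>lebesgue)"
        by (rule integral_cong_AE)
           (use G'_le in \<open>auto intro!: borel_measurable_times borel_measurable_indicator intro: sets_completionI_sets\<close>)
      also have "\<dots> = 0" using pq by (intro z1) blast
      finally show ?thesis .
    qed
  qed
  then have "AE x in lebesgue. F x = 0" by (rule AE_completion)
  moreover have "AE x in lebesgue. x \<notin> cbox a b - box a b"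
    using negligible_frontier_interval[of a b] unfolding negligible_iff_null_sets by (rule AE_not_in)
  ultimately show ?thesis using G'_le
    by eventually_elim (auto simp: F_def G_def)
qed

theorem fundamental_lemma_calculus_of_variations:
  fixes f :: "real^'n \<Rightarrow> real"
  assumes \<Omega>: "open \<Omega>" and f: "locally_integrable \<Omega> f"
    and z: "\<And>\<phi>. \<phi> \<in> test_functions \<Omega> \<Longrightarrow> (\<integral>x. f x * \<phi> x \<partial>lebesgue_on \<Omega>) = 0"
  shows "AE x in lebesgue_on \<Omega>. f x = 0"
proof -
  obtain \<D> where D: "countable \<D>" "\<D> \<subseteq> Pow \<Omega>" "\<And>X. X \<in> \<D> \<Longrightarrow> \<exists>a b. X = cbox a b" "\<Union>\<D> = \<Omega>"
    using open_countable_Union_open_cbox[OF \<Omega>] by metis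
  have "AE x in lebesgue. \<forall>X\<in>\<D>. x \<in> X \<longrightarrow> f x = 0"
  proof (subst AE_ball_countable[OF D(1)], rule ballI)
    fix X assume X: "X \<in> \<D>"
    then obtain a b where "X = cbox a b" using D by blast
    then show "AE x in lebesgue. x \<in> X \<longrightarrow> f x = 0"
      using AE_zero_on_cbox[OF assms, of a b] X D(2) by auto
  qed
  then have "AE x in lebesgue. x \<in> \<Omega> \<longrightarrow> f x = 0"
    by eventually_elim (use D(4) in auto)
  then show ?thesis using \<Omega> by (simp add: AE_restrict_space_iff)
qed

section \<open>Weak derivatives and Sobolev spaces as closures of test functions\<close>

lemma has_weak_pderiv_unique:
  assumes "open \<Omega>" "has_weak_pderiv \<Omega> i f g" "has_weak_pderiv \<Omega> i f g'"
  shows "AE x in lebesgue_on \<Omega>. g x = g' x"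
proof -
  have l: "locally_integrable \<Omega> g" "locally_integrable \<Omega> g'"
    using assms by (auto simp: has_weak_pderiv_def)
  have "AE x in lebesgue_on \<Omega>. g x - g' x = 0"
  proof (rule fundamental_lemma_calculus_of_variations[OF assms(1) locally_integrable_diff[OF l]])
    fix \<phi> assume p: "\<phi> \<in> test_functions \<Omega>"
    have "(\<integral>x. (g x - g' x) * \<phi> x \<partial>lebesgue_on \<Omega>) =
      (\<integral>x. g x * \<phi> x \<partial>lebesgue_on \<Omega>) - (\<integral>x. g' x * \<phi> x \<partial>lebesgue_on \<Omega>)"
      unfolding left_diff_distrib
      by (intro Bochner_Integration.integral_diff locally_integrable_test assms l p)
    then show "(\<integral>x. (g x - g' x) * \<phi> x \<partial>lebesgue_on \<Omega>) = 0"
      using assms p by (simp add: has_weak_pderiv_def)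
  qed
  then show ?thesis by eventually_elim simp
qed

lemma weak_pderiv:
  assumes "open \<Omega>" "has_weak_pderiv \<Omega> i f g"
  shows "has_weak_pderiv \<Omega> i f (weak_pderiv \<Omega> i f)" "AE x in lebesgue_on \<Omega>. weak_pderiv \<Omega> i f x = g x"
proof -
  show "has_weak_pderiv \<Omega> i f (weak_pderiv \<Omega> i f)"
    unfolding weak_pderiv_def using assms(2) by (rule someI[where P="has_weak_pderiv \<Omega> i f"])
  then show "AE x in lebesgue_on \<Omega>. weak_pderiv \<Omega> i f x = g x"
    using has_weak_pderiv_unique assms by blast
qed

lemma has_weak_pderiv_diff:
  assumes "open \<Omega>" "has_weak_pderiv \<Omega> i f g" "has_weak_pderiv \<Omega> i f' g'"
  shows "has_weak_pderiv \<Omega> i (\<lambda>x. f x - f' x) (\<lambda>x. g x - g' x)"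
proof -
  have l: "locally_integrable \<Omega> f" "locally_integrable \<Omega> g" "locally_integrable \<Omega> f'" "locally_integrable \<Omega> g'"
    using assms by (auto simp: has_weak_pderiv_def)
  have d: "(\<integral>x. (u x - v x) * \<phi> x \<partial>lebesgue_on \<Omega>) =
      (\<integral>x. u x * \<phi> x \<partial>lebesgue_on \<Omega>) - (\<integral>x. v x * \<phi> x \<partial>lebesgue_on \<Omega>)"
    if "\<phi> \<in> test_functions \<Omega>" "locally_integrable \<Omega> u" "locally_integrable \<Omega> v" for u v \<phi>
    unfolding left_diff_distrib
    by (intro Bochner_Integration.integral_diff locally_integrable_test assms that)
  show ?thesis
    unfolding has_weak_pderiv_def
    using l assms by (auto simp: d test_pderiv_at locally_integrable_diff) (auto simp: has_weak_pderiv_def)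
qed

lemma has_weak_pderiv_cong_AE:
  assumes "open \<Omega>" "has_weak_pderiv \<Omega> i f g" "AE x in lebesgue_on \<Omega>. f x = f' x"
  shows "has_weak_pderiv \<Omega> i f' g"
proof -
  have O: "\<Omega> \<in> sets lebesgue" using assms(1) by auto
  have lf: "locally_integrable \<Omega> f" using assms(2) by (auto simp: has_weak_pderiv_def)
  have l: "locally_integrable \<Omega> f'"
    unfolding locally_integrable_def
  proof (intro allI impI, elim conjE)
    fix K assume K: "compact K" "K \<subseteq> \<Omega>"
    have KL: "K \<in> sets lebesgue" using K by (simp add: lmeasurable_compact fmeasurableD)
    have i: "integrable (lebesgue_on K) f" using lf K by (simp add: locally_integrable_def)
    have ae: "AE x in lebesgue_on K. f x = f' x"
      using assms(3) O KL K(2) by (simp add: AE_restrict_space_iff) (auto elim!: eventually_mono)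
    have m: "f' \<in> borel_measurable (lebesgue_on K)"
      by (rule measurable_cong_AE_lebesgue_on[OF KL _ ae]) (use i in auto)
    show "integrable (lebesgue_on K) f'" by (rule integrable_cong_AE_imp[OF i m ae])
  qed
  have "(\<integral>x. f' x * pderiv_at i \<phi> x \<partial>lebesgue_on \<Omega>) = (\<integral>x. f x * pderiv_at i \<phi> x \<partial>lebesgue_on \<Omega>)"
    if "\<phi> \<in> test_functions \<Omega>" for \<phi>
    using locally_integrable_test[OF assms(1) l test_pderiv_at[OF that]]
      locally_integrable_test[OF assms(1) lf test_pderiv_at[OF that]] assms(3)
    by (intro integral_cong_AE) (auto elim!: eventually_mono)
  then show ?thesis using assms(2) l by (auto simp: has_weak_pderiv_def)
qed

lemma l2_lim_has_weak_pderiv: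
  assumes \<Omega>: "open \<Omega>" and \<phi>: "\<And>n. \<phi> n \<in> test_functions \<Omega>"
    and f: "l2_lim (lebesgue_on \<Omega>) \<phi> f" and g: "l2_lim (lebesgue_on \<Omega>) (\<lambda>n. pderiv_at i (\<phi> n)) g"
  shows "has_weak_pderiv \<Omega> i f g"
  unfolding has_weak_pderiv_def
proof (intro conjI ballI)
  show "locally_integrable \<Omega> f" "locally_integrable \<Omega> g"
    using f g \<Omega> by (auto simp: l2_lim_def intro: l2_locally_integrable)
  fix \<eta> assume \<eta>: "\<eta> \<in> test_functions \<Omega>"
  have i: "(\<integral>x. \<phi> n x * pderiv_at i \<eta> x \<partial>lebesgue_on \<Omega>) = - (\<integral>x. pderiv_at i (\<phi> n) x * \<eta> x \<partial>lebesgue_on \<Omega>)" for n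
  proof -
    have "smooth (\<phi> n)" using \<phi> test_smooth by blast
    then have [measurable]: "\<phi> n \<in> borel_measurable borel" "pderiv_at i (\<phi> n) \<in> borel_measurable borel"
      "\<eta> \<in> borel_measurable borel" "pderiv_at i \<eta> \<in> borel_measurable borel"
      using test_smooth[OF \<eta>] by (auto intro!: smooth_borel smooth_pderiv_at)
    have "(\<integral>x. \<phi> n x * pderiv_at i \<eta> x \<partial>lebesgue_on \<Omega>) = (\<integral>x. \<phi> n x * pderiv_at i \<eta> x \<partial>lborel)"
      "(\<integral>x. pderiv_at i (\<phi> n) x * \<eta> x \<partial>lebesgue_on \<Omega>) = (\<integral>x. pderiv_at i (\<phi> n) x * \<eta> x \<partial>lborel)"
      by (rule integral_lebesgue_on_vanish(1); use \<Omega> test_vanish[OF \<eta>] test_vanish[OF test_pderiv_at[OF \<eta>]] in simp)+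
    then show ?thesis
      using integral_by_parts_smooth[OF \<open>smooth (\<phi> n)\<close> test_mono[OF \<eta> subset_UNIV]] by simp
  qed
  have "(\<lambda>n. \<integral>x. \<phi> n x * pderiv_at i \<eta> x \<partial>lebesgue_on \<Omega>) \<longlonglongrightarrow> (\<integral>x. f x * pderiv_at i \<eta> x \<partial>lebesgue_on \<Omega>)"
    by (rule l2_lim_inner[OF f l2_lim_const]) (simp add: test_l2 test_pderiv_at \<eta> \<Omega>)
  moreover have "(\<lambda>n. - (\<integral>x. pderiv_at i (\<phi> n) x * \<eta> x \<partial>lebesgue_on \<Omega>)) \<longlonglongrightarrow> - (\<integral>x. g x * \<eta> x \<partial>lebesgue_on \<Omega>)"
    by (intro tendsto_minus l2_lim_inner[OF g l2_lim_const]) (simp add: test_l2 \<eta> \<Omega>)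
  ultimately show "(\<integral>x. f x * pderiv_at i \<eta> x \<partial>lebesgue_on \<Omega>) = - (\<integral>x. g x * \<eta> x \<partial>lebesgue_on \<Omega>)"
    unfolding i by (rule LIMSEQ_unique)
qed

lemma test_has_weak_pderiv:
  assumes "open \<Omega>" "\<phi> \<in> test_functions \<Omega>"
  shows "has_weak_pderiv \<Omega> i \<phi> (pderiv_at i \<phi>)"
  using assms by (intro l2_lim_has_weak_pderiv[of _ "\<lambda>_. \<phi>"] l2_lim_const test_l2 test_pderiv_at)

text \<open>\<open>H1_0_jet \<Omega> u g\<close> says that \<open>u\<close> belongs to \<open>H\<^sup>1\<^sub>0(\<Omega>)\<close> and has the weak gradient \<open>g\<close>, and \<open>H2_0_jet \<Omega> u g h\<close> that
  \<open>u\<close> belongs to \<open>H\<^sup>2\<^sub>0(\<Omega>)\<close> and has the weak gradient \<open>g\<close> and the weak Hessian \<open>h\<close>. The derivatives are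
  arguments here in order to avoid the arbitrary representatives chosen by \<open>weak_pderiv\<close>; that they are
  weak derivatives follows from the approximation by test functions.\<close>

definition H1_0_jet :: "(real^'n) set \<Rightarrow> (real^'n \<Rightarrow> real) \<Rightarrow> ('n \<Rightarrow> real^'n \<Rightarrow> real) \<Rightarrow> bool" where
  "H1_0_jet \<Omega> u g \<longleftrightarrow> u \<in> l2 (lebesgue_on \<Omega>) \<and> (\<forall>i. g i \<in> l2 (lebesgue_on \<Omega>)) \<and>
     (\<forall>\<epsilon>>0. \<exists>\<phi>\<in>test_functions \<Omega>. (\<integral>x. (u x - \<phi> x)\<^sup>2 \<partial>lebesgue_on \<Omega>) < \<epsilon> \<and>
        (\<forall>i. (\<integral>x. (g i x - pderiv_at i \<phi> x)\<^sup>2 \<partial>lebesgue_on \<Omega>) < \<epsilon>))"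

definition H2_0_jet :: "(real^'n) set \<Rightarrow> (real^'n \<Rightarrow> real) \<Rightarrow> ('n \<Rightarrow> real^'n \<Rightarrow> real) \<Rightarrow>
    ('n \<Rightarrow> 'n \<Rightarrow> real^'n \<Rightarrow> real) \<Rightarrow> bool" where
  "H2_0_jet \<Omega> u g h \<longleftrightarrow> u \<in> l2 (lebesgue_on \<Omega>) \<and> (\<forall>i. g i \<in> l2 (lebesgue_on \<Omega>)) \<and>
     (\<forall>i j. h i j \<in> l2 (lebesgue_on \<Omega>)) \<and>
     (\<forall>\<epsilon>>0. \<exists>\<phi>\<in>test_functions \<Omega>. (\<integral>x. (u x - \<phi> x)\<^sup>2 \<partial>lebesgue_on \<Omega>) < \<epsilon> \<and>
        (\<forall>i. (\<integral>x. (g i x - pderiv_at i \<phi> x)\<^sup>2 \<partial>lebesgue_on \<Omega>) < \<epsilon>) \<and>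
        (\<forall>i j. (\<integral>x. (h i j x - pderiv_at j (pderiv_at i \<phi>) x)\<^sup>2 \<partial>lebesgue_on \<Omega>) < \<epsilon>))"

lemma l2_limI_small:
  assumes "\<And>n. F n \<in> l2 M" "f \<in> l2 M" "\<And>n. (\<integral>x. (f x - F n x)\<^sup>2 \<partial>M) < inverse (real (Suc n))"
  shows "l2_lim M F f"
proof -
  have "(\<lambda>n. \<integral>x. (f x - F n x)\<^sup>2 \<partial>M) \<longlonglongrightarrow> 0"
  proof (rule tendsto_sandwich[OF _ _ tendsto_const LIMSEQ_inverse_real_of_nat])
    show "\<forall>\<^sub>F n in sequentially. (\<integral>x. (f x - F n x)\<^sup>2 \<partial>M) \<le> inverse (real (Suc n))"
      using assms(3) by (intro always_eventually allI less_imp_le)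
  qed simp
  then show ?thesis using assms by (simp add: l2_lim_def)
qed

lemma H2_0_jet_sequence:
  assumes "open \<Omega>" "H2_0_jet \<Omega> u g h"
  obtains \<phi> where "\<And>n::nat. \<phi> n \<in> test_functions \<Omega>" "l2_lim (lebesgue_on \<Omega>) \<phi> u"
    "\<And>i. l2_lim (lebesgue_on \<Omega>) (\<lambda>n. pderiv_at i (\<phi> n)) (g i)"
    "\<And>i j. l2_lim (lebesgue_on \<Omega>) (\<lambda>n. pderiv_at j (pderiv_at i (\<phi> n))) (h i j)"
proof -
  let ?P = "\<lambda>n \<phi>. \<phi> \<in> test_functions \<Omega> \<and> (\<integral>x. (u x - \<phi> x)\<^sup>2 \<partial>lebesgue_on \<Omega>) < inverse (real (Suc n)) \<and>
        (\<forall>i. (\<integral>x. (g i x - pderiv_at i \<phi> x)\<^sup>2 \<partial>lebesgue_on \<Omega>) < inverse (real (Suc n))) \<and>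
        (\<forall>i j. (\<integral>x. (h i j x - pderiv_at j (pderiv_at i \<phi>) x)\<^sup>2 \<partial>lebesgue_on \<Omega>) < inverse (real (Suc n)))"
  have l: "u \<in> l2 (lebesgue_on \<Omega>)" "g i \<in> l2 (lebesgue_on \<Omega>)" "h i j \<in> l2 (lebesgue_on \<Omega>)" for i j
    using assms(2) unfolding H2_0_jet_def by blast+
  have "\<exists>\<phi>\<in>test_functions \<Omega>. (\<integral>x. (u x - \<phi> x)\<^sup>2 \<partial>lebesgue_on \<Omega>) < inverse (real (Suc n)) \<and>
        (\<forall>i. (\<integral>x. (g i x - pderiv_at i \<phi> x)\<^sup>2 \<partial>lebesgue_on \<Omega>) < inverse (real (Suc n))) \<and>
        (\<forall>i j. (\<integral>x. (h i j x - pderiv_at j (pderiv_at i \<phi>) x)\<^sup>2 \<partial>lebesgue_on \<Omega>) < inverse (real (Suc n)))" for n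
    using assms(2) unfolding H2_0_jet_def by simp
  then have "\<forall>n. \<exists>\<phi>. ?P n \<phi>" unfolding Bex_def by blast
  from choice[OF this] obtain \<phi> where "\<And>n. ?P n (\<phi> n)" by blast
  then have \<phi>: "\<And>n. \<phi> n \<in> test_functions \<Omega>"
    "\<And>n. (\<integral>x. (u x - \<phi> n x)\<^sup>2 \<partial>lebesgue_on \<Omega>) < inverse (real (Suc n))"
    "\<And>n i. (\<integral>x. (g i x - pderiv_at i (\<phi> n) x)\<^sup>2 \<partial>lebesgue_on \<Omega>) < inverse (real (Suc n))"
    "\<And>n i j. (\<integral>x. (h i j x - pderiv_at j (pderiv_at i (\<phi> n)) x)\<^sup>2 \<partial>lebesgue_on \<Omega>) < inverse (real (Suc n))"
    by blast+
  show ?thesis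
  proof (rule that[of \<phi>])
    show "\<phi> n \<in> test_functions \<Omega>" for n by (rule \<phi>(1))
  qed (intro l2_limI_small test_l2[OF assms(1)] test_pderiv_at \<phi> l)+
qed

lemma eventually_small:
  fixes a :: "nat \<Rightarrow> real"
  assumes "a \<longlonglongrightarrow> 0" "\<epsilon> > 0" shows "\<forall>\<^sub>F n in sequentially. a n < \<epsilon>"
  using assms by (rule order_tendstoD(2))

lemma H1_0_jetI_sequence:
  assumes "\<And>n::nat. \<phi> n \<in> test_functions \<Omega>" "l2_lim (lebesgue_on \<Omega>) \<phi> u"
    "\<And>i. l2_lim (lebesgue_on \<Omega>) (\<lambda>n. pderiv_at i (\<phi> n)) (g i)"
  shows "H1_0_jet \<Omega> u g"
  unfolding H1_0_jet_def
proof (intro conjI allI impI)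
  fix \<epsilon> :: real assume e: "\<epsilon> > 0"
  have "\<forall>\<^sub>F n in sequentially. (\<integral>x. (u x - \<phi> n x)\<^sup>2 \<partial>lebesgue_on \<Omega>) < \<epsilon> \<and>
      (\<forall>i\<in>UNIV. (\<integral>x. (g i x - pderiv_at i (\<phi> n) x)\<^sup>2 \<partial>lebesgue_on \<Omega>) < \<epsilon>)"
    using assms(2,3)
    by (intro eventually_conj eventually_ball_finite ballI eventually_small[OF _ e]) (auto simp: l2_lim_def)
  then obtain n where "(\<integral>x. (u x - \<phi> n x)\<^sup>2 \<partial>lebesgue_on \<Omega>) < \<epsilon> \<and>
      (\<forall>i\<in>UNIV. (\<integral>x. (g i x - pderiv_at i (\<phi> n) x)\<^sup>2 \<partial>lebesgue_on \<Omega>) < \<epsilon>)"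
    by (auto simp: eventually_sequentially)
  then show "\<exists>\<phi>\<in>test_functions \<Omega>. (\<integral>x. (u x - \<phi> x)\<^sup>2 \<partial>lebesgue_on \<Omega>) < \<epsilon> \<and>
        (\<forall>i. (\<integral>x. (g i x - pderiv_at i \<phi> x)\<^sup>2 \<partial>lebesgue_on \<Omega>) < \<epsilon>)"
    using assms(1) by (intro bexI[of _ "\<phi> n"]) auto
qed (use assms in \<open>auto simp: l2_lim_def\<close>)

lemma H1_0_jet_sequence:
  assumes "open \<Omega>" "H1_0_jet \<Omega> u g"
  obtains \<phi> where "\<And>n::nat. \<phi> n \<in> test_functions \<Omega>" "l2_lim (lebesgue_on \<Omega>) \<phi> u"
    "\<And>i. l2_lim (lebesgue_on \<Omega>) (\<lambda>n. pderiv_at i (\<phi> n)) (g i)"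
proof -
  let ?P = "\<lambda>n \<phi>. \<phi> \<in> test_functions \<Omega> \<and> (\<integral>x. (u x - \<phi> x)\<^sup>2 \<partial>lebesgue_on \<Omega>) < inverse (real (Suc n)) \<and>
        (\<forall>i. (\<integral>x. (g i x - pderiv_at i \<phi> x)\<^sup>2 \<partial>lebesgue_on \<Omega>) < inverse (real (Suc n)))"
  have l: "u \<in> l2 (lebesgue_on \<Omega>)" "g i \<in> l2 (lebesgue_on \<Omega>)" for i
    using assms(2) unfolding H1_0_jet_def by blast+
  have "\<exists>\<phi>\<in>test_functions \<Omega>. (\<integral>x. (u x - \<phi> x)\<^sup>2 \<partial>lebesgue_on \<Omega>) < inverse (real (Suc n)) \<and>
        (\<forall>i. (\<integral>x. (g i x - pderiv_at i \<phi> x)\<^sup>2 \<partial>lebesgue_on \<Omega>) < inverse (real (Suc n)))" for n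
    using assms(2) unfolding H1_0_jet_def by simp
  then have "\<forall>n. \<exists>\<phi>. ?P n \<phi>" unfolding Bex_def by blast
  from choice[OF this] obtain \<phi> where "\<And>n. ?P n (\<phi> n)" by blast
  then have \<phi>: "\<And>n. \<phi> n \<in> test_functions \<Omega>"
    "\<And>n. (\<integral>x. (u x - \<phi> n x)\<^sup>2 \<partial>lebesgue_on \<Omega>) < inverse (real (Suc n))"
    "\<And>n i. (\<integral>x. (g i x - pderiv_at i (\<phi> n) x)\<^sup>2 \<partial>lebesgue_on \<Omega>) < inverse (real (Suc n))"
    by blast+
  show ?thesis
  proof (rule that[of \<phi>])
    show "\<phi> n \<in> test_functions \<Omega>" for n by (rule \<phi>(1))
  qed (intro l2_limI_small test_l2[OF assms(1)] test_pderiv_at \<phi> l)+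
qed

text \<open>A diagonal argument: an element of the closure near \<open>u\<close> has in turn a test function near it.\<close>

lemma H2_0_jetI_limit:
  assumes \<Omega>: "open \<Omega>" and cl: "\<And>n::nat. H2_0_jet \<Omega> (u' n) (g' n) (h' n)" and u: "l2_lim (lebesgue_on \<Omega>) u' u"
    and g: "\<And>i. l2_lim (lebesgue_on \<Omega>) (\<lambda>n. g' n i) (g i)"
    and h: "\<And>i j. l2_lim (lebesgue_on \<Omega>) (\<lambda>n. h' n i j) (h i j)"
  shows "H2_0_jet \<Omega> u g h"
  unfolding H2_0_jet_def
proof (intro conjI allI impI)
  let ?M = "lebesgue_on \<Omega>"
  fix \<epsilon> :: real assume "\<epsilon> > 0"
  then have e: "\<epsilon> / 4 > 0" by simp
  have "\<forall>\<^sub>F n in sequentially. (\<integral>x. (u x - u' n x)\<^sup>2 \<partial>?M) < \<epsilon> / 4 \<and>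
      (\<forall>i\<in>UNIV. (\<integral>x. (g i x - g' n i x)\<^sup>2 \<partial>?M) < \<epsilon> / 4) \<and>
      (\<forall>i\<in>UNIV. \<forall>j\<in>UNIV. (\<integral>x. (h i j x - h' n i j x)\<^sup>2 \<partial>?M) < \<epsilon> / 4)"
    using u g h
    by (intro eventually_conj eventually_ball_finite ballI eventually_small[OF _ e]) (auto simp: l2_lim_def)
  then obtain n where n: "(\<integral>x. (u x - u' n x)\<^sup>2 \<partial>?M) < \<epsilon> / 4"
      "\<And>i. (\<integral>x. (g i x - g' n i x)\<^sup>2 \<partial>?M) < \<epsilon> / 4"
      "\<And>i j. (\<integral>x. (h i j x - h' n i j x)\<^sup>2 \<partial>?M) < \<epsilon> / 4"
    by (auto simp: eventually_sequentially)
  obtain \<phi> where \<phi>: "\<phi> \<in> test_functions \<Omega>" "(\<integral>x. (u' n x - \<phi> x)\<^sup>2 \<partial>?M) < \<epsilon> / 4"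
      "\<And>i. (\<integral>x. (g' n i x - pderiv_at i \<phi> x)\<^sup>2 \<partial>?M) < \<epsilon> / 4"
      "\<And>i j. (\<integral>x. (h' n i j x - pderiv_at j (pderiv_at i \<phi>) x)\<^sup>2 \<partial>?M) < \<epsilon> / 4"
    using cl[of n] e unfolding H2_0_jet_def by meson
  have *: "(\<integral>x. (a x - c x)\<^sup>2 \<partial>?M) < \<epsilon>"
    if "a \<in> l2 ?M" "b \<in> l2 ?M" "c \<in> l2 ?M" "(\<integral>x. (a x - b x)\<^sup>2 \<partial>?M) < \<epsilon> / 4" "(\<integral>x. (b x - c x)\<^sup>2 \<partial>?M) < \<epsilon> / 4" for a b c
    using integral_square_sum_le[OF l2_diff[OF that(1,2)] l2_diff[OF that(2,3)]] that(4,5) by simp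
  show "\<exists>\<phi>\<in>test_functions \<Omega>. (\<integral>x. (u x - \<phi> x)\<^sup>2 \<partial>?M) < \<epsilon> \<and>
        (\<forall>i. (\<integral>x. (g i x - pderiv_at i \<phi> x)\<^sup>2 \<partial>?M) < \<epsilon>) \<and>
        (\<forall>i j. (\<integral>x. (h i j x - pderiv_at j (pderiv_at i \<phi>) x)\<^sup>2 \<partial>?M) < \<epsilon>)"
  proof (intro bexI[OF _ \<phi>(1)] conjI allI)
    show "(\<integral>x. (u x - \<phi> x)\<^sup>2 \<partial>?M) < \<epsilon>"
      by (rule *[OF _ _ _ n(1) \<phi>(2)]) (use u \<Omega> \<phi>(1) in \<open>auto simp: l2_lim_def test_l2\<close>)
    show "(\<integral>x. (g i x - pderiv_at i \<phi> x)\<^sup>2 \<partial>?M) < \<epsilon>" for i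
      by (rule *[OF _ _ _ n(2) \<phi>(3)]) (use g \<Omega> \<phi>(1) in \<open>auto simp: l2_lim_def test_l2 test_pderiv_at\<close>)
    show "(\<integral>x. (h i j x - pderiv_at j (pderiv_at i \<phi>) x)\<^sup>2 \<partial>?M) < \<epsilon>" for i j
      by (rule *[OF _ _ _ n(3) \<phi>(4)]) (use h \<Omega> \<phi>(1) in \<open>auto simp: l2_lim_def test_l2 test_pderiv_at\<close>)
  qed
qed (use u g h in \<open>auto simp: l2_lim_def\<close>)

lemma test_H2_0_jet:
  assumes "open \<Omega>" "\<phi> \<in> test_functions \<Omega>"
  shows "H2_0_jet \<Omega> \<phi> (\<lambda>i. pderiv_at i \<phi>) (\<lambda>i j. pderiv_at j (pderiv_at i \<phi>))"
  unfolding H2_0_jet_def using assms by (auto intro!: test_l2 test_pderiv_at bexI[of _ \<phi>])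

lemma H2_0_jet_add:
  assumes \<Omega>: "open \<Omega>" and a: "H2_0_jet \<Omega> u g h" and b: "H2_0_jet \<Omega> u' g' h'"
  shows "H2_0_jet \<Omega> (\<lambda>x. u x + u' x) (\<lambda>i x. g i x + g' i x) (\<lambda>i j x. h i j x + h' i j x)"
proof -
  obtain \<phi> where \<phi>: "\<And>n::nat. \<phi> n \<in> test_functions \<Omega>" "l2_lim (lebesgue_on \<Omega>) \<phi> u"
    "\<And>i. l2_lim (lebesgue_on \<Omega>) (\<lambda>n. pderiv_at i (\<phi> n)) (g i)"
    "\<And>i j. l2_lim (lebesgue_on \<Omega>) (\<lambda>n. pderiv_at j (pderiv_at i (\<phi> n))) (h i j)"
    using H2_0_jet_sequence[OF \<Omega> a] by metis
  obtain \<psi> where \<psi>: "\<And>n::nat. \<psi> n \<in> test_functions \<Omega>" "l2_lim (lebesgue_on \<Omega>) \<psi> u'"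
    "\<And>i. l2_lim (lebesgue_on \<Omega>) (\<lambda>n. pderiv_at i (\<psi> n)) (g' i)"
    "\<And>i j. l2_lim (lebesgue_on \<Omega>) (\<lambda>n. pderiv_at j (pderiv_at i (\<psi> n))) (h' i j)"
    using H2_0_jet_sequence[OF \<Omega> b] by metis
  have d: "pderiv_at i (\<lambda>x. \<phi> n x + \<psi> n x) = (\<lambda>x. pderiv_at i (\<phi> n) x + pderiv_at i (\<psi> n) x)" for i n
    by (intro ext pderiv_at_add smooth_differentiable test_smooth[OF \<phi>(1)] test_smooth[OF \<psi>(1)])
  have dd: "pderiv_at j (\<lambda>x. pderiv_at i (\<phi> n) x + pderiv_at i (\<psi> n) x) =
      (\<lambda>x. pderiv_at j (pderiv_at i (\<phi> n)) x + pderiv_at j (pderiv_at i (\<psi> n)) x)" for i j n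
    by (intro ext pderiv_at_add smooth_differentiable smooth_pderiv_at test_smooth[OF \<phi>(1)] test_smooth[OF \<psi>(1)])
  show ?thesis
    by (rule H2_0_jetI_limit[OF \<Omega> test_H2_0_jet[OF \<Omega> test_add[OF \<phi>(1) \<psi>(1)]]])
       (auto simp: d dd intro!: l2_lim_add \<phi> \<psi>)
qed

lemma L2_eq_l2: "L2 \<Omega> = l2 (lebesgue_on \<Omega>)"
  by (simp add: L2_def l2_def)

lemma l2_cong_AE_on:
  assumes "open \<Omega>" "f \<in> l2 (lebesgue_on \<Omega>)" "AE x in lebesgue_on \<Omega>. f x = g x"
  shows "g \<in> l2 (lebesgue_on \<Omega>)"
  using l2_cong_AE[OF assms(2,3)] measurable_cong_AE_lebesgue_on[OF _ l2_measurable[OF assms(2)] assms(3)] assms(1) by auto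

lemma integral_square_cong_AE_on:
  assumes "open \<Omega>" "f \<in> l2 (lebesgue_on \<Omega>)" "AE x in lebesgue_on \<Omega>. g x = f x"
  shows "(\<integral>x. (g x)\<^sup>2 \<partial>lebesgue_on \<Omega>) = (\<integral>x. (f x)\<^sup>2 \<partial>lebesgue_on \<Omega>)"
proof -
  have "g \<in> l2 (lebesgue_on \<Omega>)"
    by (rule l2_cong_AE_on[OF assms(1,2)]) (use assms(3) in \<open>auto elim!: eventually_mono\<close>)
  then show ?thesis using assms by (intro integral_cong_AE) (auto simp: l2_def elim!: eventually_mono)
qed

lemma sobolev_sqnorm_1:
  assumes "open \<Omega>" "\<And>i. has_weak_pderiv \<Omega> i u (g i)" "\<And>i. g i \<in> l2 (lebesgue_on \<Omega>)"
  shows "sobolev_sqnorm \<Omega> 1 u = (\<integral>x. (u x)\<^sup>2 \<partial>lebesgue_on \<Omega>) + (\<Sum>i\<in>UNIV. \<integral>x. (g i x)\<^sup>2 \<partial>lebesgue_on \<Omega>)"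
  using integral_square_cong_AE_on[OF assms(1,3) weak_pderiv(2)[OF assms(1,2)]] by simp

lemma sobolev_sqnorm_2:
  assumes \<Omega>: "open \<Omega>" and g: "\<And>i. has_weak_pderiv \<Omega> i u (g i)" "\<And>i. g i \<in> l2 (lebesgue_on \<Omega>)"
    and h: "\<And>i j. has_weak_pderiv \<Omega> j (g i) (h i j)" "\<And>i j. h i j \<in> l2 (lebesgue_on \<Omega>)"
  shows "sobolev_sqnorm \<Omega> 2 u = (\<integral>x. (u x)\<^sup>2 \<partial>lebesgue_on \<Omega>) +
    (\<Sum>i\<in>UNIV. (\<integral>x. (g i x)\<^sup>2 \<partial>lebesgue_on \<Omega>) + (\<Sum>j\<in>UNIV. \<integral>x. (h i j x)\<^sup>2 \<partial>lebesgue_on \<Omega>))"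
proof -
  have "sobolev_sqnorm \<Omega> 1 (weak_pderiv \<Omega> i u) =
      (\<integral>x. (g i x)\<^sup>2 \<partial>lebesgue_on \<Omega>) + (\<Sum>j\<in>UNIV. \<integral>x. (h i j x)\<^sup>2 \<partial>lebesgue_on \<Omega>)" for i
  proof -
    have ae: "AE x in lebesgue_on \<Omega>. weak_pderiv \<Omega> i u x = g i x" using weak_pderiv(2)[OF \<Omega> g(1)] .
    then have "AE x in lebesgue_on \<Omega>. g i x = weak_pderiv \<Omega> i u x" by eventually_elim simp
    from has_weak_pderiv_cong_AE[OF \<Omega> h(1) this]
    show ?thesis using integral_square_cong_AE_on[OF \<Omega> g(2) ae]
      by (subst sobolev_sqnorm_1[OF \<Omega> _ h(2)]) auto
  qed
  then show ?thesis by (simp add: numeral_2_eq_2)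
qed

lemma H1_0_jet_has_weak_pderiv:
  assumes "open \<Omega>" "H1_0_jet \<Omega> u g" shows "has_weak_pderiv \<Omega> i u (g i)"
  by (rule H1_0_jet_sequence[OF assms]) (rule l2_lim_has_weak_pderiv[OF assms(1)])

lemma H2_0_jet_has_weak_pderiv:
  assumes "open \<Omega>" "H2_0_jet \<Omega> u g h"
  shows "has_weak_pderiv \<Omega> i u (g i)" "has_weak_pderiv \<Omega> j (g i) (h i j)"
proof -
  obtain \<phi> where \<phi>: "\<And>n::nat. \<phi> n \<in> test_functions \<Omega>" "l2_lim (lebesgue_on \<Omega>) \<phi> u"
    "\<And>i. l2_lim (lebesgue_on \<Omega>) (\<lambda>n. pderiv_at i (\<phi> n)) (g i)"
    "\<And>i j. l2_lim (lebesgue_on \<Omega>) (\<lambda>n. pderiv_at j (pderiv_at i (\<phi> n))) (h i j)"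
    using H2_0_jet_sequence[OF assms] by metis
  show "has_weak_pderiv \<Omega> i u (g i)" by (rule l2_lim_has_weak_pderiv[OF assms(1) \<phi>(1-3)])
  show "has_weak_pderiv \<Omega> j (g i) (h i j)"
    by (rule l2_lim_has_weak_pderiv[OF assms(1) test_pderiv_at[OF \<phi>(1)] \<phi>(3,4)])
qed

lemma sobolev_1_iff: "u \<in> sobolev \<Omega> 1 \<longleftrightarrow>
    u \<in> l2 (lebesgue_on \<Omega>) \<and> (\<exists>g. \<forall>i. g i \<in> l2 (lebesgue_on \<Omega>) \<and> has_weak_pderiv \<Omega> i u (g i))"
  by (auto simp: L2_eq_l2 Bex_def choice_iff)

lemma sobolev_2_iff: "u \<in> sobolev \<Omega> 2 \<longleftrightarrow>
    u \<in> l2 (lebesgue_on \<Omega>) \<and> (\<exists>g h. \<forall>i. g i \<in> l2 (lebesgue_on \<Omega>) \<and> has_weak_pderiv \<Omega> i u (g i) \<and>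
      (\<forall>j. h i j \<in> l2 (lebesgue_on \<Omega>) \<and> has_weak_pderiv \<Omega> j (g i) (h i j)))"
proof -
  let ?P = "\<lambda>i g h. g \<in> l2 (lebesgue_on \<Omega>) \<and> has_weak_pderiv \<Omega> i u g \<and>
      (\<forall>j. h j \<in> l2 (lebesgue_on \<Omega>) \<and> has_weak_pderiv \<Omega> j g (h j))"
  have "u \<in> sobolev \<Omega> 2 \<longleftrightarrow> u \<in> l2 (lebesgue_on \<Omega>) \<and> (\<forall>i. \<exists>g. g \<in> sobolev \<Omega> 1 \<and> has_weak_pderiv \<Omega> i u g)"
    by (auto simp: L2_eq_l2 numeral_2_eq_2)
  also have "\<dots> \<longleftrightarrow> u \<in> l2 (lebesgue_on \<Omega>) \<and> (\<forall>i. \<exists>g h. g \<in> l2 (lebesgue_on \<Omega>) \<and> has_weak_pderiv \<Omega> i u g \<and>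
      (\<forall>j. h j \<in> l2 (lebesgue_on \<Omega>) \<and> has_weak_pderiv \<Omega> j g (h j)))"
    unfolding sobolev_1_iff by blast
  finally have eq: "u \<in> sobolev \<Omega> 2 \<longleftrightarrow> u \<in> l2 (lebesgue_on \<Omega>) \<and> (\<forall>i. \<exists>g h. ?P i g h)" .
  have "(\<forall>i. \<exists>g h. ?P i g h) \<longleftrightarrow> (\<exists>g h. \<forall>i. ?P i (g i) (h i))"
  proof
    assume "\<forall>i. \<exists>g h. ?P i g h"
    from choice[OF this] obtain g where "\<forall>i. \<exists>h. ?P i (g i) h" by blast
    from choice[OF this] show "\<exists>g h. \<forall>i. ?P i (g i) (h i)" by blast
  qed blast
  with eq show ?thesis by blast
qed

text \<open>The weak derivatives that enter the Sobolev norm are chosen arbitrarily. By uniqueness up to null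
  sets the norm may be computed from any other weak derivatives, in particular from the limits of the
  derivatives of the approximating test functions.\<close>

lemma sobolev0_1_iff:
  assumes \<Omega>: "open \<Omega>"
  shows "u \<in> sobolev0 \<Omega> 1 \<longleftrightarrow> (\<exists>g. H1_0_jet \<Omega> u g)"
proof -
  let ?M = "lebesgue_on \<Omega>"
  have norm: "sobolev_sqnorm \<Omega> 1 (\<lambda>x. u x - \<phi> x) =
      (\<integral>x. (u x - \<phi> x)\<^sup>2 \<partial>?M) + (\<Sum>i\<in>UNIV. \<integral>x. (g i x - pderiv_at i \<phi> x)\<^sup>2 \<partial>?M)"
    if "\<And>i. has_weak_pderiv \<Omega> i u (g i)" "\<And>i. g i \<in> l2 ?M" "\<phi> \<in> test_functions \<Omega>" for g \<phi>
  proof (rule sobolev_sqnorm_1[OF \<Omega>])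
    show "has_weak_pderiv \<Omega> i (\<lambda>x. u x - \<phi> x) (\<lambda>x. g i x - pderiv_at i \<phi> x)" for i
      by (intro has_weak_pderiv_diff \<Omega> that test_has_weak_pderiv)
  qed (intro l2_diff test_l2[OF \<Omega>] that test_pderiv_at that(3))
  show ?thesis
  proof
    assume u: "u \<in> sobolev0 \<Omega> 1"
    then obtain g where g: "\<And>i. g i \<in> l2 ?M" "\<And>i. has_weak_pderiv \<Omega> i u (g i)" and ul: "u \<in> l2 ?M"
      unfolding sobolev0_def mem_Collect_eq sobolev_1_iff by metis
    have "H1_0_jet \<Omega> u g"
      unfolding H1_0_jet_def
    proof (intro conjI allI impI)
      fix \<epsilon> :: real assume "\<epsilon> > 0"
      then obtain \<phi> where \<phi>: "\<phi> \<in> test_functions \<Omega>" "sobolev_sqnorm \<Omega> 1 (\<lambda>x. u x - \<phi> x) < \<epsilon>"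
        using u unfolding sobolev0_def by blast
      have S: "(\<integral>x. (u x - \<phi> x)\<^sup>2 \<partial>?M) + (\<Sum>i\<in>UNIV. \<integral>x. (g i x - pderiv_at i \<phi> x)\<^sup>2 \<partial>?M) < \<epsilon>"
        using \<phi>(2) by (subst (asm) norm[OF g(2,1) \<phi>(1)])
      have "(\<integral>x. (g i x - pderiv_at i \<phi> x)\<^sup>2 \<partial>?M) \<le> (\<Sum>i\<in>UNIV. \<integral>x. (g i x - pderiv_at i \<phi> x)\<^sup>2 \<partial>?M)" for i
        by (rule member_le_sum) auto
      moreover have "(\<integral>x. (u x - \<phi> x)\<^sup>2 \<partial>?M) \<ge> 0" "(\<Sum>i\<in>UNIV. \<integral>x. (g i x - pderiv_at i \<phi> x)\<^sup>2 \<partial>?M) \<ge> 0"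
        by (auto intro: sum_nonneg)
      ultimately show "\<exists>\<phi>\<in>test_functions \<Omega>. (\<integral>x. (u x - \<phi> x)\<^sup>2 \<partial>?M) < \<epsilon> \<and>
        (\<forall>i. (\<integral>x. (g i x - pderiv_at i \<phi> x)\<^sup>2 \<partial>?M) < \<epsilon>)"
        using S by (intro bexI[OF _ \<phi>(1)] conjI allI) (meson add_increasing add_increasing2 le_less_trans order_refl)+
    qed (use g ul in auto)
    then show "\<exists>g. H1_0_jet \<Omega> u g" by blast
  next
    assume "\<exists>g. H1_0_jet \<Omega> u g"
    then obtain g where g: "H1_0_jet \<Omega> u g" by blast
    have w: "has_weak_pderiv \<Omega> i u (g i)" for i by (rule H1_0_jet_has_weak_pderiv[OF \<Omega> g])
    have gl: "g i \<in> l2 ?M" and ul: "u \<in> l2 ?M" for i using g unfolding H1_0_jet_def by blast+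
    obtain \<phi> where \<phi>: "\<And>n::nat. \<phi> n \<in> test_functions \<Omega>" "l2_lim ?M \<phi> u"
      "\<And>i. l2_lim ?M (\<lambda>n. pderiv_at i (\<phi> n)) (g i)"
      using H1_0_jet_sequence[OF \<Omega> g] by metis
    have "(\<lambda>n. (\<integral>x. (u x - \<phi> n x)\<^sup>2 \<partial>?M) + (\<Sum>i\<in>UNIV. \<integral>x. (g i x - pderiv_at i (\<phi> n) x)\<^sup>2 \<partial>?M)) \<longlonglongrightarrow> 0 + (\<Sum>i\<in>(UNIV::'a set). 0)"
      using \<phi>(2,3) by (intro tendsto_add tendsto_sum) (auto simp: l2_lim_def)
    then have lim: "(\<lambda>n. sobolev_sqnorm \<Omega> 1 (\<lambda>x. u x - \<phi> n x)) \<longlonglongrightarrow> 0"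
      using norm[OF w gl \<phi>(1)] by (simp del: sobolev_sqnorm.simps One_nat_def)
    show "u \<in> sobolev0 \<Omega> 1"
      unfolding sobolev0_def mem_Collect_eq
    proof (intro conjI allI impI)
      show "u \<in> sobolev \<Omega> 1" unfolding sobolev_1_iff using w gl ul by blast
      fix \<epsilon> :: real assume "\<epsilon> > 0"
      from eventually_small[OF lim this] obtain n where "sobolev_sqnorm \<Omega> 1 (\<lambda>x. u x - \<phi> n x) < \<epsilon>"
        by (auto simp: eventually_sequentially simp del: sobolev_sqnorm.simps One_nat_def)
      then show "\<exists>\<phi>\<in>test_functions \<Omega>. sobolev_sqnorm \<Omega> 1 (\<lambda>x. u x - \<phi> x) < \<epsilon>" using \<phi>(1) by blast
    qed
  qed
qed

lemma sobolev0_2_iff: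
  assumes \<Omega>: "open \<Omega>"
  shows "u \<in> sobolev0 \<Omega> 2 \<longleftrightarrow> (\<exists>g h. H2_0_jet \<Omega> u g h)"
proof -
  let ?M = "lebesgue_on \<Omega>"
  have norm: "sobolev_sqnorm \<Omega> 2 (\<lambda>x. u x - \<phi> x) = (\<integral>x. (u x - \<phi> x)\<^sup>2 \<partial>?M) +
      (\<Sum>i\<in>UNIV. (\<integral>x. (g i x - pderiv_at i \<phi> x)\<^sup>2 \<partial>?M) + (\<Sum>j\<in>UNIV. \<integral>x. (h i j x - pderiv_at j (pderiv_at i \<phi>) x)\<^sup>2 \<partial>?M))"
    if "\<And>i. has_weak_pderiv \<Omega> i u (g i)" "\<And>i. g i \<in> l2 ?M"
      "\<And>i j. has_weak_pderiv \<Omega> j (g i) (h i j)" "\<And>i j. h i j \<in> l2 ?M" "\<phi> \<in> test_functions \<Omega>" for g h \<phi>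
  proof (rule sobolev_sqnorm_2[OF \<Omega>])
    show "has_weak_pderiv \<Omega> i (\<lambda>x. u x - \<phi> x) (\<lambda>x. g i x - pderiv_at i \<phi> x)"
      "has_weak_pderiv \<Omega> j (\<lambda>x. g i x - pderiv_at i \<phi> x) (\<lambda>x. h i j x - pderiv_at j (pderiv_at i \<phi>) x)" for i j
      by (intro has_weak_pderiv_diff \<Omega> that test_has_weak_pderiv test_pderiv_at)+
  qed (intro l2_diff test_l2[OF \<Omega>] that test_pderiv_at that(5))+
  show ?thesis
  proof
    assume u: "u \<in> sobolev0 \<Omega> 2"
    then obtain g h where g: "\<And>i. g i \<in> l2 ?M" "\<And>i. has_weak_pderiv \<Omega> i u (g i)"
      and h: "\<And>i j. h i j \<in> l2 ?M" "\<And>i j. has_weak_pderiv \<Omega> j (g i) (h i j)" and ul: "u \<in> l2 ?M"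
      unfolding sobolev0_def mem_Collect_eq sobolev_2_iff by metis
    have "H2_0_jet \<Omega> u g h"
      unfolding H2_0_jet_def
    proof (intro conjI allI impI)
      fix \<epsilon> :: real assume "\<epsilon> > 0"
      then obtain \<phi> where \<phi>: "\<phi> \<in> test_functions \<Omega>" "sobolev_sqnorm \<Omega> 2 (\<lambda>x. u x - \<phi> x) < \<epsilon>"
        using u unfolding sobolev0_def by blast
      define a where "a i = (\<integral>x. (g i x - pderiv_at i \<phi> x)\<^sup>2 \<partial>?M)" for i
      define b where "b i j = (\<integral>x. (h i j x - pderiv_at j (pderiv_at i \<phi>) x)\<^sup>2 \<partial>?M)" for i j
      have S: "(\<integral>x. (u x - \<phi> x)\<^sup>2 \<partial>?M) + (\<Sum>i\<in>UNIV. a i + (\<Sum>j\<in>UNIV. b i j)) < \<epsilon>"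
        unfolding a_def b_def using \<phi>(2) by (subst (asm) norm[OF g(2,1) h(2,1) \<phi>(1)])
      have nn: "a i \<ge> 0" "b i j \<ge> 0" for i j by (auto simp: a_def b_def)
      have "a i + (\<Sum>j\<in>UNIV. b i j) \<le> (\<Sum>i\<in>UNIV. a i + (\<Sum>j\<in>UNIV. b i j))" for i
        by (rule member_le_sum) (auto intro!: add_nonneg_nonneg sum_nonneg nn)
      moreover have "b i j \<le> (\<Sum>j\<in>UNIV. b i j)" for i j
        by (rule member_le_sum) (auto intro: nn)
      moreover have "(\<integral>x. (u x - \<phi> x)\<^sup>2 \<partial>?M) \<ge> 0" "(\<Sum>i\<in>UNIV. a i + (\<Sum>j\<in>UNIV. b i j)) \<ge> 0"
        by (auto intro!: sum_nonneg add_nonneg_nonneg nn)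
      moreover have "(\<Sum>j\<in>UNIV. b i j) \<ge> 0" for i by (auto intro!: sum_nonneg nn)
      moreover note S nn
      ultimately have "(\<integral>x. (u x - \<phi> x)\<^sup>2 \<partial>?M) < \<epsilon>" "a i < \<epsilon>" "b i j < \<epsilon>" for i j
        by (meson add_increasing add_increasing2 le_less_trans order.trans order_refl)+
      then show "\<exists>\<phi>\<in>test_functions \<Omega>. (\<integral>x. (u x - \<phi> x)\<^sup>2 \<partial>?M) < \<epsilon> \<and>
        (\<forall>i. (\<integral>x. (g i x - pderiv_at i \<phi> x)\<^sup>2 \<partial>?M) < \<epsilon>) \<and>
        (\<forall>i j. (\<integral>x. (h i j x - pderiv_at j (pderiv_at i \<phi>) x)\<^sup>2 \<partial>?M) < \<epsilon>)"
        unfolding a_def b_def by (intro bexI[OF _ \<phi>(1)]) auto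
    qed (use g h ul in auto)
    then show "\<exists>g h. H2_0_jet \<Omega> u g h" by blast
  next
    assume "\<exists>g h. H2_0_jet \<Omega> u g h"
    then obtain g h where g: "H2_0_jet \<Omega> u g h" by blast
    note w = H2_0_jet_has_weak_pderiv[OF \<Omega> g]
    have gl: "g i \<in> l2 ?M" and hl: "h i j \<in> l2 ?M" and ul: "u \<in> l2 ?M" for i j using g unfolding H2_0_jet_def by blast+
    obtain \<phi> where \<phi>: "\<And>n::nat. \<phi> n \<in> test_functions \<Omega>" "l2_lim ?M \<phi> u"
      "\<And>i. l2_lim ?M (\<lambda>n. pderiv_at i (\<phi> n)) (g i)"
      "\<And>i j. l2_lim ?M (\<lambda>n. pderiv_at j (pderiv_at i (\<phi> n))) (h i j)"
      using H2_0_jet_sequence[OF \<Omega> g] by metis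
    have "(\<lambda>n. (\<integral>x. (u x - \<phi> n x)\<^sup>2 \<partial>?M) + (\<Sum>i\<in>UNIV. (\<integral>x. (g i x - pderiv_at i (\<phi> n) x)\<^sup>2 \<partial>?M)
        + (\<Sum>j\<in>UNIV. \<integral>x. (h i j x - pderiv_at j (pderiv_at i (\<phi> n)) x)\<^sup>2 \<partial>?M)))
        \<longlonglongrightarrow> 0 + (\<Sum>i\<in>(UNIV::'a set). 0 + (\<Sum>j\<in>(UNIV::'a set). 0))"
      using \<phi>(2-4) by (intro tendsto_add tendsto_sum) (auto simp: l2_lim_def)
    then have lim: "(\<lambda>n. sobolev_sqnorm \<Omega> 2 (\<lambda>x. u x - \<phi> n x)) \<longlonglongrightarrow> 0"
      using norm[OF w(1) gl w(2) hl \<phi>(1)] by simp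
    show "u \<in> sobolev0 \<Omega> 2"
      unfolding sobolev0_def mem_Collect_eq
    proof (intro conjI allI impI)
      show "u \<in> sobolev \<Omega> 2" unfolding sobolev_2_iff using w gl hl ul by blast
      fix \<epsilon> :: real assume "\<epsilon> > 0"
      from eventually_small[OF lim this] obtain n where "sobolev_sqnorm \<Omega> 2 (\<lambda>x. u x - \<phi> n x) < \<epsilon>"
        by (auto simp: eventually_sequentially)
      then show "\<exists>\<phi>\<in>test_functions \<Omega>. sobolev_sqnorm \<Omega> 2 (\<lambda>x. u x - \<phi> x) < \<epsilon>" using \<phi>(1) by blast
    qed
  qed
qed

section \<open>Mollification\<close>

definition mollify :: "(real^'n \<Rightarrow> real) \<Rightarrow> (real^'n \<Rightarrow> real) \<Rightarrow> real^'n \<Rightarrow> real" where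
  "mollify \<rho> f x = (\<integral>y. f y * \<rho> (x - y) \<partial>lborel)"

lemma integrable_mult_bounded:
  fixes f g :: "'a \<Rightarrow> real"
  assumes "integrable M f" "g \<in> borel_measurable M" "\<And>x. \<bar>g x\<bar> \<le> B"
  shows "integrable M (\<lambda>x. f x * g x)"
proof (rule Bochner_Integration.integrable_bound[where f="\<lambda>x. B * f x"])
  have "\<bar>g x\<bar> \<le> \<bar>B\<bar>" for x using assms(3)[of x] by simp
  then show "AE x in M. norm (f x * g x) \<le> norm (B * f x)"
    by (auto simp: abs_mult mult.commute[of _ "\<bar>f _\<bar>"] intro!: mult_left_mono)
qed (use assms in auto)

lemma integrable_mult_test:
  assumes "integrable lborel f" "\<eta> \<in> test_functions UNIV"
  shows "integrable lborel (\<lambda>x. f x * \<eta> x)"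
proof -
  obtain B where "\<And>x. \<bar>\<eta> x\<bar> \<le> B" using test_bounded[OF assms(2)] by metis
  then show ?thesis
    using assms smooth_borel[OF test_smooth[OF assms(2)]] by (intro integrable_mult_bounded[where B=B]) auto
qed

lemma integrable_mollify_integrand:
  assumes "integrable lborel f" "\<rho> \<in> test_functions UNIV"
  shows "integrable lborel (\<lambda>y. f y * \<rho> (x - y))"
  by (rule integrable_mult_test[OF assms(1) test_reflect[OF assms(2)]])

lemma has_derivative_sum_pderiv_at:
  assumes "smooth f"
  shows "(f has_derivative (\<lambda>h. \<Sum>i\<in>UNIV. h $ i * pderiv_at i f x)) (at x)"
proof -
  have d: "(f has_derivative frechet_derivative f (at x)) (at x)"
    using smooth_differentiable[OF assms] frechet_derivative_works by blast
  have "linear (frechet_derivative f (at x))"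
    using smooth_differentiable[OF assms] by (rule linear_frechet_derivative)
  then have "frechet_derivative f (at x) (\<Sum>i\<in>UNIV. h $ i *\<^sub>R axis i 1) = (\<Sum>i\<in>UNIV. h $ i * pderiv_at i f x)" for h
    by (simp add: pderiv_at_def linear_sum linear_scale)
  moreover have "(\<Sum>i\<in>UNIV. h $ i *\<^sub>R axis i 1) = h" for h :: "real^'a"
    using basis_expansion[of h] by (simp only: scalar_mult_eq_scaleR)
  ultimately have "frechet_derivative f (at x) h = (\<Sum>i\<in>UNIV. h $ i * pderiv_at i f x)" for h
    by metis
  then have "frechet_derivative f (at x) = (\<lambda>h. \<Sum>i\<in>UNIV. h $ i * pderiv_at i f x)" by blast
  then show ?thesis using d by simp
qed

text \<open>The derivatives of a test function are uniformly continuous, so the remainder of the linear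
  approximation is small uniformly in the base point \<open>z\<close>. This is what permits differentiation of
  \<open>mollify \<rho> f\<close> under the integral when \<open>f\<close> is merely integrable.\<close>

lemma test_taylor_uniform:
  fixes \<rho> :: "real^'n \<Rightarrow> real"
  assumes "\<rho> \<in> test_functions UNIV" "e > 0"
  obtains d where "d > 0" "\<And>z h. norm h < d \<Longrightarrow>
     \<bar>\<rho> (z + h) - \<rho> z - (\<Sum>i\<in>UNIV. h $ i * pderiv_at i \<rho> z)\<bar> \<le> e * norm h"
proof -
  define e' where "e' = e / real CARD('n)"
  have e': "e' > 0" using assms by (simp add: e'_def)
  have "\<exists>d>0. \<forall>x y. dist x y < d \<longrightarrow> \<bar>pderiv_at i \<rho> x - pderiv_at i \<rho> y\<bar> < e'" for i
  proof -
    obtain K where "smooth (pderiv_at i \<rho>)" "compact K" "\<And>x. x \<notin> K \<Longrightarrow> pderiv_at i \<rho> x = 0"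
      using test_pderiv_at[OF assms(1), of i] by (metis test_functionsE)
    then show ?thesis
      using continuous_vanish_unif_continuous[OF smooth_continuous _ _ e'] by metis
  qed
  then obtain D where D: "\<And>i. D i > 0" "\<And>i x y. dist x y < D i \<Longrightarrow> \<bar>pderiv_at i \<rho> x - pderiv_at i \<rho> y\<bar> < e'"
    by metis
  define d where "d = Min (range D)"
  have d: "d > 0" "d \<le> D i" for i using D by (auto simp: d_def)
  show ?thesis
  proof (rule that[OF d(1)])
    fix z h :: "real^'n" assume h: "norm h < d"
    have der: "((\<lambda>t. \<rho> (z + t *\<^sub>R h)) has_real_derivative (\<Sum>i\<in>UNIV. h $ i * pderiv_at i \<rho> (z + t *\<^sub>R h))) (at t)" for t
    proof -
      have "((\<lambda>t. z + t *\<^sub>R h) has_derivative (\<lambda>s. s *\<^sub>R h)) (at t)"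
        by (auto intro!: derivative_eq_intros)
      from has_derivative_compose[OF this has_derivative_sum_pderiv_at[OF test_smooth[OF assms(1)]]]
      moreover have "(*) (\<Sum>i\<in>UNIV. h $ i * pderiv_at i \<rho> (z + t *\<^sub>R h)) =
          (\<lambda>s. \<Sum>i\<in>UNIV. (s *\<^sub>R h) $ i * pderiv_at i \<rho> (z + t *\<^sub>R h))"
        by (auto simp: sum_distrib_left sum_distrib_right mult_ac)
      ultimately show ?thesis unfolding has_field_derivative_def by simp
    qed
    obtain \<xi> where \<xi>: "0 < \<xi>" "\<xi> < 1"
      "\<rho> (z + 1 *\<^sub>R h) - \<rho> (z + 0 *\<^sub>R h) = (1 - 0) * (\<Sum>i\<in>UNIV. h $ i * pderiv_at i \<rho> (z + \<xi> *\<^sub>R h))"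
      using MVT2[of 0 1, OF zero_less_one der] by blast
    have "\<bar>\<rho> (z + h) - \<rho> z - (\<Sum>i\<in>UNIV. h $ i * pderiv_at i \<rho> z)\<bar> =
        \<bar>\<Sum>i\<in>UNIV. h $ i * (pderiv_at i \<rho> (z + \<xi> *\<^sub>R h) - pderiv_at i \<rho> z)\<bar>"
      using \<xi>(3) by (simp add: right_diff_distrib sum_subtractf)
    also have "\<dots> \<le> (\<Sum>i\<in>UNIV. \<bar>h $ i * (pderiv_at i \<rho> (z + \<xi> *\<^sub>R h) - pderiv_at i \<rho> z)\<bar>)"
      by (rule sum_abs)
    also have "\<dots> \<le> (\<Sum>i\<in>(UNIV::'n set). norm h * e')"
    proof (rule sum_mono)
      fix i
      have "\<xi> * norm h \<le> norm h" using \<xi> by (simp add: mult_left_le_one_le)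
      then have "dist (z + \<xi> *\<^sub>R h) z < D i" using h d(2)[of i] \<xi> by (simp add: dist_norm)
      then have "\<bar>pderiv_at i \<rho> (z + \<xi> *\<^sub>R h) - pderiv_at i \<rho> z\<bar> \<le> e'" using D(2) by (simp add: less_imp_le)
      then show "\<bar>h $ i * (pderiv_at i \<rho> (z + \<xi> *\<^sub>R h) - pderiv_at i \<rho> z)\<bar> \<le> norm h * e'"
        unfolding abs_mult by (intro mult_mono component_le_norm_cart) auto
    qed
    also have "\<dots> = e * norm h" by (simp add: e'_def)
    finally show "\<bar>\<rho> (z + h) - \<rho> z - (\<Sum>i\<in>UNIV. h $ i * pderiv_at i \<rho> z)\<bar> \<le> e * norm h" .
  qed
qed

lemma mollify_has_derivative:
  fixes f \<rho> :: "real^'n \<Rightarrow> real"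
  assumes f: "integrable lborel f" and \<rho>: "\<rho> \<in> test_functions UNIV"
  shows "(mollify \<rho> f has_derivative (\<lambda>h. \<Sum>i\<in>UNIV. h $ i * mollify (pderiv_at i \<rho>) f x)) (at x)"
  unfolding has_derivative_at_alt
proof (intro conjI allI impI)
  show "bounded_linear (\<lambda>h. \<Sum>i\<in>UNIV. h $ i * mollify (pderiv_at i \<rho>) f x)"
    by (intro bounded_linear_sum bounded_linear_mult_const bounded_linear_vec_nth)
  fix e :: real assume "e > 0"
  define A where "A = (\<integral>y. \<bar>f y\<bar> \<partial>lborel) + 1"
  have A: "A > 0" by (simp add: A_def add_nonneg_pos)
  obtain d where d: "d > 0" "\<And>z h. norm h < d \<Longrightarrow>
     \<bar>\<rho> (z + h) - \<rho> z - (\<Sum>i\<in>UNIV. h $ i * pderiv_at i \<rho> z)\<bar> \<le> e / A * norm h"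
    using test_taylor_uniform[OF \<rho> divide_pos_pos[OF \<open>e > 0\<close> A]] by blast
  show "\<exists>d>0. \<forall>y. norm (y - x) < d \<longrightarrow> norm (mollify \<rho> f y - mollify \<rho> f x -
      (\<Sum>i\<in>UNIV. (y - x) $ i * mollify (pderiv_at i \<rho>) f x)) \<le> e * norm (y - x)"
  proof (intro exI[of _ d] conjI allI impI d(1))
    fix w assume w: "norm (w - x) < d"
    define h where "h = w - x"
    define r where "r y = \<rho> (w - y) - \<rho> (x - y) - (\<Sum>i\<in>UNIV. h $ i * pderiv_at i \<rho> (x - y))" for y
    have r: "\<bar>r y\<bar> \<le> e / A * norm h" for y
      using d(2)[of h "x - y"] w by (simp add: r_def h_def)
    have i: "integrable lborel (\<lambda>y. f y * \<rho> (a - y))" "integrable lborel (\<lambda>y. f y * pderiv_at i \<rho> (a - y))" for a i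
      by (intro integrable_mollify_integrand f \<rho> test_pderiv_at)+
    have "(\<lambda>y. f y * r y) = (\<lambda>y. f y * \<rho> (w - y) - f y * \<rho> (x - y) - (\<Sum>i\<in>UNIV. h $ i * (f y * pderiv_at i \<rho> (x - y))))"
      by (auto simp: r_def algebra_simps sum_distrib_left)
    moreover have "integrable lborel \<dots>"
      by (intro Bochner_Integration.integrable_diff Bochner_Integration.integrable_sum integrable_mult_right i)
    ultimately have ir: "integrable lborel (\<lambda>y. f y * r y)"
      and eq: "(\<integral>y. f y * r y \<partial>lborel) = mollify \<rho> f w - mollify \<rho> f x - (\<Sum>k\<in>UNIV. h $ k * mollify (pderiv_at k \<rho>) f x)"
      using i by (simp_all add: mollify_def)
    have "\<bar>\<integral>y. f y * r y \<partial>lborel\<bar> \<le> (\<integral>y. \<bar>f y * r y\<bar> \<partial>lborel)" by (rule integral_abs_bound)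
    also have "\<dots> \<le> (\<integral>y. (e / A * norm h) * \<bar>f y\<bar> \<partial>lborel)"
    proof (rule integral_mono)
      show "\<bar>f y * r y\<bar> \<le> (e / A * norm h) * \<bar>f y\<bar>" for y
        unfolding abs_mult using mult_left_mono[OF r[of y] abs_ge_zero[of "f y"]] by (simp add: mult.commute)
    qed (use ir f in auto)
    also have "\<dots> = e / A * norm h * (A - 1)" by (simp add: A_def)
    also have "\<dots> \<le> e / A * norm h * A" using A \<open>e > 0\<close> by (intro mult_left_mono) auto
    also have "\<dots> = e * norm h" using A by simp
    finally show "norm (mollify \<rho> f w - mollify \<rho> f x - (\<Sum>i\<in>UNIV. (w - x) $ i * mollify (pderiv_at i \<rho>) f x)) \<le> e * norm (w - x)"
      unfolding eq h_def by simp
  qed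
qed

lemma pderiv_at_mollify:
  assumes "integrable lborel f" "\<rho> \<in> test_functions UNIV"
  shows "pderiv_at i (mollify \<rho> f) = mollify (pderiv_at i \<rho>) f"
proof
  fix x
  have "pderiv_at i (mollify \<rho> f) x = (\<Sum>k\<in>UNIV. axis i 1 $ k * mollify (pderiv_at k \<rho>) f x)"
    by (rule pderiv_at_eq[OF mollify_has_derivative[OF assms]])
  also have "\<dots> = (\<Sum>k\<in>UNIV. if k = i then mollify (pderiv_at k \<rho>) f x else 0)"
    by (intro sum.cong) (auto simp: axis_def)
  finally show "pderiv_at i (mollify \<rho> f) x = mollify (pderiv_at i \<rho>) f x" by simp
qed

lemma smooth_mollify:
  assumes f: "integrable lborel f" and "\<rho> \<in> test_functions UNIV"
  shows "smooth (mollify \<rho> f)"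
proof -
  have "C_diff k (mollify \<rho> f)" for k
    using assms(2)
  proof (induction k arbitrary: \<rho>)
    case 0
    then show ?case
      using has_derivative_continuous[OF mollify_has_derivative[OF f]]
      by (auto intro!: continuous_at_imp_continuous_on)
  next
    case (Suc k)
    then show ?case
      using mollify_has_derivative[OF f Suc.prems] unfolding C_diff.simps differentiable_def
      by (auto simp: pderiv_at_mollify[OF f Suc.prems] test_pderiv_at)
  qed
  then show ?thesis by (simp add: smooth_def)
qed

lemma mollify_eq_0:
  assumes "\<And>y. f y \<noteq> 0 \<Longrightarrow> \<rho> (x - y) = 0"
  shows "mollify \<rho> f x = 0"
proof -
  have "(\<lambda>y. f y * \<rho> (x - y)) = (\<lambda>y. 0)" using assms by force
  then show ?thesis by (simp add: mollify_def)
qed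

lemma test_mollify:
  assumes f: "integrable lborel f" "compact K" "\<And>x. x \<notin> K \<Longrightarrow> f x = 0"
    and \<rho>: "\<rho> \<in> test_functions UNIV" "compact L" "\<And>x. x \<notin> L \<Longrightarrow> \<rho> x = 0"
    and sub: "{x + y |x y. x \<in> K \<and> y \<in> L} \<subseteq> \<Omega>"
  shows "mollify \<rho> f \<in> test_functions \<Omega>"
proof (rule test_functionsI[OF smooth_mollify[OF f(1) \<rho>(1)] compact_sums[OF f(2) \<rho>(2)] sub])
  fix x assume x: "x \<notin> {x + y |x y. x \<in> K \<and> y \<in> L}"
  show "mollify \<rho> f x = 0"
  proof (rule mollify_eq_0)
    fix y assume "f y \<noteq> 0"
    then have "y \<in> K" using f(3) by blast
    then have "x - y \<notin> L" using x by force
    then show "\<rho> (x - y) = 0" by (rule \<rho>(3))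
  qed
qed

definition mollifier :: "(real^'n \<Rightarrow> real) \<Rightarrow> bool" where
  "mollifier \<rho> \<longleftrightarrow> \<rho> \<in> test_functions UNIV \<and> (\<forall>x. \<rho> x \<ge> 0) \<and> (\<integral>x. \<rho> x \<partial>lborel) = 1"

lemma mollifierD:
  assumes "mollifier \<rho>"
  shows "\<rho> \<in> test_functions UNIV" "\<rho> x \<ge> 0" "(\<integral>y. \<rho> (x - y) \<partial>lborel) = 1"
    "\<rho> \<in> borel_measurable borel" "integrable lborel (\<lambda>y. \<rho> (x - y))"
proof -
  show t: "\<rho> \<in> test_functions UNIV" and "\<rho> x \<ge> 0" using assms by (auto simp: mollifier_def)
  show m: "\<rho> \<in> borel_measurable borel" using smooth_borel[OF test_smooth[OF t]] .
  show "(\<integral>y. \<rho> (x - y) \<partial>lborel) = 1"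
    using integral_lborel_reflect[OF m, of x] assms by (simp add: mollifier_def)
  show "integrable lborel (\<lambda>y. \<rho> (x - y))" by (rule test_integrable[OF test_reflect[OF t]])
qed

text \<open>Young's inequality: Cauchy-Schwarz for the probability density \<open>\<rho> (x - y)\<close> bounds the square
  of the average by the average of the square, which is then integrated over \<open>x\<close> by Tonelli.\<close>

lemma mollify_l2:
  assumes i: "integrable lborel f" and f: "f \<in> l2 lborel" and \<rho>: "mollifier \<rho>"
  shows "mollify \<rho> f \<in> l2 lborel"
    and "(\<integral>x. (mollify \<rho> f x)\<^sup>2 \<partial>lborel) \<le> (\<integral>x. (f x)\<^sup>2 \<partial>lborel)"
proof -
  note \<rho>' = mollifierD[OF \<rho>]
  note [measurable] = \<rho>'(4)
  have [measurable]: "f \<in> borel_measurable borel" using f by (simp add: l2_def)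
  have f2: "integrable lborel (\<lambda>x. (f x)\<^sup>2)" using f by (simp add: l2_def)
  have sq: "(mollify \<rho> f x)\<^sup>2 \<le> (\<integral>y. (f y)\<^sup>2 * \<rho> (x - y) \<partial>lborel)" for x
  proof -
    have a: "(\<lambda>y. f y * sqrt (\<rho> (x - y))) \<in> l2 lborel"
      using integrable_mollify_integrand[OF f2 \<rho>'(1), of x] \<rho>'(2)
      by (simp add: l2_def power_mult_distrib)
    have b: "(\<lambda>y. sqrt (\<rho> (x - y))) \<in> l2 lborel"
      using \<rho>'(2,5) by (simp add: l2_def)
    show ?thesis
      using l2_cauchy_schwarz[OF a b] \<rho>'(2,3) by (simp add: mollify_def power_mult_distrib mult.assoc)
  qed
  have m: "mollify \<rho> f \<in> borel_measurable borel"
    by (rule smooth_borel[OF smooth_mollify[OF i \<rho>'(1)]])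
  have "(\<integral>\<^sup>+x. ennreal ((mollify \<rho> f x)\<^sup>2) \<partial>lborel) \<le> (\<integral>\<^sup>+x. ennreal (\<integral>y. (f y)\<^sup>2 * \<rho> (x - y) \<partial>lborel) \<partial>lborel)"
    by (intro nn_integral_mono ennreal_leI sq)
  also have "\<dots> = (\<integral>\<^sup>+x. \<integral>\<^sup>+y. ennreal ((f y)\<^sup>2 * \<rho> (x - y)) \<partial>lborel \<partial>lborel)"
    by (intro nn_integral_cong nn_integral_eq_integral[symmetric] integrable_mollify_integrand f2 \<rho>'(1))
       (simp add: \<rho>'(2))
  also have "\<dots> = (\<integral>\<^sup>+y. \<integral>\<^sup>+x. ennreal ((f y)\<^sup>2 * \<rho> (x - y)) \<partial>lborel \<partial>lborel)"
    by (rule lborel_pair.Fubini') simp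
  also have "\<dots> = (\<integral>\<^sup>+y. ennreal ((f y)\<^sup>2) \<partial>lborel)"
  proof (rule nn_integral_cong)
    fix y :: "real^'a"
    have "(\<integral>\<^sup>+x. ennreal (\<rho> (x - y)) \<partial>lborel) = (\<integral>\<^sup>+x. ennreal (\<rho> x) \<partial>lborel)"
      using nn_integral_lborel_shift[of "\<lambda>x. ennreal (\<rho> x)" "- y"] by simp
    also have "\<dots> = ennreal (\<integral>x. \<rho> x \<partial>lborel)"
      by (intro nn_integral_eq_integral test_integrable[OF \<rho>'(1)]) (simp add: \<rho>'(2))
    finally have "(\<integral>\<^sup>+x. ennreal (\<rho> (x - y)) \<partial>lborel) = 1" using \<rho> by (simp add: mollifier_def)
    then show "(\<integral>\<^sup>+x. ennreal ((f y)\<^sup>2 * \<rho> (x - y)) \<partial>lborel) = ennreal ((f y)\<^sup>2)"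
      by (simp add: ennreal_mult \<rho>'(2) nn_integral_cmult)
  qed
  also have "\<dots> = ennreal (\<integral>y. (f y)\<^sup>2 \<partial>lborel)"
    by (intro nn_integral_eq_integral f2) simp
  finally have le: "(\<integral>\<^sup>+x. ennreal ((mollify \<rho> f x)\<^sup>2) \<partial>lborel) \<le> ennreal (\<integral>y. (f y)\<^sup>2 \<partial>lborel)" .
  have int: "integrable lborel (\<lambda>x. (mollify \<rho> f x)\<^sup>2)"
    by (rule integrableI_bounded) (use m le in \<open>auto simp: le_less_trans\<close>)
  then show "mollify \<rho> f \<in> l2 lborel" using m by (simp add: l2_def)
  have "ennreal (\<integral>x. (mollify \<rho> f x)\<^sup>2 \<partial>lborel) \<le> ennreal (\<integral>y. (f y)\<^sup>2 \<partial>lborel)"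
    using le nn_integral_eq_integral[OF int] by simp
  then show "(\<integral>x. (mollify \<rho> f x)\<^sup>2 \<partial>lborel) \<le> (\<integral>x. (f x)\<^sup>2 \<partial>lborel)" by simp
qed

definition cont_csupp :: "(real^'n \<Rightarrow> real) \<Rightarrow> bool" where
  "cont_csupp c \<longleftrightarrow> continuous_on UNIV c \<and> (\<exists>K. compact K \<and> (\<forall>x. x \<notin> K \<longrightarrow> c x = 0))"

text \<open>The functions whose mollifications will be shown to be smooth, for which integrability is used, and
  to converge in \<open>L\<^sup>2\<close>, for which approximability by continuous functions is used.\<close>

definition l2_approx :: "(real^'n \<Rightarrow> real) \<Rightarrow> bool" where
  "l2_approx f \<longleftrightarrow> integrable lborel f \<and> f \<in> l2 lborel \<and>
     (\<forall>\<epsilon>>0. \<exists>c. cont_csupp c \<and> (\<integral>x. (f x - c x)\<^sup>2 \<partial>lborel) < \<epsilon>)"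

lemma cont_csuppE:
  assumes "cont_csupp c"
  obtains K where "continuous_on UNIV c" "compact K" "\<And>x. x \<notin> K \<Longrightarrow> c x = 0"
  using assms unfolding cont_csupp_def by blast

lemma cont_csupp_l2:
  assumes "cont_csupp c" shows "integrable lborel c" "c \<in> l2 lborel"
proof -
  obtain K where K: "continuous_on UNIV c" "compact K" "\<And>x. x \<notin> K \<Longrightarrow> c x = 0"
    using cont_csuppE[OF assms] by metis
  show "integrable lborel c" using continuous_vanish_integrable[OF K] .
  have "continuous_on UNIV (\<lambda>x. (c x)\<^sup>2)" using K by (intro continuous_intros)
  from continuous_vanish_integrable[OF this K(2)] have "integrable lborel (\<lambda>x. (c x)\<^sup>2)" using K(3) by simp
  then show "c \<in> l2 lborel" using K(1) by (simp add: l2_def borel_measurable_continuous_onI)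
qed

lemma cont_csupp_l2_approx: "cont_csupp c \<Longrightarrow> l2_approx c"
  unfolding l2_approx_def using cont_csupp_l2 by (auto intro!: exI[of _ c])

lemma cont_csupp_add:
  assumes "cont_csupp c" "cont_csupp d" shows "cont_csupp (\<lambda>x. c x + d x)"
proof -
  obtain K where K: "continuous_on UNIV c" "compact K" "\<And>x. x \<notin> K \<Longrightarrow> c x = 0"
    using cont_csuppE[OF assms(1)] by metis
  obtain L where L: "continuous_on UNIV d" "compact L" "\<And>x. x \<notin> L \<Longrightarrow> d x = 0"
    using cont_csuppE[OF assms(2)] by metis
  show ?thesis unfolding cont_csupp_def using K L
    by (intro conjI continuous_intros exI[of _ "K \<union> L"]) auto
qed

lemma cont_csupp_mult:
  assumes "cont_csupp c" "continuous_on UNIV g" shows "cont_csupp (\<lambda>x. c x * g x)"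
  using assms unfolding cont_csupp_def by (auto intro!: continuous_intros)

lemma test_cont_csupp: "f \<in> test_functions \<Omega> \<Longrightarrow> cont_csupp f"
  unfolding cont_csupp_def by (metis smooth_continuous test_functionsE)

lemma l2_approx_add:
  assumes "l2_approx f" "l2_approx g" shows "l2_approx (\<lambda>x. f x + g x)"
  unfolding l2_approx_def
proof (intro conjI allI impI)
  fix \<epsilon> :: real assume "\<epsilon> > 0"
  then have e: "\<epsilon> / 4 > 0" by simp
  obtain c where c: "cont_csupp c" "(\<integral>x. (f x - c x)\<^sup>2 \<partial>lborel) < \<epsilon> / 4"
    using assms(1) e unfolding l2_approx_def by meson
  obtain d where d: "cont_csupp d" "(\<integral>x. (g x - d x)\<^sup>2 \<partial>lborel) < \<epsilon> / 4"
    using assms(2) e unfolding l2_approx_def by meson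
  have fg: "f \<in> l2 lborel" "g \<in> l2 lborel" using assms unfolding l2_approx_def by blast+
  have "(\<integral>x. ((f x + g x) - (c x + d x))\<^sup>2 \<partial>lborel) = (\<integral>x. ((f x - c x) + (g x - d x))\<^sup>2 \<partial>lborel)"
    by (simp add: algebra_simps)
  also have "\<dots> < \<epsilon>"
    using integral_square_sum_le[OF l2_diff[OF fg(1) cont_csupp_l2(2)[OF c(1)]] l2_diff[OF fg(2) cont_csupp_l2(2)[OF d(1)]]] c(2) d(2)
    by simp
  finally show "\<exists>c. cont_csupp c \<and> (\<integral>x. (f x + g x - c x)\<^sup>2 \<partial>lborel) < \<epsilon>"
    using cont_csupp_add[OF c(1) d(1)] by blast
next
  show "integrable lborel (\<lambda>x. f x + g x)" "(\<lambda>x. f x + g x) \<in> l2 lborel"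
    using assms unfolding l2_approx_def by (blast intro: l2_add Bochner_Integration.integrable_add)+
qed

lemma l2_approx_test_mult:
  assumes f: "l2_approx f" and \<theta>: "\<theta> \<in> test_functions UNIV" shows "l2_approx (\<lambda>x. \<theta> x * f x)"
proof -
  obtain B where B: "B > 0" "\<And>x. \<bar>\<theta> x\<bar> \<le> B" using test_bounded[OF \<theta>] by metis
  have fl: "integrable lborel f" "f \<in> l2 lborel" using f unfolding l2_approx_def by blast+
  have m: "\<theta> \<in> borel_measurable lborel" using smooth_borel[OF test_smooth[OF \<theta>]] by simp
  have "\<exists>c. cont_csupp c \<and> (\<integral>x. (\<theta> x * f x - c x)\<^sup>2 \<partial>lborel) < \<epsilon>" if "\<epsilon> > 0" for \<epsilon>
  proof -
    have "\<epsilon> / B\<^sup>2 > 0" using that B by simp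
    then obtain c where c: "cont_csupp c" "(\<integral>x. (f x - c x)\<^sup>2 \<partial>lborel) < \<epsilon> / B\<^sup>2"
      using f unfolding l2_approx_def by meson
    have l: "(\<lambda>x. f x - c x) \<in> l2 lborel" by (rule l2_diff[OF fl(2) cont_csupp_l2(2)[OF c(1)]])
    have "(\<integral>x. (\<theta> x * (f x - c x))\<^sup>2 \<partial>lborel) \<le> (\<integral>x. B\<^sup>2 * (f x - c x)\<^sup>2 \<partial>lborel)"
    proof (rule integral_mono)
      show "integrable lborel (\<lambda>x. (\<theta> x * (f x - c x))\<^sup>2)"
        using l2_bounded_mult[OF l m B(2)] by (simp add: l2_def)
      show "(\<theta> x * (f x - c x))\<^sup>2 \<le> B\<^sup>2 * (f x - c x)\<^sup>2" for x
        using B(2)[of x] B(1) unfolding power_mult_distrib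
        by (intro mult_right_mono) (auto simp: abs_le_square_iff[symmetric])
    qed (use l in \<open>auto simp: l2_def\<close>)
    also have "\<dots> < \<epsilon>" using c(2) B by (simp add: field_simps)
    finally have "(\<integral>x. (\<theta> x * f x - c x * \<theta> x)\<^sup>2 \<partial>lborel) < \<epsilon>" by (simp add: algebra_simps)
    then show ?thesis using cont_csupp_mult[OF c(1) smooth_continuous[OF test_smooth[OF \<theta>]]] by blast
  qed
  moreover have "integrable lborel (\<lambda>x. \<theta> x * f x)"
    using integrable_mult_test[OF fl(1) \<theta>] by (simp add: mult.commute)
  ultimately show ?thesis
    unfolding l2_approx_def using l2_bounded_mult[OF fl(2) m B(2)] by blast
qed

lemma mollify_diff:
  assumes "integrable lborel f" "integrable lborel g" "\<rho> \<in> test_functions UNIV"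
  shows "mollify \<rho> (\<lambda>x. f x - g x) x = mollify \<rho> f x - mollify \<rho> g x"
  unfolding mollify_def left_diff_distrib
  by (intro Bochner_Integration.integral_diff integrable_mollify_integrand assms)

text \<open>The convergence is uniform by uniform continuity, and it takes place within a fixed ball.\<close>

lemma mollify_uniform_convergence:
  assumes c: "cont_csupp c" and \<rho>: "\<And>n. mollifier (\<rho> n)" and r: "\<And>n z. norm z \<ge> r n \<Longrightarrow> \<rho> n z = 0"
    "r \<longlonglongrightarrow> 0"
  shows "(\<lambda>n. \<integral>x. (mollify (\<rho> n) c x - c x)\<^sup>2 \<partial>lborel) \<longlonglongrightarrow> 0"
proof -
  obtain K where K: "continuous_on UNIV c" "compact K" "\<And>x. x \<notin> K \<Longrightarrow> c x = 0"
    using cont_csuppE[OF c] by metis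
  note ci = cont_csupp_l2[OF c]
  obtain R where R: "K \<subseteq> cball 0 R"
    using bounded_subset_ballD[OF compact_imp_bounded[OF K(2)], of 0] ball_subset_cball by blast
  define W where "W = cball (0::real^'a) (R + 1)"
  define V where "V = measure lborel W + 1"
  have V: "V > 0" by (simp add: V_def add_nonneg_pos)
  show ?thesis
  proof (rule order_tendstoI)
    show "\<forall>\<^sub>F n in sequentially. a < (\<integral>x. (mollify (\<rho> n) c x - c x)\<^sup>2 \<partial>lborel)" if "a < 0" for a
      using that by (intro always_eventually allI) (auto intro: less_le_trans)
    fix a :: real assume a: "0 < a"
    define e where "e = sqrt (a / V)"
    have e: "e > 0" "e\<^sup>2 * V = a" using a V by (auto simp: e_def)
    obtain d where d: "d > 0" "\<And>x y. dist x y < d \<Longrightarrow> \<bar>c x - c y\<bar> < e"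
      using continuous_vanish_unif_continuous[OF K e(1)] by metis
    have "\<forall>\<^sub>F n in sequentially. r n < min d 1"
      using r(2) d(1) by (intro order_tendstoD(2)) auto
    then show "\<forall>\<^sub>F n in sequentially. (\<integral>x. (mollify (\<rho> n) c x - c x)\<^sup>2 \<partial>lborel) < a"
    proof eventually_elim
      case (elim n)
      note \<rho>' = mollifierD[OF \<rho>, of n]
      have bound: "\<bar>mollify (\<rho> n) c x - c x\<bar> \<le> e" for x
      proof -
        have i: "integrable lborel (\<lambda>y. c y * \<rho> n (x - y))" by (rule integrable_mollify_integrand[OF ci(1) \<rho>'(1)])
        have "mollify (\<rho> n) c x - c x = (\<integral>y. (c y - c x) * \<rho> n (x - y) \<partial>lborel)"
          unfolding mollify_def left_diff_distrib
          using i \<rho>'(3,5)[of x] by simp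
        also have "\<bar>\<dots>\<bar> \<le> (\<integral>y. \<bar>(c y - c x) * \<rho> n (x - y)\<bar> \<partial>lborel)" by (rule integral_abs_bound)
        also have "\<dots> \<le> (\<integral>y. e * \<rho> n (x - y) \<partial>lborel)"
        proof (rule integral_mono)
          show "integrable lborel (\<lambda>y. \<bar>(c y - c x) * \<rho> n (x - y)\<bar>)"
            unfolding left_diff_distrib using i \<rho>'(5)[of x] by auto
          show "integrable lborel (\<lambda>y. e * \<rho> n (x - y))" using \<rho>'(5)[of x] by auto
          show "\<bar>(c y - c x) * \<rho> n (x - y)\<bar> \<le> e * \<rho> n (x - y)" for y
          proof (cases "norm (x - y) \<ge> r n")
            case True then show ?thesis using r(1) by simp
          next
            case False
            then have "\<bar>c y - c x\<bar> \<le> e" using d(2)[of y x] elim by (simp add: dist_norm norm_minus_commute less_imp_le)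
            then show ?thesis using \<rho>'(2) by (auto simp: abs_mult intro!: mult_right_mono)
          qed
        qed
        also have "\<dots> = e" using \<rho>'(3)[of x] by simp
        finally show ?thesis .
      qed
      have zero: "mollify (\<rho> n) c x - c x = 0" if "x \<notin> W" for x
      proof -
        have "mollify (\<rho> n) c x = 0"
        proof (rule mollify_eq_0)
          fix y assume "c y \<noteq> 0"
          then have "norm y \<le> R" using K(3) R by (auto simp: subset_iff)
          then have "norm (x - y) \<ge> r n"
            using that elim norm_triangle_ineq2[of x y] by (simp add: W_def)
          then show "\<rho> n (x - y) = 0" by (rule r(1))
        qed
        moreover have "c x = 0" using that K(3) R by (force simp: W_def)
        ultimately show ?thesis by simp
      qed
      have l: "(\<lambda>x. mollify (\<rho> n) c x - c x) \<in> l2 lborel"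
        by (intro l2_diff mollify_l2 ci \<rho>)
      have "(\<integral>x. (mollify (\<rho> n) c x - c x)\<^sup>2 \<partial>lborel) \<le> (\<integral>x. e\<^sup>2 * indicator W x \<partial>lborel)"
      proof (rule integral_mono)
        show "integrable lborel (\<lambda>x. (mollify (\<rho> n) c x - c x)\<^sup>2)" using l by (simp add: l2_def)
        show "integrable lborel (\<lambda>x. e\<^sup>2 * indicator W x :: real)"
          by (auto simp: W_def intro!: integrable_mult_right integrable_real_indicator emeasure_lborel_cball_finite)
        show "(mollify (\<rho> n) c x - c x)\<^sup>2 \<le> e\<^sup>2 * indicator W x" for x
          using zero[of x] bound[of x] e(1) by (cases "x \<in> W") (auto simp: abs_le_square_iff[symmetric])
      qed
      also have "\<dots> = e\<^sup>2 * (V - 1)" by (simp add: V_def W_def)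
      also have "\<dots> < a" using e by (simp add: algebra_simps)
      finally show ?case .
    qed
  qed
qed

text \<open>By Young's inequality the difference between the mollifications of \<open>f\<close> and of a continuous function
  \<open>c\<close> near \<open>f\<close> is as small as \<open>f - c\<close>, so it suffices that the mollifications of \<open>c\<close> converge. The
  supports of the mollifiers only need to shrink to the origin; they may lie on one side of it.\<close>

lemma mollify_l2_lim:
  assumes f: "l2_approx f" and \<rho>: "\<And>n. mollifier (\<rho> n)" and r: "\<And>n z. norm z \<ge> r n \<Longrightarrow> \<rho> n z = 0"
    "r \<longlonglongrightarrow> 0"
  shows "l2_lim lborel (\<lambda>n. mollify (\<rho> n) f) f"
proof -
  have fl: "integrable lborel f" "f \<in> l2 lborel" using f unfolding l2_approx_def by blast+
  have "(\<lambda>n. \<integral>x. (f x - mollify (\<rho> n) f x)\<^sup>2 \<partial>lborel) \<longlonglongrightarrow> 0"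
  proof (rule order_tendstoI)
    show "\<forall>\<^sub>F n in sequentially. a < (\<integral>x. (f x - mollify (\<rho> n) f x)\<^sup>2 \<partial>lborel)" if "a < 0" for a
      using that by (intro always_eventually allI) (auto intro: less_le_trans)
    fix a :: real assume "0 < a"
    then have a: "a / 16 > 0" by simp
    then obtain c where c: "cont_csupp c" "(\<integral>x. (f x - c x)\<^sup>2 \<partial>lborel) < a / 16"
      using f unfolding l2_approx_def by meson
    note ci = cont_csupp_l2[OF c(1)]
    have "\<forall>\<^sub>F n in sequentially. (\<integral>x. (mollify (\<rho> n) c x - c x)\<^sup>2 \<partial>lborel) < a / 16"
      by (rule order_tendstoD(2)[OF mollify_uniform_convergence[OF c(1) \<rho> r] a])
    then show "\<forall>\<^sub>F n in sequentially. (\<integral>x. (f x - mollify (\<rho> n) f x)\<^sup>2 \<partial>lborel) < a"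
    proof eventually_elim
      case (elim n)
      note t = mollifierD(1)[OF \<rho>, of n]
      have d: "(\<lambda>x. f x - c x) \<in> l2 lborel" "integrable lborel (\<lambda>x. f x - c x)"
        using fl ci by (auto intro: l2_diff)
      have d': "(\<lambda>x. c x - f x) \<in> l2 lborel" "integrable lborel (\<lambda>x. c x - f x)"
        using fl ci by (auto intro: l2_diff)
      have m: "(\<integral>x. (mollify (\<rho> n) (\<lambda>x. c x - f x) x)\<^sup>2 \<partial>lborel) < a / 16"
        using mollify_l2(2)[OF d'(2,1) \<rho>[of n]] c(2) by (simp add: power2_commute[of "c _"])
      have k: "(\<lambda>x. c x - mollify (\<rho> n) c x) \<in> l2 lborel"
        by (intro l2_diff mollify_l2 ci \<rho>)
      have s: "(\<integral>x. ((f x - c x) + (c x - mollify (\<rho> n) c x))\<^sup>2 \<partial>lborel) \<le> 2 * (a/16) + 2 * (a/16)"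
        using integral_square_sum_le[OF d(1) k] c(2) elim by (simp add: power2_commute[of "c _"])
      have "(\<integral>x. (((f x - c x) + (c x - mollify (\<rho> n) c x)) + mollify (\<rho> n) (\<lambda>x. c x - f x) x)\<^sup>2 \<partial>lborel) < a"
        using integral_square_sum_le[OF l2_add[OF d(1) k] mollify_l2(1)[OF d'(2,1) \<rho>[of n]]] s m \<open>0 < a\<close> by linarith
      then show ?case by (simp add: mollify_diff[OF ci(1) fl(1) t])
    qed
  qed
  then show ?thesis using fl mollify_l2(1)[OF fl \<rho>] by (simp add: l2_lim_def)
qed

section \<open>Weak derivatives on the whole space and cutoff functions\<close>

text \<open>Weak derivatives on the whole space with respect to the Borel-Lebesgue measure, for which
  convolutions and iterated integrals are available.\<close>

definition wderiv :: "'n \<Rightarrow> (real^'n \<Rightarrow> real) \<Rightarrow> (real^'n \<Rightarrow> real) \<Rightarrow> bool" where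
  "wderiv i f g \<longleftrightarrow> integrable lborel f \<and> integrable lborel g \<and>
     (\<forall>\<eta>\<in>test_functions UNIV. (\<integral>x. f x * pderiv_at i \<eta> x \<partial>lborel) = - (\<integral>x. g x * \<eta> x \<partial>lborel))"

text \<open>The reflected kernel \<open>y \<mapsto> \<rho> (x - y)\<close> is an admissible test function for the weak derivative.\<close>

lemma pderiv_at_mollify_wderiv:
  assumes w: "wderiv i f g" and \<rho>: "\<rho> \<in> test_functions UNIV"
  shows "pderiv_at i (mollify \<rho> f) = mollify \<rho> g"
proof -
  have f: "integrable lborel f" using w by (simp add: wderiv_def)
  have "mollify (pderiv_at i \<rho>) f x = mollify \<rho> g x" for x
  proof -
    have "pderiv_at i (\<lambda>y. \<rho> (x - y)) = (\<lambda>y. - pderiv_at i \<rho> (x - y))"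
      by (intro ext pderiv_at_reflect smooth_differentiable test_smooth[OF \<rho>])
    then have "(\<integral>y. f y * (- pderiv_at i \<rho> (x - y)) \<partial>lborel) = - (\<integral>y. g y * \<rho> (x - y) \<partial>lborel)"
      using w test_reflect[OF \<rho>, of x] unfolding wderiv_def by metis
    then show ?thesis by (simp add: mollify_def)
  qed
  then show ?thesis using pderiv_at_mollify[OF f \<rho>] by auto
qed

lemma wderiv_add:
  assumes "wderiv i f g" "wderiv i f' g'"
  shows "wderiv i (\<lambda>x. f x + f' x) (\<lambda>x. g x + g' x)"
  unfolding wderiv_def
proof (intro conjI ballI)
  fix \<eta> :: "real^'a \<Rightarrow> real" assume \<eta>: "\<eta> \<in> test_functions UNIV"
  have i: "integrable lborel f" "integrable lborel f'" "integrable lborel g" "integrable lborel g'"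
    using assms by (auto simp: wderiv_def)
  show "(\<integral>x. (f x + f' x) * pderiv_at i \<eta> x \<partial>lborel) = - (\<integral>x. (g x + g' x) * \<eta> x \<partial>lborel)"
    using assms \<eta> i unfolding wderiv_def
    by (simp add: distrib_right integrable_mult_test test_pderiv_at)
qed (use assms in \<open>auto simp: wderiv_def\<close>)

lemma wderiv_test_mult:
  assumes w: "wderiv i f g" and \<theta>: "\<theta> \<in> test_functions UNIV"
  shows "wderiv i (\<lambda>x. \<theta> x * f x) (\<lambda>x. \<theta> x * g x + pderiv_at i \<theta> x * f x)"
  unfolding wderiv_def
proof (intro conjI ballI)
  have i: "integrable lborel f" "integrable lborel g" using w by (auto simp: wderiv_def)
  have i2: "integrable lborel (\<lambda>x. \<theta> x * f x)" "integrable lborel (\<lambda>x. \<theta> x * g x)" 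
    "integrable lborel (\<lambda>x. pderiv_at i \<theta> x * f x)"
    using integrable_mult_test[OF i(1) \<theta>] integrable_mult_test[OF i(2) \<theta>] integrable_mult_test[OF i(1) test_pderiv_at[OF \<theta>]]
    by (simp_all add: mult.commute)
  show "integrable lborel (\<lambda>x. \<theta> x * f x)" by fact
  show "integrable lborel (\<lambda>x. \<theta> x * g x + pderiv_at i \<theta> x * f x)" using i2 by simp
  fix \<eta> :: "real^'a \<Rightarrow> real" assume \<eta>: "\<eta> \<in> test_functions UNIV"
  have t: "(\<lambda>x. \<theta> x * \<eta> x) \<in> test_functions UNIV" by (rule test_smooth_mult[OF test_smooth[OF \<theta>] \<eta>])
  have p: "pderiv_at i (\<lambda>x. \<theta> x * \<eta> x) = (\<lambda>x. \<theta> x * pderiv_at i \<eta> x + pderiv_at i \<theta> x * \<eta> x)"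
    by (intro ext pderiv_at_mult smooth_differentiable test_smooth[OF \<theta>] test_smooth[OF \<eta>])
  have e: "(\<integral>x. f x * (\<theta> x * pderiv_at i \<eta> x + pderiv_at i \<theta> x * \<eta> x) \<partial>lborel) = - (\<integral>x. g x * (\<theta> x * \<eta> x) \<partial>lborel)"
    using w t p unfolding wderiv_def by metis
  have a: "(\<lambda>x. f x * (\<theta> x * pderiv_at i \<eta> x + pderiv_at i \<theta> x * \<eta> x)) =
      (\<lambda>x. (\<theta> x * f x) * pderiv_at i \<eta> x + (pderiv_at i \<theta> x * f x) * \<eta> x)"
    "(\<lambda>x. g x * (\<theta> x * \<eta> x)) = (\<lambda>x. (\<theta> x * g x) * \<eta> x)"
    by (auto simp: algebra_simps)
  have b: "integrable lborel (\<lambda>x. (\<theta> x * f x) * pderiv_at i \<eta> x)" "integrable lborel (\<lambda>x. (pderiv_at i \<theta> x * f x) * \<eta> x)"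
     "integrable lborel (\<lambda>x. (\<theta> x * g x) * \<eta> x)"
    by (intro integrable_mult_test i2 test_pderiv_at \<eta>)+
  show "(\<integral>x. (\<theta> x * f x) * pderiv_at i \<eta> x \<partial>lborel) = - (\<integral>x. (\<theta> x * g x + pderiv_at i \<theta> x * f x) * \<eta> x \<partial>lborel)"
    using e b unfolding a distrib_right by (simp add: algebra_simps)
qed

lemma mollify_bounded:
  assumes "\<rho> \<in> test_functions UNIV" "f \<in> borel_measurable borel" "\<And>x. \<bar>f x\<bar> \<le> 1"
  shows "\<bar>mollify \<rho> f x\<bar> \<le> (\<integral>y. \<bar>\<rho> y\<bar> \<partial>lborel)"
proof -
  have m: "\<rho> \<in> borel_measurable borel" using smooth_borel[OF test_smooth[OF assms(1)]] .
  have i: "integrable lborel (\<lambda>y. \<rho> (x - y))" by (rule test_integrable[OF test_reflect[OF assms(1)]])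
  have i2: "integrable lborel (\<lambda>y. f y * \<rho> (x - y))"
    using integrable_mult_bounded[OF i _ assms(3)] assms(2) by (simp add: mult.commute)
  have "\<bar>mollify \<rho> f x\<bar> \<le> (\<integral>y. \<bar>f y * \<rho> (x - y)\<bar> \<partial>lborel)"
    unfolding mollify_def by (rule integral_abs_bound)
  also have "\<dots> \<le> (\<integral>y. \<bar>\<rho> (x - y)\<bar> \<partial>lborel)"
    using integrable_abs[OF i] integrable_abs[OF i2] assms(3)
    by (intro integral_mono) (auto simp: abs_mult intro!: mult_left_le_one_le)
  also have "\<dots> = (\<integral>y. \<bar>\<rho> y\<bar> \<partial>lborel)"
    using integral_lborel_reflect[of "\<lambda>y. \<bar>\<rho> y\<bar>" x] m by simp
  finally show ?thesis .
qed

text \<open>The cutoff functions are mollified indicator functions of balls. The bound \<open>B\<close> depends on the width \<open>s\<close>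
  of the transition layer but not on the radius, so that letting \<open>R\<close> tend to infinity gives cutoffs at
  infinity with bounded derivatives.\<close>

lemma cutoff_exists:
  assumes "s > 0"
  obtains B where "B > 0" "\<And>p::real^'n. \<And>R. \<exists>\<theta>\<in>test_functions UNIV. (\<forall>x\<in>ball p R. \<theta> x = 1) \<and>
    (\<forall>x. x \<notin> ball p (R + 2 * s) \<longrightarrow> \<theta> x = 0) \<and> (\<forall>x. \<bar>\<theta> x\<bar> \<le> B) \<and>
    (\<forall>i x. \<bar>pderiv_at i \<theta> x\<bar> \<le> B) \<and> (\<forall>i j x. \<bar>pderiv_at j (pderiv_at i \<theta>) x\<bar> \<le> B)"
proof -
  obtain \<rho> where \<rho>: "\<rho> \<in> test_functions UNIV" "\<And>x. \<rho> x \<ge> 0" "(\<integral>x. \<rho> x \<partial>lborel) = 1"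
    "\<And>x. x \<notin> ball (0::real^'n) s \<Longrightarrow> \<rho> x = 0"
    using mollifier_exists[OF assms, of 0] by metis
  have moll: "mollifier \<rho>" using \<rho> by (simp add: mollifier_def)
  define B0 where "B0 = (\<integral>y. \<bar>\<rho> y\<bar> \<partial>lborel)"
  define B1 where "B1 i = (\<integral>y. \<bar>pderiv_at i \<rho> y\<bar> \<partial>lborel)" for i
  define B2 where "B2 i j = (\<integral>y. \<bar>pderiv_at j (pderiv_at i \<rho>) y\<bar> \<partial>lborel)" for i j
  define B where "B = 1 + B0 + (\<Sum>i\<in>UNIV. B1 i) + (\<Sum>i\<in>UNIV. \<Sum>j\<in>UNIV. B2 i j)"
  have nn: "B0 \<ge> 0" "B1 i \<ge> 0" "B2 i j \<ge> 0" for i j by (auto simp: B0_def B1_def B2_def)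
  have s: "(\<Sum>i\<in>UNIV. B1 i) \<ge> 0" "(\<Sum>i\<in>UNIV. \<Sum>j\<in>UNIV. B2 i j) \<ge> 0" "(\<Sum>j\<in>UNIV. B2 i j) \<ge> 0" for i
    by (auto intro!: sum_nonneg nn)
  have l1: "B1 i \<le> (\<Sum>i\<in>UNIV. B1 i)" for i by (rule member_le_sum) (auto intro: nn)
  have "B2 i j \<le> (\<Sum>j\<in>UNIV. B2 i j)" for i j by (rule member_le_sum) (auto intro: nn)
  moreover have "(\<Sum>j\<in>UNIV. B2 i j) \<le> (\<Sum>i\<in>UNIV. \<Sum>j\<in>UNIV. B2 i j)" for i
    by (rule member_le_sum) (auto intro: s)
  ultimately have l2: "B2 i j \<le> (\<Sum>i\<in>UNIV. \<Sum>j\<in>UNIV. B2 i j)" for i j using order_trans by blast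
  have B: "B > 0" "B0 \<le> B" "B1 i \<le> B" "B2 i j \<le> B" for i j
    unfolding B_def using nn(1) s(1,2) l1[of i] l2[of i j] by linarith+
  show ?thesis
  proof (rule that[OF B(1)])
    fix p :: "real^'n" and R :: real
    define A where "A = (indicator (ball p (R + s)) :: real^'n \<Rightarrow> real)"
    have A: "integrable lborel A" "A \<in> borel_measurable borel" "\<bar>A x\<bar> \<le> 1" for x
      unfolding A_def
      by (auto intro!: integrable_real_indicator emeasure_lborel_ball_finite borel_measurable_indicator)
    have "mollify \<rho> A \<in> test_functions UNIV"
      by (rule test_mollify[OF A(1) compact_cball[of p "R + s"] _ \<rho>(1) compact_cball[of 0 s]])
         (auto simp: A_def indicator_def \<rho>(4))
    moreover have "mollify \<rho> A x = 1" if "x \<in> ball p R" for x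
    proof -
      have "(\<lambda>y. A y * \<rho> (x - y)) = (\<lambda>y. \<rho> (x - y))"
      proof
        fix y show "A y * \<rho> (x - y) = \<rho> (x - y)"
        proof (cases "x - y \<in> ball 0 s")
          case True
          then have "dist p y < R + s"
            using that dist_triangle[of p y x] by (simp add: dist_norm norm_minus_commute)
          then show ?thesis by (simp add: A_def)
        qed (simp add: \<rho>(4))
      qed
      then show ?thesis using mollifierD(3)[OF moll, of x] by (simp add: mollify_def)
    qed
    moreover have "mollify \<rho> A x = 0" if "x \<notin> ball p (R + 2 * s)" for x
    proof (rule mollify_eq_0)
      fix y assume "A y \<noteq> 0"
      then have "dist p y < R + s" by (auto simp: A_def indicator_def split: if_splits)
      then have "x - y \<notin> ball 0 s"
        using that dist_triangle[of p x y] by (simp add: dist_norm norm_minus_commute)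
      then show "\<rho> (x - y) = 0" by (rule \<rho>(4))
    qed
    moreover have "\<bar>mollify \<rho> A x\<bar> \<le> B" "\<bar>pderiv_at i (mollify \<rho> A) x\<bar> \<le> B"
      "\<bar>pderiv_at j (pderiv_at i (mollify \<rho> A)) x\<bar> \<le> B" for i j x
      using mollify_bounded[OF \<rho>(1) A(2,3), of x] mollify_bounded[OF test_pderiv_at[OF \<rho>(1)] A(2,3), of i x]
       mollify_bounded[OF test_pderiv_at[OF test_pderiv_at[OF \<rho>(1)]] A(2,3), of j i x] B
      unfolding pderiv_at_mollify[OF A(1) \<rho>(1)] pderiv_at_mollify[OF A(1) test_pderiv_at[OF \<rho>(1)]]
        B0_def[symmetric] B1_def[symmetric] B2_def[symmetric]
      by (meson order_trans)+
    ultimately show "\<exists>\<theta>\<in>test_functions UNIV. (\<forall>x\<in>ball p R. \<theta> x = 1) \<and>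
      (\<forall>x. x \<notin> ball p (R + 2 * s) \<longrightarrow> \<theta> x = 0) \<and> (\<forall>x. \<bar>\<theta> x\<bar> \<le> B) \<and>
      (\<forall>i x. \<bar>pderiv_at i \<theta> x\<bar> \<le> B) \<and> (\<forall>i j x. \<bar>pderiv_at j (pderiv_at i \<theta>) x\<bar> \<le> B)"
      by blast
  qed
qed

section \<open>Membership in the second Sobolev space with zero boundary values\<close>

lemma l2_lborel_restrict:
  assumes O: "open \<Omega>" and f: "f \<in> l2 lborel"
  shows "f \<in> l2 (lebesgue_on \<Omega>)" "(\<integral>x. (f x)\<^sup>2 \<partial>lebesgue_on \<Omega>) \<le> (\<integral>x. (f x)\<^sup>2 \<partial>lborel)"
proof -
  have m: "f \<in> borel_measurable lborel" and m2: "(\<lambda>x. (f x)\<^sup>2) \<in> borel_measurable lborel" using f by (auto simp: l2_def)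
  have i: "integrable lebesgue (\<lambda>x. (f x)\<^sup>2)"
    using f m2 by (simp add: integrable_completion l2_def)
  have S: "\<Omega> \<inter> space lebesgue \<in> sets lebesgue" using O by auto
  have i2: "integrable lebesgue (\<lambda>x. indicator \<Omega> x *\<^sub>R (f x)\<^sup>2)"
    by (rule integrable_mult_indicator[OF _ i]) (use O in auto)
  then have "integrable (lebesgue_on \<Omega>) (\<lambda>x. (f x)\<^sup>2)"
    using integrable_restrict_space[OF S] by blast
  then show "f \<in> l2 (lebesgue_on \<Omega>)"
    using measurable_restrict_space1[OF measurable_completion[OF m]] by (simp add: l2_def)
  have "(\<integral>x. (f x)\<^sup>2 \<partial>lebesgue_on \<Omega>) = (\<integral>x. indicator \<Omega> x *\<^sub>R (f x)\<^sup>2 \<partial>lebesgue)"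
    by (rule integral_restrict_space[OF S])
  also have "\<dots> \<le> (\<integral>x. (f x)\<^sup>2 \<partial>lebesgue)"
    by (rule integral_mono[OF i2 i]) (auto simp: indicator_def)
  also have "\<dots> = (\<integral>x. (f x)\<^sup>2 \<partial>lborel)" by (rule integral_completion[OF m2])
  finally show "(\<integral>x. (f x)\<^sup>2 \<partial>lebesgue_on \<Omega>) \<le> (\<integral>x. (f x)\<^sup>2 \<partial>lborel)" .
qed

lemma l2_lim_lborel_restrict:
  assumes O: "open \<Omega>" and l: "l2_lim lborel F f"
  shows "l2_lim (lebesgue_on \<Omega>) F f"
proof -
  have F: "F n \<in> l2 lborel" "f \<in> l2 lborel" for n using l by (auto simp: l2_lim_def)
  have "(\<lambda>n. \<integral>x. (f x - F n x)\<^sup>2 \<partial>lebesgue_on \<Omega>) \<longlonglongrightarrow> 0"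
  proof (rule tendsto_sandwich[OF _ _ tendsto_const])
    show "(\<lambda>n. \<integral>x. (f x - F n x)\<^sup>2 \<partial>lborel) \<longlonglongrightarrow> 0" using l by (simp add: l2_lim_def)
    show "\<forall>\<^sub>F n in sequentially. (\<integral>x. (f x - F n x)\<^sup>2 \<partial>lebesgue_on \<Omega>) \<le> (\<integral>x. (f x - F n x)\<^sup>2 \<partial>lborel)"
      using l2_lborel_restrict(2)[OF O l2_diff[OF F(2,1)]] by simp
  qed simp
  then show ?thesis using F O by (simp add: l2_lim_def l2_lborel_restrict(1))
qed

lemma l2_lim_dominated:
  assumes F: "\<And>n. F n \<in> borel_measurable M" and g: "g \<in> l2 M"
    and b: "\<And>n x. \<bar>F n x\<bar> \<le> g x" and lim: "\<And>x. (\<lambda>n. F n x) \<longlonglongrightarrow> f x"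
  shows "l2_lim M F f"
proof -
  have f: "f \<in> borel_measurable M"
    by (rule borel_measurable_LIMSEQ_real[OF lim F])
  have bf: "\<bar>f x\<bar> \<le> g x" for x
    by (rule LIMSEQ_le_const2[OF tendsto_rabs[OF lim]]) (use b in auto)
  have g2: "integrable M (\<lambda>x. (g x)\<^sup>2)" using g by (simp add: l2_def)
  have *: "u \<in> l2 M" if "u \<in> borel_measurable M" "\<And>x. \<bar>u x\<bar> \<le> g x" for u
  proof -
    have "integrable M (\<lambda>x. (u x)\<^sup>2)"
    proof (rule Bochner_Integration.integrable_bound[OF g2])
      have "(u x)\<^sup>2 \<le> (g x)\<^sup>2" for x
        using that(2)[of x] by (simp add: abs_le_square_iff[symmetric])
      then show "AE x in M. norm ((u x)\<^sup>2) \<le> norm ((g x)\<^sup>2)" by simp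
    qed (use that in simp)
    then show ?thesis using that by (simp add: l2_def)
  qed
  have "(\<lambda>n. \<integral>x. (f x - F n x)\<^sup>2 \<partial>M) \<longlonglongrightarrow> (\<integral>x. 0 \<partial>M)"
  proof (rule integral_dominated_convergence[where w="\<lambda>x. 4 * (g x)\<^sup>2"])
    show "AE x in M. (\<lambda>n. (f x - F n x)\<^sup>2) \<longlonglongrightarrow> 0"
      using lim by (intro AE_I2) (auto intro!: tendsto_eq_intros)
    have "(f x - F n x)\<^sup>2 \<le> 4 * (g x)\<^sup>2" for n x
    proof -
      have "\<bar>f x - F n x\<bar> \<le> \<bar>2 * g x\<bar>" using b[of n x] bf[of x] by linarith
      then show ?thesis using abs_le_square_iff[of "f x - F n x" "2 * g x"] by simp
    qed
    then show "AE x in M. norm ((f x - F n x)\<^sup>2) \<le> 4 * (g x)\<^sup>2" for n by simp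
  qed (use F f g2 in auto)
  then show ?thesis using *[OF F b] *[OF f bf] by (simp add: l2_lim_def)
qed

text \<open>A uniform interior cone condition at \<open>p\<close>: the translation direction \<open>e\<close> and the opening \<open>c\<close> of the cone are
  the same for all points near \<open>p\<close>. The margin \<open>c \<epsilon>\<close> leaves room for the support of a mollifier. The condition
  holds trivially at points which are not on the boundary.\<close>

definition inward_at :: "(real^'n) set \<Rightarrow> real^'n \<Rightarrow> bool" where
  "inward_at \<Omega> p \<longleftrightarrow> (\<exists>r>0. \<exists>e. \<exists>c>0. \<forall>K. compact K \<and> K \<subseteq> ball p r \<inter> closure \<Omega> \<longrightarrow>
     (\<exists>t>0. \<forall>\<epsilon>. 0 < \<epsilon> \<and> \<epsilon> < t \<longrightarrow> (\<forall>x\<in>K. cball (x + \<epsilon> *\<^sub>R e) (c * \<epsilon>) \<subseteq> \<Omega>)))"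

text \<open>Mollifiers supported in \<open>cball (\<epsilon> e) (c \<epsilon>)\<close> smooth the function and move it inwards at the same
  time.\<close>

lemma H2_0_jet_inward:
  fixes f :: "real^'n \<Rightarrow> real"
  assumes O: "open \<Omega>" and K: "compact K" "\<And>x. x \<notin> K \<Longrightarrow> f x = 0"
    and a: "l2_approx f" "\<And>i. l2_approx (f1 i)" "\<And>i j. l2_approx (f2 i j)"
    and w: "\<And>i. wderiv i f (f1 i)" "\<And>i j. wderiv j (f1 i) (f2 i j)"
    and inward: "c > 0" "t > 0" "\<And>\<epsilon> x. 0 < \<epsilon> \<Longrightarrow> \<epsilon> < t \<Longrightarrow> x \<in> K \<Longrightarrow> cball (x + \<epsilon> *\<^sub>R e) (c * \<epsilon>) \<subseteq> \<Omega>"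
  shows "H2_0_jet \<Omega> f f1 f2"
proof -
  define \<epsilon> where "\<epsilon> n = t / 2 * inverse (real (Suc n))" for n
  have \<epsilon>: "0 < \<epsilon> n" "\<epsilon> n < t" for n
  proof -
    have "inverse (real (Suc n)) \<le> 1" by (simp add: inverse_le_1_iff)
    then have "t / 2 * inverse (real (Suc n)) \<le> t / 2 * 1" using inward(2) by (intro mult_left_mono) auto
    then show "\<epsilon> n < t" using inward(2) unfolding \<epsilon>_def by linarith
    show "0 < \<epsilon> n" using inward(2) by (simp add: \<epsilon>_def)
  qed
  have "\<exists>\<rho>. mollifier \<rho> \<and> (\<forall>x. x \<notin> ball (\<epsilon> n *\<^sub>R e) (c * \<epsilon> n) \<longrightarrow> \<rho> x = 0)" for n
  proof -
    have "c * \<epsilon> n > 0" using inward(1) \<epsilon> by simp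
    then show ?thesis using mollifier_exists[of "c * \<epsilon> n" "\<epsilon> n *\<^sub>R e"] unfolding mollifier_def by metis
  qed
  then obtain \<rho> where \<rho>: "\<And>n. mollifier (\<rho> n)" "\<And>n x. x \<notin> ball (\<epsilon> n *\<^sub>R e) (c * \<epsilon> n) \<Longrightarrow> \<rho> n x = 0"
    by metis
  define r where "r n = \<epsilon> n * (norm e + c)" for n
  have r: "\<rho> n z = 0" if "norm z \<ge> r n" for n z
  proof (rule \<rho>(2))
    have "norm z \<le> norm (\<epsilon> n *\<^sub>R e) + norm (z - \<epsilon> n *\<^sub>R e)"
      using norm_triangle_ineq[of "\<epsilon> n *\<^sub>R e" "z - \<epsilon> n *\<^sub>R e"] by simp
    then show "z \<notin> ball (\<epsilon> n *\<^sub>R e) (c * \<epsilon> n)"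
      using that \<epsilon>(1)[of n] by (simp add: r_def dist_norm norm_minus_commute algebra_simps)
  qed
  have "(\<lambda>n. t / 2 * inverse (real (Suc n)) * (norm e + c)) \<longlonglongrightarrow> t / 2 * 0 * (norm e + c)"
    by (intro tendsto_intros LIMSEQ_inverse_real_of_nat)
  then have r0: "r \<longlonglongrightarrow> 0" unfolding r_def \<epsilon>_def by simp
  have fi: "integrable lborel f" "integrable lborel (f1 i)" for i
    using w(1) by (auto simp: wderiv_def)
  have test: "mollify (\<rho> n) f \<in> test_functions \<Omega>" for n
  proof (rule test_mollify[OF fi(1) K mollifierD(1)[OF \<rho>(1)] compact_cball[of "\<epsilon> n *\<^sub>R e" "c * \<epsilon> n"]])
    show "\<rho> n x = 0" if "x \<notin> cball (\<epsilon> n *\<^sub>R e) (c * \<epsilon> n)" for x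
      using that by (intro \<rho>(2)) auto
    show "{x + y |x y. x \<in> K \<and> y \<in> cball (\<epsilon> n *\<^sub>R e) (c * \<epsilon> n)} \<subseteq> \<Omega>"
    proof clarify
      fix x y assume "x \<in> K" "y \<in> cball (\<epsilon> n *\<^sub>R e) (c * \<epsilon> n)"
      then have "x + y \<in> cball (x + \<epsilon> n *\<^sub>R e) (c * \<epsilon> n)" by (simp add: dist_norm)
      then show "x + y \<in> \<Omega>" using inward(3)[OF \<epsilon> \<open>x \<in> K\<close>] by blast
    qed
  qed
  have d: "pderiv_at i (mollify (\<rho> n) f) = mollify (\<rho> n) (f1 i)"
    "pderiv_at j (mollify (\<rho> n) (f1 i)) = mollify (\<rho> n) (f2 i j)" for i j n
    by (rule pderiv_at_mollify_wderiv[OF _ mollifierD(1)[OF \<rho>(1)]], rule w)+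
  have "H2_0_jet \<Omega> (mollify (\<rho> n) f) (\<lambda>i. mollify (\<rho> n) (f1 i)) (\<lambda>i j. mollify (\<rho> n) (f2 i j))" for n
    using test_H2_0_jet[OF O test, of n] by (simp add: d)
  then show ?thesis
    by (rule H2_0_jetI_limit[OF O, where u'="\<lambda>n. mollify (\<rho> n) f" and g'="\<lambda>n i. mollify (\<rho> n) (f1 i)"
          and h'="\<lambda>n i j. mollify (\<rho> n) (f2 i j)"])
       (intro l2_lim_lborel_restrict[OF O] mollify_l2_lim[OF _ \<rho>(1) r r0] a; assumption)+
qed

text \<open>The product rule gives the derivatives \<open>J1 \<theta>\<close> and \<open>J2 \<theta>\<close> of \<open>J0 \<theta> = \<theta> \<psi>\<close>. If the test function \<open>\<theta>\<close> is
  supported in a small ball, then \<open>\<theta> \<psi>\<close> is mollified inwards. A general \<open>\<theta>\<close> is treated by induction over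
  finitely many balls that cover its support: with a cutoff \<open>\<xi>\<close> for one of them, \<open>\<xi> \<theta>\<close> lives in a small ball
  and \<open>(1 - \<xi>) \<theta>\<close> is supported in the others, so that no partition of unity has to be normalised. Finally \<open>\<theta>\<close>
  tends to 1 through cutoffs at infinity with uniformly bounded derivatives.\<close>

theorem H2_0_jet_if_inward:
  fixes \<psi> :: "real^'n \<Rightarrow> real"
  assumes O: "open \<Omega>" and inward: "\<And>p. inward_at \<Omega> p"
    and \<psi>: "continuous_on UNIV \<psi>" "\<And>x. x \<notin> \<Omega> \<Longrightarrow> \<psi> x = 0" "\<psi> \<in> l2 lborel"
    and a: "\<And>i. l2_approx (g i)" "\<And>i j. l2_approx (h i j)"
    and w: "\<And>i. wderiv i \<psi> (g i)" "\<And>i j. wderiv j (g i) (h i j)"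
  shows "H2_0_jet \<Omega> \<psi> g h"
proof -
  define J0 where "J0 \<theta> x = \<theta> x * \<psi> x" for \<theta> and x :: "real^'n"
  define J1 where "J1 \<theta> i x = \<theta> x * g i x + pderiv_at i \<theta> x * \<psi> x" for \<theta> i and x :: "real^'n"
  define J2 where "J2 \<theta> i j x = (\<theta> x * h i j x + pderiv_at j \<theta> x * g i x) +
      (pderiv_at i \<theta> x * g j x + pderiv_at j (pderiv_at i \<theta>) x * \<psi> x)" for \<theta> i j and x :: "real^'n"
  obtain r e c where r: "\<And>p. r p > 0" and c: "\<And>p. c p > 0"
    and rec: "\<And>p K. compact K \<Longrightarrow> K \<subseteq> ball p (r p) \<inter> closure \<Omega> \<Longrightarrow>
     \<exists>t>0. \<forall>\<epsilon>. 0 < \<epsilon> \<and> \<epsilon> < t \<longrightarrow> (\<forall>x\<in>K. cball (x + \<epsilon> *\<^sub>R e p) (c p * \<epsilon>) \<subseteq> \<Omega>)"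
    using inward unfolding inward_at_def by metis
  have t\<psi>: "l2_approx (\<lambda>x. \<theta> x * \<psi> x)" if "\<theta> \<in> test_functions UNIV" for \<theta>
    by (intro cont_csupp_l2_approx cont_csupp_mult[OF test_cont_csupp[OF that] \<psi>(1)])
  have local: "H2_0_jet \<Omega> (J0 \<theta>) (J1 \<theta>) (J2 \<theta>)"
    if \<theta>: "\<theta> \<in> test_functions UNIV" "\<And>x. x \<notin> ball p (r p / 2) \<Longrightarrow> \<theta> x = 0" for \<theta> p
  proof -
    define K where "K = cball p (r p / 2) \<inter> closure \<Omega>"
    have K: "compact K" "K \<subseteq> ball p (r p) \<inter> closure \<Omega>"
      using r[of p] by (auto simp: K_def compact_Int_closed)
    obtain t where t: "t > 0" "\<And>\<epsilon> x. 0 < \<epsilon> \<Longrightarrow> \<epsilon> < t \<Longrightarrow> x \<in> K \<Longrightarrow> cball (x + \<epsilon> *\<^sub>R e p) (c p * \<epsilon>) \<subseteq> \<Omega>"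
      using rec[OF K] by blast
    show ?thesis
    proof (rule H2_0_jet_inward[OF O K(1) _ _ _ _ _ _ c t])
      show "J0 \<theta> x = 0" if "x \<notin> K" for x
        using that \<theta>(2)[of x] \<psi>(2)[of x] closure_subset[of \<Omega>] by (auto simp: J0_def K_def)
      show "l2_approx (J0 \<theta>)" unfolding J0_def by (rule t\<psi>[OF \<theta>(1)])
      show "l2_approx (J1 \<theta> i)" for i
        unfolding J1_def by (intro l2_approx_add l2_approx_test_mult a t\<psi> \<theta> test_pderiv_at)
      show "l2_approx (J2 \<theta> i j)" for i j
        unfolding J2_def by (intro l2_approx_add l2_approx_test_mult a t\<psi> \<theta> test_pderiv_at)
      show "wderiv i (J0 \<theta>) (J1 \<theta> i)" for i
        unfolding J0_def J1_def by (rule wderiv_test_mult[OF w(1) \<theta>(1)])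
      show "wderiv j (J1 \<theta> i) (J2 \<theta> i j)" for i j
        unfolding J1_def J2_def
        by (intro wderiv_add wderiv_test_mult w \<theta>(1) test_pderiv_at)
    qed
  qed
  have add: "H2_0_jet \<Omega> (J0 \<theta>) (J1 \<theta>) (J2 \<theta>)"
    if t: "\<theta>' \<in> test_functions UNIV" "\<theta>'' \<in> test_functions UNIV" "\<theta> = (\<lambda>x. \<theta>' x + \<theta>'' x)"
     and H: "H2_0_jet \<Omega> (J0 \<theta>') (J1 \<theta>') (J2 \<theta>')" "H2_0_jet \<Omega> (J0 \<theta>'') (J1 \<theta>'') (J2 \<theta>'')" for \<theta> \<theta>' \<theta>''
  proof -
    have d: "pderiv_at i \<theta> = (\<lambda>x. pderiv_at i \<theta>' x + pderiv_at i \<theta>'' x)" for i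
      unfolding t(3) by (intro ext pderiv_at_add smooth_differentiable test_smooth[OF t(1)] test_smooth[OF t(2)])
    have dd: "pderiv_at j (pderiv_at i \<theta>) = (\<lambda>x. pderiv_at j (pderiv_at i \<theta>') x + pderiv_at j (pderiv_at i \<theta>'') x)" for i j
      unfolding d by (intro ext pderiv_at_add smooth_differentiable smooth_pderiv_at test_smooth[OF t(1)] test_smooth[OF t(2)])
    have "J0 \<theta> = (\<lambda>x. J0 \<theta>' x + J0 \<theta>'' x)" by (auto simp: J0_def t(3) algebra_simps)
    moreover have "J1 \<theta> = (\<lambda>i x. J1 \<theta>' i x + J1 \<theta>'' i x)"
      unfolding J1_def d by (auto simp: t(3) algebra_simps)
    moreover have "J2 \<theta> = (\<lambda>i j x. J2 \<theta>' i j x + J2 \<theta>'' i j x)"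
      unfolding J2_def dd unfolding d by (auto simp: t(3) algebra_simps)
    ultimately show ?thesis using H2_0_jet_add[OF O H] by simp
  qed
  have "\<exists>\<theta>\<in>test_functions UNIV. (\<forall>x\<in>ball p (r p / 4). \<theta> x = 1) \<and> (\<forall>x. x \<notin> ball p (r p / 2) \<longrightarrow> \<theta> x = 0)" for p
  proof -
    have e: "r p / 4 + 2 * (r p / 8) = r p / 2" by simp
    have "r p / 8 > 0" using r[of p] by simp
    from cutoff_exists[OF this] have "\<exists>\<theta>\<in>test_functions UNIV. (\<forall>x\<in>ball p (r p / 4). \<theta> x = 1) \<and>
      (\<forall>x. x \<notin> ball p (r p / 4 + 2 * (r p / 8)) \<longrightarrow> \<theta> x = 0)" by metis
    then show ?thesis unfolding e .
  qed
  \<comment> \<open>The balls of radius \<open>r p / 4\<close> serve as the cover; the cutoffs need the room up to \<open>r p / 2\<close>.\<close>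
  then obtain \<xi> where \<xi>: "\<And>p. \<xi> p \<in> test_functions UNIV" "\<And>p x. x \<in> ball p (r p / 4) \<Longrightarrow> \<xi> p x = 1"
    "\<And>p x. x \<notin> ball p (r p / 2) \<Longrightarrow> \<xi> p x = 0" by metis
  have cover: "H2_0_jet \<Omega> (J0 \<theta>) (J1 \<theta>) (J2 \<theta>)"
    if "finite F" "\<theta> \<in> test_functions UNIV" "\<And>x. x \<notin> (\<Union>p\<in>F. ball p (r p / 4)) \<Longrightarrow> \<theta> x = 0" for F \<theta>
    using that
  proof (induction F arbitrary: \<theta> rule: finite_induct)
    case empty
    show ?case using empty(2) r[of 0] by (intro local[OF empty(1), of 0]) auto
  next
    case (insert p F)
    let ?a = "\<lambda>x. \<xi> p x * \<theta> x" and ?b = "\<lambda>x. (1 - \<xi> p x) * \<theta> x"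
    have t: "?a \<in> test_functions UNIV" "?b \<in> test_functions UNIV"
      by (intro test_smooth_mult smooth_diff smooth_const test_smooth[OF \<xi>(1)] insert.prems(1))+
    show ?case
    proof (rule add[OF t])
      show "\<theta> = (\<lambda>x. ?a x + ?b x)" by (auto simp: algebra_simps)
      show "H2_0_jet \<Omega> (J0 ?a) (J1 ?a) (J2 ?a)" by (rule local[OF t(1), of p]) (simp add: \<xi>(3))
      show "H2_0_jet \<Omega> (J0 ?b) (J1 ?b) (J2 ?b)"
      proof (rule insert.IH[OF t(2)])
        fix x assume "x \<notin> (\<Union>p\<in>F. ball p (r p / 4))"
        then show "?b x = 0" using insert.prems(2)[of x] \<xi>(2)[of x p] by (cases "x \<in> ball p (r p / 4)") auto
      qed
    qed
  qed
  have comp: "H2_0_jet \<Omega> (J0 \<theta>) (J1 \<theta>) (J2 \<theta>)" if \<theta>: "\<theta> \<in> test_functions UNIV" for \<theta>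
  proof -
    obtain C where C: "compact C" "\<And>x. x \<notin> C \<Longrightarrow> \<theta> x = 0"
      using \<theta> by (metis test_functionsE)
    have "C \<subseteq> (\<Union>p\<in>C. ball p (r p / 4))" using r by force
    then obtain F where F: "F \<subseteq> C" "finite F" "C \<subseteq> (\<Union>p\<in>F. ball p (r p / 4))"
      by (rule compactE_image[OF C(1) open_ball])
    show ?thesis by (rule cover[OF F(2) \<theta>]) (use C(2) F(3) in blast)
  qed
  obtain B where B: "B > 0" "\<And>p::real^'n. \<And>R. \<exists>\<theta>\<in>test_functions UNIV. (\<forall>x\<in>ball p R. \<theta> x = 1) \<and>
    (\<forall>x. x \<notin> ball p (R + 2 * 1) \<longrightarrow> \<theta> x = 0) \<and> (\<forall>x. \<bar>\<theta> x\<bar> \<le> B) \<and>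
    (\<forall>i x. \<bar>pderiv_at i \<theta> x\<bar> \<le> B) \<and> (\<forall>i j x. \<bar>pderiv_at j (pderiv_at i \<theta>) x\<bar> \<le> B)"
    using cutoff_exists[OF zero_less_one, where 'n='n] by blast
  let ?P = "\<lambda>n \<theta>. \<theta> \<in> test_functions UNIV \<and> (\<forall>x\<in>ball (0::real^'n) (real n). \<theta> x = 1) \<and>
    (\<forall>x. x \<notin> ball 0 (real n + 2 * 1) \<longrightarrow> \<theta> x = 0) \<and> (\<forall>x. \<bar>\<theta> x\<bar> \<le> B) \<and>
    (\<forall>i x. \<bar>pderiv_at i \<theta> x\<bar> \<le> B) \<and> (\<forall>i j x. \<bar>pderiv_at j (pderiv_at i \<theta>) x\<bar> \<le> B)"
  have "\<forall>n. \<exists>\<theta>. ?P n \<theta>" using B(2)[of 0] unfolding Bex_def by blast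
  from choice[OF this] obtain \<theta> where "\<And>n. ?P n (\<theta> n)" by blast
  then have \<theta>: "\<And>n. \<theta> n \<in> test_functions UNIV" "\<And>n x. x \<in> ball (0::real^'n) (real n) \<Longrightarrow> \<theta> n x = 1"
    "\<And>n x. \<bar>\<theta> n x\<bar> \<le> B" "\<And>n i x. \<bar>pderiv_at i (\<theta> n) x\<bar> \<le> B"
    "\<And>n i j x. \<bar>pderiv_at j (pderiv_at i (\<theta> n)) x\<bar> \<le> B"
    by blast+
  have \<theta>1: "pderiv_at i (\<theta> n) x = 0" if "x \<in> ball 0 (real n)" for i n x
  proof -
    have "((\<lambda>x. 1) has_derivative (\<lambda>h. 0)) (at x)" by simp
    then have "(\<theta> n has_derivative (\<lambda>h. 0)) (at x)"
      by (rule has_derivative_transform_within_open[OF _ open_ball that]) (simp add: \<theta>(2))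
    then show ?thesis by (simp add: pderiv_at_eq)
  qed
  have \<theta>2: "pderiv_at j (pderiv_at i (\<theta> n)) x = 0" if "x \<in> ball 0 (real n)" for i j n x
  proof -
    have "((\<lambda>x. 0) has_derivative (\<lambda>h. 0)) (at x)" by simp
    then have "(pderiv_at i (\<theta> n) has_derivative (\<lambda>h. 0)) (at x)"
      by (rule has_derivative_transform_within_open[OF _ open_ball that]) (simp add: \<theta>1)
    then show ?thesis by (simp add: pderiv_at_eq)
  qed
  have ev: "\<forall>\<^sub>F n in sequentially. x \<in> ball 0 (real n)" for x :: "real^'n"
  proof -
    obtain N where "norm x < real N" using reals_Archimedean2 by blast
    then show ?thesis by (intro eventually_sequentiallyI[of N]) auto
  qed
  have gl: "g i \<in> l2 lborel" "h i j \<in> l2 lborel" for i j using a unfolding l2_approx_def by blast+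
  have abs_l2: "(\<lambda>x. \<bar>u x\<bar>) \<in> l2 lborel" if "u \<in> l2 lborel" for u :: "real^'n \<Rightarrow> real"
    using that by (auto simp: l2_def)
  have m: "\<psi> \<in> borel_measurable borel" "g i \<in> borel_measurable borel" "h i j \<in> borel_measurable borel" for i j
    using \<psi>(3) gl by (auto simp: l2_def)
  have m\<theta>: "\<theta> n \<in> borel_measurable borel" "pderiv_at i (\<theta> n) \<in> borel_measurable borel"
    "pderiv_at j (pderiv_at i (\<theta> n)) \<in> borel_measurable borel" for n i j
    by (intro smooth_borel smooth_pderiv_at test_smooth[OF \<theta>(1)])+
  have ab: "\<bar>x * y\<bar> \<le> B * \<bar>y\<bar>" if "\<bar>x\<bar> \<le> B" for x y :: real
    using that by (simp add: abs_mult mult_right_mono)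
  show ?thesis
  proof (rule H2_0_jetI_limit[OF O comp[OF \<theta>(1)]]; rule l2_lim_lborel_restrict[OF O])
    show "l2_lim lborel (\<lambda>n. J0 (\<theta> n)) \<psi>"
    proof (rule l2_lim_dominated)
      show "(\<lambda>x. B * \<bar>\<psi> x\<bar>) \<in> l2 lborel" by (intro l2_cmult abs_l2 \<psi>(3))
      show "\<bar>J0 (\<theta> n) x\<bar> \<le> B * \<bar>\<psi> x\<bar>" for n x unfolding J0_def by (rule ab[OF \<theta>(3)])
      show "(\<lambda>n. J0 (\<theta> n) x) \<longlonglongrightarrow> \<psi> x" for x
        by (rule tendsto_eventually) (use ev[of x] in \<open>eventually_elim, simp add: J0_def \<theta>(2)\<close>)
    qed (use m m\<theta> in \<open>auto simp: J0_def[abs_def]\<close>)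
    show "l2_lim lborel (\<lambda>n. J1 (\<theta> n) i) (g i)" for i
    proof (rule l2_lim_dominated)
      show "(\<lambda>x. B * \<bar>g i x\<bar> + B * \<bar>\<psi> x\<bar>) \<in> l2 lborel" by (intro l2_add l2_cmult abs_l2 \<psi>(3) gl)
      show "\<bar>J1 (\<theta> n) i x\<bar> \<le> B * \<bar>g i x\<bar> + B * \<bar>\<psi> x\<bar>" for n x
        unfolding J1_def using ab[OF \<theta>(3), of n x "g i x"] ab[OF \<theta>(4), of i n x "\<psi> x"] by linarith
      show "(\<lambda>n. J1 (\<theta> n) i x) \<longlonglongrightarrow> g i x" for x
        by (rule tendsto_eventually) (use ev[of x] in \<open>eventually_elim, simp add: J1_def \<theta>(2) \<theta>1\<close>)
    qed (use m m\<theta> in \<open>auto simp: J1_def[abs_def]\<close>)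
    show "l2_lim lborel (\<lambda>n. J2 (\<theta> n) i j) (h i j)" for i j
    proof (rule l2_lim_dominated)
      show "(\<lambda>x. (B * \<bar>h i j x\<bar> + B * \<bar>g i x\<bar>) + (B * \<bar>g j x\<bar> + B * \<bar>\<psi> x\<bar>)) \<in> l2 lborel"
        by (intro l2_add l2_cmult abs_l2 \<psi>(3) gl)
      show "\<bar>J2 (\<theta> n) i j x\<bar> \<le> (B * \<bar>h i j x\<bar> + B * \<bar>g i x\<bar>) + (B * \<bar>g j x\<bar> + B * \<bar>\<psi> x\<bar>)" for n x
        unfolding J2_def
        using ab[OF \<theta>(3), of n x "h i j x"] ab[OF \<theta>(4), of j n x "g i x"] ab[OF \<theta>(4), of i n x "g j x"]
          ab[OF \<theta>(5), of j i n x "\<psi> x"] by linarith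
      show "(\<lambda>n. J2 (\<theta> n) i j x) \<longlonglongrightarrow> h i j x" for x
        by (rule tendsto_eventually) (use ev[of x] in \<open>eventually_elim, simp add: J2_def \<theta>(2) \<theta>1 \<theta>2\<close>)
    qed (use m m\<theta> in \<open>auto simp: J2_def[abs_def]\<close>)
  qed
qed

section \<open>Lipschitz boundaries\<close>

lemma lipschitz_boundaryE:
  fixes \<Omega> :: "(real^2) set"
  assumes "lipschitz_boundary \<Omega>" "p \<in> frontier \<Omega>"
  obtains r Q e L g where "r > 0" "linear Q" "\<And>x. norm (Q x) = norm x" "Q e = axis (2::2) (1::real)" "norm e = 1" "L \<ge> 0"
    "\<And>s t. \<bar>g s - g t\<bar> \<le> L * \<bar>s - t\<bar>" "continuous_on UNIV g"
    "\<And>x. x \<in> ball p r \<Longrightarrow> x \<in> \<Omega> \<longleftrightarrow> g (Q x $ 1) < Q x $ 2"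
proof -
  obtain r and Q :: "real^2 \<Rightarrow> real^2" and L g where r: "r > 0" and Q: "orthogonal_transformation Q"
    and g: "L-lipschitz_on UNIV g" and eq: "ball p r \<inter> \<Omega> = {x \<in> ball p r. g (Q x $ 1) < Q x $ 2}"
    using assms(1)[unfolded lipschitz_boundary_def, rule_format, OF assms(2)] by blast
  obtain e where e: "Q e = axis 2 1"
    using orthogonal_transformation_surj[OF Q] by (metis surjD)
  have n: "norm (Q x) = norm x" for x using Q by (rule orthogonal_transformation_norm)
  then have "norm e = 1" using e by (metis norm_axis_1)
  moreover have "\<bar>g s - g t\<bar> \<le> L * \<bar>s - t\<bar>" for s t
    using lipschitz_onD[OF g, of s t] by (simp add: dist_real_def)
  moreover have "continuous_on UNIV g" using g by (rule lipschitz_on_continuous_on)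
  moreover have "x \<in> \<Omega> \<longleftrightarrow> g (Q x $ 1) < Q x $ 2" if "x \<in> ball p r" for x using eq that by blast
  ultimately show ?thesis
    using that[OF r orthogonal_transformation_linear[OF Q] n e _ lipschitz_on_nonneg[OF g]] by blast
qed

text \<open>At a boundary point the fixed direction is the one in which the graph is left upwards. A translation
  by \<open>\<epsilon>\<close> in this direction raises the height above the graph by \<open>\<epsilon>\<close>, and a further displacement of length
  \<open>c \<epsilon>\<close> lowers it by at most \<open>(L + 1) c \<epsilon>\<close>, which is less than \<open>\<epsilon>\<close> for \<open>c = 1 / (L + 2)\<close>.\<close>

lemma inward_at_lipschitz_boundary:
  fixes \<Omega> :: "(real^2) set"
  assumes O: "open \<Omega>" and L: "lipschitz_boundary \<Omega>"
  shows "inward_at \<Omega> p"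
proof -
  consider "p \<notin> closure \<Omega>" | "p \<in> \<Omega>" | "p \<in> frontier \<Omega>"
    using O by (auto simp: frontier_def interior_open)
  then show ?thesis
  proof cases
    case 1
    then obtain r where "r > 0" "ball p r \<subseteq> - closure \<Omega>"
      using open_contains_ball[of "- closure \<Omega>"] by auto
    then have "K = {}" if "K \<subseteq> ball p r \<inter> closure \<Omega>" for K using that by blast
    then show ?thesis unfolding inward_at_def using \<open>r > 0\<close>
      by (intro exI[of _ r] conjI exI[of _ 0] exI[of _ 1]) (auto intro!: exI[of _ 1])
  next
    case 2
    then obtain r where r: "r > 0" "ball p r \<subseteq> \<Omega>" using O openE by blast
    have "\<exists>t>0. \<forall>\<epsilon>. 0 < \<epsilon> \<and> \<epsilon> < t \<longrightarrow> (\<forall>x\<in>K. cball (x + \<epsilon> *\<^sub>R 0) (1 * \<epsilon>) \<subseteq> \<Omega>)"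
      if "compact K" "K \<subseteq> ball p r \<inter> closure \<Omega>" for K
    proof -
      obtain t where t: "t > 0" "(\<Union>x\<in>K. cball x t) \<subseteq> \<Omega>"
        using compact_subset_open_imp_cball_epsilon_subset[OF \<open>compact K\<close> O] \<open>K \<subseteq> _\<close> r(2) by blast
      then show ?thesis
        by (intro exI[of _ t]) (auto simp: subset_iff, meson less_imp_le order_trans)
    qed
    then show ?thesis unfolding inward_at_def using r(1)
      by (intro exI[of _ r] conjI exI[of _ 0] exI[of _ 1]) auto
  next
    case 3
    obtain r Q e L g where r: "r > 0" and Q: "linear Q" "\<And>x. norm (Q x) = norm x"
      and e: "Q e = axis (2::2) (1::real)" "norm e = 1" and L0: "L \<ge> 0"
      and g: "\<And>s t. \<bar>g s - g t\<bar> \<le> L * \<bar>s - t\<bar>" "continuous_on UNIV g"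
      and eq: "\<And>x. x \<in> ball p r \<Longrightarrow> x \<in> \<Omega> \<longleftrightarrow> g (Q x $ 1) < Q x $ 2"
      using lipschitz_boundaryE[OF L 3] by metis
    have cQ: "continuous_on UNIV Q" using Q(1) by (simp add: linear_continuous_on linear_conv_bounded_linear)
    have cl: "g (Q x $ 1) \<le> Q x $ 2" if "x \<in> ball p r \<inter> closure \<Omega>" for x
    proof -
      have "x \<in> closure (ball p r \<inter> \<Omega>)"
        using that open_Int_closure_subset[OF open_ball] by blast
      moreover have "closed {x. g (Q x $ 1) \<le> Q x $ 2}"
        by (intro closed_Collect_le continuous_intros continuous_on_compose2[OF g(2)] cQ) auto
      then have "closure (ball p r \<inter> \<Omega>) \<subseteq> {x. g (Q x $ 1) \<le> Q x $ 2}"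
        by (intro closure_minimal) (auto simp: eq)
      ultimately show ?thesis by blast
    qed
    define c where "c = 1 / (L + 2)"
    have c: "c > 0" "c * (L + 1) < 1" "c \<le> 1" using L0 by (auto simp: c_def field_simps)
    have "\<exists>t>0. \<forall>\<epsilon>. 0 < \<epsilon> \<and> \<epsilon> < t \<longrightarrow> (\<forall>x\<in>K. cball (x + \<epsilon> *\<^sub>R e) (c * \<epsilon>) \<subseteq> \<Omega>)"
      if K: "compact K" "K \<subseteq> ball p r \<inter> closure \<Omega>" for K
    proof -
      obtain t where t: "t > 0" "(\<Union>x\<in>K. cball x t) \<subseteq> ball p r"
        using compact_subset_open_imp_cball_epsilon_subset[OF K(1) open_ball, of p r] K(2) by blast
      show ?thesis
      proof (intro exI[of _ "t/2"] conjI allI impI ballI subsetI)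
        show "t / 2 > 0" using t by simp
        fix \<epsilon> x y assume \<epsilon>: "0 < \<epsilon> \<and> \<epsilon> < t / 2" and x: "x \<in> K" and y: "y \<in> cball (x + \<epsilon> *\<^sub>R e) (c * \<epsilon>)"
        define v where "v = y - (x + \<epsilon> *\<^sub>R e)"
        have v: "norm v \<le> c * \<epsilon>" using y by (simp add: v_def dist_norm norm_minus_commute)
        have yv: "y = x + \<epsilon> *\<^sub>R e + v" by (simp add: v_def)
        have "norm (y - x) \<le> \<epsilon> + c * \<epsilon>"
          using norm_triangle_ineq[of "\<epsilon> *\<^sub>R e" v] v e(2) \<epsilon> by (simp add: yv add.assoc)
        also have "\<dots> \<le> 2 * \<epsilon>" using c(3) \<epsilon> by (simp add: mult_left_le_one_le)
        finally have "y \<in> cball x t" using \<epsilon> by (simp add: dist_norm norm_minus_commute)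
        then have yb: "y \<in> ball p r" using t(2) x by blast
        have Qy: "Q y = Q x + \<epsilon> *\<^sub>R axis 2 1 + Q v"
          using Q(1) e(1) by (simp add: yv linear_add linear_scale)
        have Qv: "\<bar>Q v $ i\<bar> \<le> c * \<epsilon>" for i
          using component_le_norm_cart[of "Q v" i] Q(2)[of v] v by simp
        have "g (Q y $ 1) \<le> g (Q x $ 1) + L * \<bar>Q v $ 1\<bar>"
          using g(1)[of "Q y $ 1" "Q x $ 1"] by (simp add: Qy axis_def)
        also have "\<dots> \<le> Q x $ 2 + L * (c * \<epsilon>)"
          using cl[OF subsetD[OF K(2) x]] Qv[of 1] L0 by (intro add_mono mult_left_mono) auto
        also have "\<dots> < Q x $ 2 + \<epsilon> - c * \<epsilon>"
          using mult_strict_right_mono[OF c(2), of \<epsilon>] \<epsilon> by (simp add: algebra_simps)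
        also have "\<dots> \<le> Q y $ 2" using Qv[of 2] by (simp add: Qy axis_def)
        finally show "y \<in> \<Omega>" using eq[OF yb] by blast
      qed
    qed
    then show ?thesis unfolding inward_at_def using r c(1) by blast
  qed
qed

text \<open>The complement of a Lipschitz domain is locally the region on or below a graph. From each of its
  points near \<open>p\<close> one reaches, moving vertically and then horizontally below the graph, one and the
  same exterior point.\<close>

lemma locally_constant_complement_lipschitz:
  fixes \<Omega> :: "(real^2) set" and \<psi> :: "real^2 \<Rightarrow> real"
  assumes O: "open \<Omega>" and L: "lipschitz_boundary \<Omega>" and \<psi>: "continuous_on UNIV \<psi>"
    and lc: "\<And>x. x \<notin> closure \<Omega> \<Longrightarrow> \<exists>d>0. \<forall>y\<in>ball x d. \<psi> y = \<psi> x"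
    and p: "p \<notin> \<Omega>"
  shows "\<exists>d>0. \<forall>y\<in>ball p d - \<Omega>. \<psi> y = \<psi> p"
proof (cases "p \<in> closure \<Omega>")
  case False
  then show ?thesis using lc[OF False] by blast
next
  case True
  then have pf: "p \<in> frontier \<Omega>" using p O by (simp add: frontier_def interior_open)
  obtain r Q e L g where r: "r > 0" and Q: "linear Q" "\<And>x. norm (Q x) = norm x"
      and e: "Q e = axis (2::2) (1::real)" "norm e = 1" and L0: "L \<ge> 0"
      and g: "\<And>s t. \<bar>g s - g t\<bar> \<le> L * \<bar>s - t\<bar>" "continuous_on UNIV g"
      and eq: "\<And>x. x \<in> ball p r \<Longrightarrow> x \<in> \<Omega> \<longleftrightarrow> g (Q x $ 1) < Q x $ 2"
    using lipschitz_boundaryE[OF L pf] by metis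
  have cQ: "continuous_on UNIV Q" using Q(1) by (simp add: linear_continuous_on linear_conv_bounded_linear)
  define E where "E = ball p r \<inter> {x. Q x $ 2 < g (Q x $ 1)}"
  have "open E" unfolding E_def
    by (intro open_Int open_ball open_Collect_less continuous_intros continuous_on_compose2[OF g(2)] cQ) auto
  moreover have "E \<inter> \<Omega> = {}" using eq by (force simp: E_def)
  ultimately have E: "E \<inter> closure \<Omega> = {}" by (metis open_Int_closure_eq_empty)
  have const: "\<psi> x = \<psi> y" if "connected S" "S \<subseteq> E" "x \<in> S" "y \<in> S" for S x y
  proof (rule connected_local_const[OF that(1,3,4)], intro ballI)
    fix z assume "z \<in> S"
    then have "z \<notin> closure \<Omega>" using E \<open>S \<subseteq> E\<close> by blast
    from lc[OF this] obtain d where d: "d > 0" "\<forall>y\<in>ball z d. \<psi> y = \<psi> z" by blast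
    have "\<psi> z = \<psi> b" if "dist b z < d" for b using d(2) that by (simp add: dist_commute)
    then show "\<forall>\<^sub>F b in at z within S. \<psi> z = \<psi> b"
      using d(1) unfolding eventually_at by blast
  qed
  \<comment> \<open>Moving the ball of radius \<open>d\<close> around \<open>p\<close> down by \<open>t > (L + 1) d\<close> brings it below the graph, and
    \<open>d + t < r\<close> keeps the motion inside the chart.\<close>
  define d where "d = r / (L + 4)"
  define t where "t = (L + 2) * d"
  have d: "d > 0" "(L + 3) * d < r" using r L0 by (auto simp: d_def field_simps)
  have "L * d \<ge> 0" using d L0 by simp
  then have t: "t > 0" "t > (L + 1) * d" "d + t < r"
    using d unfolding t_def distrib_right by linarith+
  have Qp: "Q p $ 2 \<le> g (Q p $ 1)" using eq[of p] r p by auto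
  have key: "\<psi> y = \<psi> (p - t *\<^sub>R e)" if y: "y \<in> ball p d" "y \<notin> \<Omega>" for y
  proof -
    have "d < r" using t by simp
    then have yr: "y \<in> ball p r" using y(1) by auto
    have Qy: "Q y $ 2 \<le> g (Q y $ 1)" using eq[OF yr] y(2) by auto
    have down: "y - s *\<^sub>R e \<in> E" if "0 < s" "s \<le> t" for s
    proof -
      have "norm (p - (y - s *\<^sub>R e)) \<le> norm (p - y) + norm (s *\<^sub>R e)"
        using norm_triangle_ineq[of "p - y" "s *\<^sub>R e"] by (simp add: algebra_simps)
      then have "y - s *\<^sub>R e \<in> ball p r" using y(1) that t(3) e(2) by (simp add: dist_norm)
      moreover have "Q (y - s *\<^sub>R e) = Q y - s *\<^sub>R axis 2 1" using Q(1) e(1) by (simp add: linear_diff linear_scale)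
      ultimately show ?thesis using Qy that(1) by (simp add: E_def axis_def)
    qed
    have "\<psi> (y - s *\<^sub>R e) = \<psi> (y - t *\<^sub>R e)" if "0 < s" "s \<le> t" for s
    proof (rule const)
      show "connected ((\<lambda>s. y - s *\<^sub>R e) ` {0<..t})"
        by (intro connected_continuous_image continuous_intros) (simp add: is_interval_connected)
    qed (use down that t in auto)
    moreover have "(\<lambda>n. \<psi> (y - (t * inverse (real (Suc n))) *\<^sub>R e)) \<longlonglongrightarrow> \<psi> (y - (t * 0) *\<^sub>R e)"
      using \<psi> by (intro isCont_tendsto_compose[of _ \<psi>] tendsto_intros LIMSEQ_inverse_real_of_nat)
        (simp add: continuous_on_eq_continuous_at)
    moreover have "t * inverse (real (Suc n)) > 0" "t * inverse (real (Suc n)) \<le> t" for n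
      using t(1) by (auto simp: field_simps)
    ultimately have 1: "\<psi> y = \<psi> (y - t *\<^sub>R e)" by (simp add: LIMSEQ_const_iff)
    have "\<psi> (y - t *\<^sub>R e) = \<psi> (p - t *\<^sub>R e)"
    proof (rule const)
      show "connected (closed_segment (y - t *\<^sub>R e) (p - t *\<^sub>R e))" by simp
      show "closed_segment (y - t *\<^sub>R e) (p - t *\<^sub>R e) \<subseteq> E"
      proof
        fix z assume "z \<in> closed_segment (y - t *\<^sub>R e) (p - t *\<^sub>R e)"
        then have "z + t *\<^sub>R e \<in> closed_segment y p"
          using closed_segment_translation_eq[of "t *\<^sub>R e" z "y - t *\<^sub>R e" "p - t *\<^sub>R e"] by (simp add: add.commute)
        also have "\<dots> \<subseteq> ball p d" using y(1) d(1) by (intro closed_segment_subset) auto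
        finally have n: "norm (z + t *\<^sub>R e - p) < d" by (simp add: dist_norm norm_minus_commute)
        have "norm (p - z) \<le> norm (z + t *\<^sub>R e - p) + norm (t *\<^sub>R e)"
          using norm_triangle_ineq[of "- (z + t *\<^sub>R e - p)" "t *\<^sub>R e"] by (simp add: norm_minus_commute algebra_simps)
        then have zb: "z \<in> ball p r" using n t e(2) by (simp add: dist_norm)
        define v where "v = Q (z + t *\<^sub>R e - p)"
        have v: "\<bar>v $ i\<bar> < d" for i
          using component_le_norm_cart[of v i] n by (simp add: v_def Q(2))
        have Qz: "Q z = Q p + v - t *\<^sub>R axis 2 1"
          using Q(1) e(1) by (simp add: v_def linear_diff linear_add linear_scale)
        have "Q z $ 2 < Q p $ 2 + d - t" using v[of 2] by (simp add: Qz axis_def)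
        also have "\<dots> < Q p $ 2 - L * d" using t(2) by (simp add: algebra_simps)
        also have "\<dots> \<le> g (Q p $ 1) - L * \<bar>v $ 1\<bar>"
          using Qp v[of 1] L0 by (intro diff_mono mult_left_mono) auto
        also have "\<dots> \<le> g (Q z $ 1)"
          using g(1)[of "Q z $ 1" "Q p $ 1"] by (simp add: Qz axis_def)
        finally show "z \<in> E" using zb by (simp add: E_def)
      qed
    qed auto
    with 1 show ?thesis by simp
  qed
  have "\<psi> y = \<psi> p" if "y \<in> ball p d - \<Omega>" for y using key[of y] key[of p] that d(1) p by auto
  then show ?thesis using d(1) by blast
qed

section \<open>Integration over quadrants of the plane\<close>

definition pt :: "real \<Rightarrow> real \<Rightarrow> real^2" where
  "pt s t = s *\<^sub>R axis 1 1 + t *\<^sub>R axis 2 1"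

lemma pt_nth [simp]: "pt s t $ 1 = s" "pt s t $ 2 = t"
  by (simp_all add: pt_def axis_def)

lemma pt_collapse [simp]: "pt (x $ 1) (x $ 2) = x"
  by (simp add: vec_eq_iff forall_2)

lemma continuous_on_pt [continuous_intros]:
  "continuous_on S f \<Longrightarrow> continuous_on S g \<Longrightarrow> continuous_on S (\<lambda>x. pt (f x) (g x))"
  unfolding pt_def by (intro continuous_intros)

lemma Basis_real_2: "Basis = {axis 1 1, axis 2 1 :: real^2}"
  by (auto simp: Basis_vec_def UNIV_2)

lemma measurable_pt [measurable]: "(\<lambda>(s, t). pt s t) \<in> lborel \<Otimes>\<^sub>M lborel \<rightarrow>\<^sub>M borel"
  unfolding pt_def by measurable

lemma lborel_distr_pt: "distr (lborel \<Otimes>\<^sub>M lborel) borel (\<lambda>(s, t). pt s t) = lborel"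
proof (rule lborel_eqI[symmetric])
  fix l u :: "real^2" assume "\<And>b. b \<in> Basis \<Longrightarrow> l \<bullet> b \<le> u \<bullet> b"
  from this[of "axis 1 1"] this[of "axis 2 1"] have le: "l $ 1 \<le> u $ 1" "l $ 2 \<le> u $ 2"
    by (simp_all add: Basis_real_2 inner_axis)
  have "(\<lambda>(s, t). pt s t) -` box l u \<inter> space (lborel \<Otimes>\<^sub>M lborel) = {l $ 1<..<u $ 1} \<times> {l $ 2<..<u $ 2}"
    by (auto simp: mem_box_cart forall_2 space_pair_measure)
  then have "emeasure (distr (lborel \<Otimes>\<^sub>M lborel) borel (\<lambda>(s, t). pt s t)) (box l u) =
      emeasure (lborel \<Otimes>\<^sub>M lborel) ({l $ 1<..<u $ 1} \<times> {l $ 2<..<u $ 2})"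
    by (subst emeasure_distr) auto
  also have "\<dots> = ennreal (u $ 1 - l $ 1) * ennreal (u $ 2 - l $ 2)"
    using le by (subst lborel.emeasure_pair_measure_Times) auto
  also have "\<dots> = ennreal (\<Prod>b\<in>Basis. (u - l) \<bullet> b)"
    using le by (simp add: Basis_real_2 inner_axis axis_eq_axis ennreal_mult')
  finally show "emeasure (distr (lborel \<Otimes>\<^sub>M lborel) borel (\<lambda>(s, t). pt s t)) (box l u) = (\<Prod>b\<in>Basis. (u - l) \<bullet> b)" .
qed simp

lemma integral_pt:
  fixes f :: "real^2 \<Rightarrow> real"
  assumes "integrable lborel f"
  shows "(\<integral>x. f x \<partial>lborel) = (\<integral>s. \<integral>t. f (pt s t) \<partial>lborel \<partial>lborel)"
    "(\<integral>x. f x \<partial>lborel) = (\<integral>t. \<integral>s. f (pt s t) \<partial>lborel \<partial>lborel)"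
proof -
  have m: "f \<in> borel_measurable borel" using assms by auto
  have "integrable (distr (lborel \<Otimes>\<^sub>M lborel) borel (\<lambda>(s, t). pt s t)) f"
    using assms by (simp add: lborel_distr_pt)
  then have i: "integrable (lborel \<Otimes>\<^sub>M lborel) (\<lambda>(s, t). f (pt s t))"
    using integrable_distr[OF measurable_pt, of f] by (simp add: case_prod_beta')
  have "(\<integral>x. f x \<partial>lborel) = (\<integral>x. f x \<partial>distr (lborel \<Otimes>\<^sub>M lborel) borel (\<lambda>(s, t). pt s t))"
    by (simp add: lborel_distr_pt)
  also have "\<dots> = (\<integral>p. f ((\<lambda>(s, t). pt s t) p) \<partial>(lborel \<Otimes>\<^sub>M lborel))"
    by (rule integral_distr[OF measurable_pt m])
  also have "\<dots> = (\<integral>(s, t). f (pt s t) \<partial>(lborel \<Otimes>\<^sub>M lborel))"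
    by (simp add: case_prod_unfold)
  finally have e: "(\<integral>x. f x \<partial>lborel) = (\<integral>(s, t). f (pt s t) \<partial>(lborel \<Otimes>\<^sub>M lborel))" .
  show "(\<integral>x. f x \<partial>lborel) = (\<integral>s. \<integral>t. f (pt s t) \<partial>lborel \<partial>lborel)"
    unfolding e using lborel_pair.integral_fst[OF i] by simp
  show "(\<integral>x. f x \<partial>lborel) = (\<integral>t. \<integral>s. f (pt s t) \<partial>lborel \<partial>lborel)"
    unfolding e using lborel_pair.integral_snd[OF i] by simp
qed

lemma integral_halfline_FTC:
  fixes F F' :: "real \<Rightarrow> real"
  assumes d: "\<And>t. (F has_real_derivative F' t) (at t)" and c: "continuous_on UNIV F'"
    and z: "\<And>t. t < m \<Longrightarrow> F t = 0" "\<And>t. t < m \<Longrightarrow> F' t = 0"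
  shows "(\<integral>t. indicator {..b} t * F' t \<partial>lborel) = F b"
proof -
  define a where "a = min m b - 1"
  have a: "a \<le> b" "a < m" by (auto simp: a_def)
  have "(\<integral>t. indicator {..b} t * F' t \<partial>lborel) = (\<integral>t. F' t * indicator {a..b} t \<partial>lborel)"
    using a z(2) by (intro Bochner_Integration.integral_cong) (auto simp: indicator_def)
  also have "\<dots> = F b - F a"
    using a d c by (intro integral_FTC_Icc_real) (auto intro: continuous_on_interior continuous_on_eq_continuous_at[THEN iffD1])
  finally show ?thesis using z(1) a by simp
qed

lemma halfline_integral_has_derivative:
  fixes F :: "real \<Rightarrow> real"
  assumes c: "continuous_on UNIV F" and z: "\<And>t. t < m \<Longrightarrow> F t = 0"
  shows "((\<lambda>x. \<integral>s. indicator {..x} s * F s \<partial>lborel) has_real_derivative F x) (at x)"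
proof -
  define a where "a = min m x - 1"
  have a: "a < x" "a < m" by (auto simp: a_def)
  have eq: "(\<integral>s. indicator {..y} s * F s \<partial>lborel) = integral {a..y} F" for y
  proof -
    have "(\<integral>s. indicator {..y} s * F s \<partial>lborel) = (\<integral>s. indicator {a..y} s *\<^sub>R F s \<partial>lborel)"
      using a z by (intro Bochner_Integration.integral_cong) (auto simp: indicator_def)
    also have "\<dots> = integral {a..y} F"
      using set_borel_integral_eq_integral(2)[OF borel_integrable_atLeastAtMost'[OF continuous_on_subset[OF c]]]
      by (simp add: set_lebesgue_integral_def)
    finally show ?thesis .
  qed
  have "((\<lambda>y. integral {a..y} F) has_real_derivative F x) (at x within {a..x + 1})"
    using a by (intro integral_has_real_derivative continuous_on_subset[OF c]) auto
  then have "((\<lambda>y. integral {a..y} F) has_real_derivative F x) (at x)"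
    using a by (subst (asm) at_within_Icc_at) auto
  then show ?thesis unfolding eq .
qed

definition quadrant :: "real^2 \<Rightarrow> (real^2) set" where
  "quadrant a = {x. x $ 1 \<le> a $ 1 \<and> x $ 2 \<le> a $ 2}"

lemma quadrant_borel [measurable]: "quadrant a \<in> sets borel"
  unfolding quadrant_def by (intro borel_closed closed_Collect_conj closed_Collect_le continuous_intros)

lemma indicator_quadrant_pt: "indicator (quadrant a) (pt s t) = (indicator {..a $ 1} s * indicator {..a $ 2} t :: real)"
  by (auto simp: quadrant_def indicator_def)

lemma integrable_quadrant:
  fixes w :: "real^2 \<Rightarrow> real"
  shows "integrable lborel w \<Longrightarrow> integrable lborel (\<lambda>x. indicator (quadrant a) x * w x)"
  using integrable_mult_indicator[of "quadrant a" lborel w] by simp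

lemma test_vanish_outside:
  fixes \<phi> :: "real^2 \<Rightarrow> real"
  assumes "\<phi> \<in> test_functions UNIV"
  obtains M where "\<And>x i. \<bar>x $ i\<bar> > M \<Longrightarrow> \<phi> x = 0" "\<And>x i j. \<bar>x $ i\<bar> > M \<Longrightarrow> pderiv_at j \<phi> x = 0"
proof -
  obtain K where K: "compact K" "\<And>x. x \<notin> K \<Longrightarrow> \<phi> x = 0" using assms by (metis test_functionsE)
  obtain M where M: "K \<subseteq> cball 0 M"
    using bounded_subset_ballD[OF compact_imp_bounded[OF K(1)], of 0] ball_subset_cball by blast
  have "x \<notin> K" if "\<bar>x $ i\<bar> > M" for x i
    using that M component_le_norm_cart[of x i] by (auto simp: subset_iff)
  moreover have "pderiv_at j \<phi> x = 0" if "x \<notin> K" for x j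
    by (rule pderiv_at_vanish[OF compact_imp_closed[OF K(1)] _ that]) (rule K(2))
  ultimately show ?thesis
    using that[of M] K(2) by metis
qed

lemma test_halfline_integral:
  assumes \<phi>: "\<phi> \<in> test_functions UNIV"
  shows "(\<integral>s. indicator {..b} s * pderiv_at 1 \<phi> (pt s t) \<partial>lborel) = \<phi> (pt b t)"
    and "(\<integral>s. indicator {..b} s * pderiv_at 2 \<phi> (pt t s) \<partial>lborel) = \<phi> (pt t b)"
proof -
  obtain M where M: "\<And>x i. \<bar>x $ i\<bar> > M \<Longrightarrow> \<phi> x = 0" "\<And>x i j. \<bar>x $ i\<bar> > M \<Longrightarrow> pderiv_at j \<phi> x = 0"
    using test_vanish_outside[OF \<phi>] by metis
  have c: "continuous_on UNIV (pderiv_at i \<phi>)" for i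
    by (rule smooth_continuous[OF smooth_pderiv_at[OF test_smooth[OF \<phi>]]])
  show "(\<integral>s. indicator {..b} s * pderiv_at 1 \<phi> (pt s t) \<partial>lborel) = \<phi> (pt b t)"
  proof (rule integral_halfline_FTC[where m="- \<bar>M\<bar>"])
    show "((\<lambda>s. \<phi> (pt s t)) has_real_derivative pderiv_at 1 \<phi> (pt s t)) (at s)" for s
      using smooth_directional_derivative[OF test_smooth[OF \<phi>], of "t *\<^sub>R axis 2 1" 1 s] by (simp add: pt_def add.commute)
    show "continuous_on UNIV (\<lambda>s. pderiv_at 1 \<phi> (pt s t))"
      by (intro continuous_on_compose2[OF c] continuous_intros) auto
    show "\<phi> (pt s t) = 0" if "s < - \<bar>M\<bar>" for s using that by (intro M(1)[of _ 1]) auto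
    show "pderiv_at 1 \<phi> (pt s t) = 0" if "s < - \<bar>M\<bar>" for s using that by (intro M(2)[of _ 1]) auto
  qed
  show "(\<integral>s. indicator {..b} s * pderiv_at 2 \<phi> (pt t s) \<partial>lborel) = \<phi> (pt t b)"
  proof (rule integral_halfline_FTC[where m="- \<bar>M\<bar>"])
    show "((\<lambda>s. \<phi> (pt t s)) has_real_derivative pderiv_at 2 \<phi> (pt t s)) (at s)" for s
      using smooth_directional_derivative[OF test_smooth[OF \<phi>], of "t *\<^sub>R axis 1 1" 2 s] by (simp add: pt_def)
    show "continuous_on UNIV (\<lambda>s. pderiv_at 2 \<phi> (pt t s))"
      by (intro continuous_on_compose2[OF c] continuous_intros) auto
    show "\<phi> (pt t s) = 0" if "s < - \<bar>M\<bar>" for s using that by (intro M(1)[of _ 2]) auto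
    show "pderiv_at 2 \<phi> (pt t s) = 0" if "s < - \<bar>M\<bar>" for s using that by (intro M(2)[of _ 2]) auto
  qed
qed

lemma test_halfline_has_derivative:
  assumes \<phi>: "\<phi> \<in> test_functions UNIV"
  shows "((\<lambda>y. \<integral>s. indicator {..y} s * \<phi> (pt s t) \<partial>lborel) has_real_derivative \<phi> (pt b t)) (at b)"
    and "((\<lambda>y. \<integral>s. indicator {..y} s * \<phi> (pt t s) \<partial>lborel) has_real_derivative \<phi> (pt t b)) (at b)"
proof -
  obtain M where M: "\<And>x i. \<bar>x $ i\<bar> > M \<Longrightarrow> \<phi> x = 0" using test_vanish_outside[OF \<phi>] by metis
  have "\<phi> (pt s t) = 0" "\<phi> (pt t s) = 0" if "s < - \<bar>M\<bar>" for s
    using that M[of "pt s t" 1] M[of "pt t s" 2] by auto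
  moreover have "continuous_on UNIV (\<lambda>s. \<phi> (pt s t))" "continuous_on UNIV (\<lambda>s. \<phi> (pt t s))"
    by (intro continuous_on_compose2[OF smooth_continuous[OF test_smooth[OF \<phi>]]] continuous_intros; simp)+
  ultimately show "((\<lambda>y. \<integral>s. indicator {..y} s * \<phi> (pt s t) \<partial>lborel) has_real_derivative \<phi> (pt b t)) (at b)"
    and "((\<lambda>y. \<integral>s. indicator {..y} s * \<phi> (pt t s) \<partial>lborel) has_real_derivative \<phi> (pt t b)) (at b)"
    using halfline_integral_has_derivative by blast+
qed

text \<open>By Fubini the derivative may first be integrated in its own direction, which leaves an integral along
  the half-line that ends in the corner of the quadrant.\<close>

lemma quadrant_pderiv_1:
  assumes \<phi>: "\<phi> \<in> test_functions UNIV"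
  shows "(\<integral>x. indicator (quadrant a) x * pderiv_at 1 \<phi> x \<partial>lborel) = (\<integral>t. indicator {..a $ 2} t * \<phi> (pt (a $ 1) t) \<partial>lborel)"
proof -
  have "(\<integral>s. indicator (quadrant a) (pt s t) * pderiv_at 1 \<phi> (pt s t) \<partial>lborel) =
      indicator {..a $ 2} t * (\<integral>s. indicator {..a $ 1} s * pderiv_at 1 \<phi> (pt s t) \<partial>lborel)" for t
    unfolding integral_mult_right_zero[symmetric] by (simp add: indicator_quadrant_pt mult_ac)
  then show ?thesis
    by (subst integral_pt(2)[OF integrable_quadrant[OF test_integrable[OF test_pderiv_at[OF \<phi>]]]])
       (simp add: test_halfline_integral[OF \<phi>])
qed

lemma quadrant_pderiv_2:
  assumes \<phi>: "\<phi> \<in> test_functions UNIV"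
  shows "(\<integral>x. indicator (quadrant a) x * pderiv_at 2 \<phi> x \<partial>lborel) = (\<integral>s. indicator {..a $ 1} s * \<phi> (pt s (a $ 2)) \<partial>lborel)"
  by (subst integral_pt(1)[OF integrable_quadrant[OF test_integrable[OF test_pderiv_at[OF \<phi>]]]])
     (simp add: indicator_quadrant_pt mult.assoc test_halfline_integral[OF \<phi>])

lemma quadrant_mixed_pderiv:
  assumes \<phi>: "\<phi> \<in> test_functions UNIV"
  shows "(\<integral>x. indicator (quadrant a) x * pderiv_at 2 (pderiv_at 1 \<phi>) x \<partial>lborel) = \<phi> a"
    and "(\<integral>x. indicator (quadrant a) x * pderiv_at 1 (pderiv_at 2 \<phi>) x \<partial>lborel) = \<phi> a"
  by (simp_all add: quadrant_pderiv_1 quadrant_pderiv_2 test_pderiv_at \<phi> test_halfline_integral[OF \<phi>])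

lemma AE_coordinate_neq: "AE x in lborel. (x::real^'n) $ i \<noteq> c"
proof -
  have n: "negligible {x::real^'n. axis i 1 \<bullet> x = c}"
    by (rule negligible_hyperplane) (simp add: axis_eq_0_iff)
  have e: "{x::real^'n. axis i 1 \<bullet> x = c} = {x. x $ i = c}" by (simp add: inner_axis' )
  have "closed {x::real^'n. x $ i = c}" by (intro closed_Collect_eq continuous_intros)
  then have "{x::real^'n. x $ i = c} \<in> null_sets lborel"
    using n unfolding e negligible_iff_null_sets by (subst (asm) null_sets_completion_iff) auto
  from AE_not_in[OF this] show ?thesis by simp
qed

text \<open>Indicator functions of converging quadrants converge off the two lines through the limiting corner.\<close>

lemma continuous_quadrant_integral:
  fixes w :: "real^2 \<Rightarrow> real"
  assumes w: "integrable lborel w"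
  shows "continuous_on UNIV (\<lambda>a. \<integral>x. indicator (quadrant a) x * w x \<partial>lborel)"
proof (rule continuous_at_imp_continuous_on, rule ballI)
  fix a :: "real^2"
  show "isCont (\<lambda>a. \<integral>x. indicator (quadrant a) x * w x \<partial>lborel) a"
    unfolding continuous_at_sequentially comp_def
  proof (intro allI impI)
    fix b :: "nat \<Rightarrow> real^2" assume b: "b \<longlonglongrightarrow> a"
    show "(\<lambda>n. \<integral>x. indicator (quadrant (b n)) x * w x \<partial>lborel) \<longlonglongrightarrow> (\<integral>x. indicator (quadrant a) x * w x \<partial>lborel)"
    proof (rule integral_dominated_convergence[where w="\<lambda>x. \<bar>w x\<bar>"])
      show "AE x in lborel. (\<lambda>n. indicator (quadrant (b n)) x * w x) \<longlonglongrightarrow> indicator (quadrant a) x * w x"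
        using AE_coordinate_neq[of 1 "a $ 1"] AE_coordinate_neq[of 2 "a $ 2"]
      proof eventually_elim
        case (elim x)
        have ev: "\<forall>\<^sub>F n in sequentially. (x $ i \<le> b n $ i) = (x $ i \<le> a $ i)" if "x $ i \<noteq> a $ i" for i
        proof -
          have l: "(\<lambda>n. b n $ i) \<longlonglongrightarrow> a $ i" by (intro tendsto_intros b)
          show ?thesis
          proof (cases "x $ i < a $ i")
            case True
            from order_tendstoD(1)[OF l this] show ?thesis by eventually_elim (use True in auto)
          next
            case False
            then have "a $ i < x $ i" using that by simp
            from order_tendstoD(2)[OF l this] show ?thesis by eventually_elim (use \<open>a $ i < x $ i\<close> in auto)
          qed
        qed
        have "\<forall>\<^sub>F n in sequentially. indicator (quadrant (b n)) x * w x = indicator (quadrant a) x * w x"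
          using ev[OF elim(1)] ev[OF elim(2)] by eventually_elim (simp add: quadrant_def indicator_def)
        then show ?case by (rule tendsto_eventually)
      qed
      show "AE x in lborel. norm (indicator (quadrant (b n)) x * w x) \<le> \<bar>w x\<bar>" for n
        by (intro AE_I2) (auto simp: indicator_def)
    qed (use w in \<open>auto intro!: borel_measurable_times borel_measurable_indicator\<close>)
  qed
qed

text \<open>Up to a null set, a box is the alternating sum of the quadrants at its four corners.\<close>

lemma AE_zero_if_quadrant_integral_zero:
  fixes w :: "real^2 \<Rightarrow> real"
  assumes w: "integrable lborel w" and z: "\<And>a. (\<integral>x. indicator (quadrant a) x * w x \<partial>lborel) = 0"
  shows "AE x in lborel. w x = 0"
proof (rule AE_zero_if_integral_box_zero[OF w])
  fix l u :: "real^2"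
  show "(\<integral>x. indicator (box l u) x * w x \<partial>lborel) = 0"
  proof (cases "l $ 1 \<le> u $ 1 \<and> l $ 2 \<le> u $ 2")
    case True
    let ?q = "\<lambda>a x. indicator (quadrant a) x * w x"
    have [measurable]: "w \<in> borel_measurable borel" using w by auto
    have i: "integrable lborel (?q a)" for a by (rule integrable_quadrant[OF w])
    have "(\<integral>x. indicator (box l u) x * w x \<partial>lborel) =
      (\<integral>x. ?q u x - ?q (pt (l $ 1) (u $ 2)) x - ?q (pt (u $ 1) (l $ 2)) x + ?q l x \<partial>lborel)"
    proof (rule integral_cong_AE)
      show "AE x in lborel. indicator (box l u) x * w x =
          ?q u x - ?q (pt (l $ 1) (u $ 2)) x - ?q (pt (u $ 1) (l $ 2)) x + ?q l x"
        using AE_coordinate_neq[of 1 "u $ 1"] AE_coordinate_neq[of 2 "u $ 2"]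
        by eventually_elim (use True in \<open>auto simp: indicator_def quadrant_def mem_box_cart forall_2\<close>)
    qed auto
    also have "\<dots> = 0" using i z by simp
    finally show ?thesis .
  next
    case False
    then have "box l u = {}" by (force simp: mem_box_cart forall_2)
    then show ?thesis by simp
  qed
qed

text \<open>For either order of differentiation, the integral over a quadrant is the value of \<open>\<phi>\<close> at the corner. Hence
  the difference of the two derivatives vanishes almost everywhere, and everywhere by continuity.\<close>

lemma pderiv_at_commute_12:
  fixes \<phi> :: "real^2 \<Rightarrow> real"
  assumes \<phi>: "\<phi> \<in> test_functions UNIV"
  shows "pderiv_at 2 (pderiv_at 1 \<phi>) = pderiv_at 1 (pderiv_at 2 \<phi>)"
proof -
  let ?D = "\<lambda>x. pderiv_at 2 (pderiv_at 1 \<phi>) x - pderiv_at 1 (pderiv_at 2 \<phi>) x"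
  have i: "integrable lborel (pderiv_at 2 (pderiv_at 1 \<phi>))" "integrable lborel (pderiv_at 1 (pderiv_at 2 \<phi>))"
    by (rule test_integrable[OF test_pderiv_at[OF test_pderiv_at[OF \<phi>]]])+
  have "AE x in lborel. ?D x = 0"
  proof (rule AE_zero_if_quadrant_integral_zero)
    show "(\<integral>x. indicator (quadrant a) x * ?D x \<partial>lborel) = 0" for a
      using i by (simp add: right_diff_distrib integrable_quadrant quadrant_mixed_pderiv[OF \<phi>])
  qed (use i in auto)
  moreover have "closed {x. ?D x = 0}"
    by (intro closed_Collect_eq continuous_intros smooth_continuous smooth_pderiv_at test_smooth[OF \<phi>])
  ultimately have "?D x = 0" for x
    using mem_closed_if_AE_lebesgue[of "{x. ?D x = 0}" x] AE_completion by auto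
  then show ?thesis by (auto simp: fun_eq_iff)
qed

lemma pderiv_at_commute:
  fixes \<phi> :: "real^2 \<Rightarrow> real"
  assumes \<phi>: "\<phi> \<in> test_functions UNIV"
  shows "pderiv_at j (pderiv_at i \<phi>) = pderiv_at i (pderiv_at j \<phi>)"
  using exhaust_2[of i] exhaust_2[of j] pderiv_at_commute_12[OF \<phi>] by auto

section \<open>The Dirichlet energy of the gradient equals that of the Laplacian\<close>

text \<open>Twofold integration by parts turns \<open>\<integral> \<partial>\<^sub>1\<partial>\<^sub>1\<phi> \<partial>\<^sub>2\<partial>\<^sub>2\<phi>\<close> into \<open>\<integral> (\<partial>\<^sub>1\<partial>\<^sub>2\<phi>)\<^sup>2\<close>; the boundary terms vanish because \<open>\<phi>\<close>
  has compact support.\<close>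

lemma test_energy_identity:
  fixes \<phi> :: "real^2 \<Rightarrow> real"
  assumes O: "open \<Omega>" and \<phi>: "\<phi> \<in> test_functions \<Omega>"
  shows "(\<integral>x. (pderiv_at 1 (pderiv_at 1 \<phi>) x + pderiv_at 2 (pderiv_at 2 \<phi>) x)\<^sup>2 \<partial>lebesgue_on \<Omega>) =
    (\<Sum>i\<in>UNIV. \<Sum>j\<in>UNIV. \<integral>x. (pderiv_at j (pderiv_at i \<phi>) x)\<^sup>2 \<partial>lebesgue_on \<Omega>)"
proof -
  let ?M = "lebesgue_on \<Omega>" and ?d = "\<lambda>i j. pderiv_at j (pderiv_at i \<phi>)"
  have \<phi>U: "\<phi> \<in> test_functions UNIV" by (rule test_mono[OF \<phi>]) simp
  have l: "?d i j \<in> l2 ?M" for i j by (intro test_l2[OF O] test_pderiv_at \<phi>)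
  have S: "\<Omega> \<in> sets lebesgue" using O by auto
  have conv: "(\<integral>x. ?d i j x * ?d k m x \<partial>?M) = (\<integral>x. ?d i j x * ?d k m x \<partial>lborel)" for i j k m
  proof (rule integral_lebesgue_on_vanish(1)[OF S])
    show "?d i j x * ?d k m x = 0" if "x \<notin> \<Omega>" for x
      using test_vanish[OF test_pderiv_at[OF test_pderiv_at[OF \<phi>]] that] by simp
    have "?d i j \<in> borel_measurable borel" for i j by (intro smooth_borel smooth_pderiv_at test_smooth[OF \<phi>])
    then show "(\<lambda>x. ?d i j x * ?d k m x) \<in> borel_measurable borel" by measurable
  qed
  have "(\<integral>x. ?d 2 2 x * ?d 1 1 x \<partial>lborel) = - (\<integral>x. pderiv_at 1 (?d 2 2) x * pderiv_at 1 \<phi> x \<partial>lborel)"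
    by (rule integral_by_parts_smooth) (intro smooth_pderiv_at test_smooth[OF \<phi>] test_pderiv_at \<phi>U)+
  also have "\<dots> = - (\<integral>x. pderiv_at 2 (?d 2 1) x * pderiv_at 1 \<phi> x \<partial>lborel)"
    by (simp add: pderiv_at_commute[OF test_pderiv_at[OF \<phi>U], of 1 2 2])
  also have "\<dots> = (\<integral>x. ?d 2 1 x * ?d 1 2 x \<partial>lborel)"
    by (rule integral_by_parts_smooth[symmetric]) (intro smooth_pderiv_at test_smooth[OF \<phi>] test_pderiv_at \<phi>U)+
  finally have k: "(\<integral>x. ?d 2 2 x * ?d 1 1 x \<partial>?M) = (\<integral>x. ?d 2 1 x * ?d 1 2 x \<partial>?M)"
    unfolding conv .
  have c: "?d 2 1 = ?d 1 2" by (rule pderiv_at_commute[OF \<phi>U])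
  have "(\<integral>x. (?d 1 1 x + ?d 2 2 x)\<^sup>2 \<partial>?M) = (\<integral>x. (?d 1 1 x)\<^sup>2 + (?d 2 2 x)\<^sup>2 + 2 * (?d 2 2 x * ?d 1 1 x) \<partial>?M)"
    by (simp add: power2_sum mult_ac)
  also have "\<dots> = (\<integral>x. (?d 1 1 x)\<^sup>2 \<partial>?M) + (\<integral>x. (?d 2 2 x)\<^sup>2 \<partial>?M) + 2 * (\<integral>x. ?d 2 1 x * ?d 1 2 x \<partial>?M)"
    using l[of 1 1] l[of 2 2] l2_mult_integrable[OF l[of 2 2] l[of 1 1]] unfolding k[symmetric]
    by (simp add: l2_def)
  also have "\<dots> = (\<Sum>i\<in>UNIV. \<Sum>j\<in>UNIV. \<integral>x. (?d i j x)\<^sup>2 \<partial>?M)"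
    by (simp add: sum_2 c power2_eq_square)
  finally show ?thesis .
qed

lemma H2_0_jet_energy_identity:
  fixes \<psi> :: "real^2 \<Rightarrow> real"
  assumes O: "open \<Omega>" and H: "H2_0_jet \<Omega> \<psi> g h"
  shows "(\<integral>x. (h 1 1 x + h 2 2 x)\<^sup>2 \<partial>lebesgue_on \<Omega>) = (\<Sum>i\<in>UNIV. \<Sum>j\<in>UNIV. \<integral>x. (h i j x)\<^sup>2 \<partial>lebesgue_on \<Omega>)"
    and "AE x in lebesgue_on \<Omega>. h 1 2 x = h 2 1 x"
proof -
  let ?M = "lebesgue_on \<Omega>"
  obtain \<phi> where \<phi>: "\<And>n::nat. \<phi> n \<in> test_functions \<Omega>" "\<And>i j. l2_lim ?M (\<lambda>n. pderiv_at j (pderiv_at i (\<phi> n))) (h i j)"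
    using H2_0_jet_sequence[OF O H] by metis
  have \<phi>U: "\<phi> n \<in> test_functions UNIV" for n by (rule test_mono[OF \<phi>(1)]) simp
  have "(\<lambda>n. \<integral>x. (pderiv_at 1 (pderiv_at 1 (\<phi> n)) x + pderiv_at 2 (pderiv_at 2 (\<phi> n)) x)\<^sup>2 \<partial>?M)
      \<longlonglongrightarrow> (\<integral>x. (h 1 1 x + h 2 2 x)\<^sup>2 \<partial>?M)"
    by (intro l2_lim_square l2_lim_add \<phi>)
  moreover have "(\<lambda>n. \<Sum>i\<in>UNIV. \<Sum>j\<in>UNIV. \<integral>x. (pderiv_at j (pderiv_at i (\<phi> n)) x)\<^sup>2 \<partial>?M)
      \<longlonglongrightarrow> (\<Sum>i\<in>UNIV. \<Sum>j\<in>UNIV. \<integral>x. (h i j x)\<^sup>2 \<partial>?M)"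
    by (intro tendsto_sum l2_lim_square \<phi>)
  ultimately show "(\<integral>x. (h 1 1 x + h 2 2 x)\<^sup>2 \<partial>?M) = (\<Sum>i\<in>UNIV. \<Sum>j\<in>UNIV. \<integral>x. (h i j x)\<^sup>2 \<partial>?M)"
    unfolding test_energy_identity[OF O \<phi>(1)] by (rule LIMSEQ_unique)
  show "AE x in ?M. h 1 2 x = h 2 1 x"
  proof (rule l2_lim_unique)
    show "l2_lim ?M (\<lambda>n. pderiv_at 2 (pderiv_at 1 (\<phi> n))) (h 1 2)" by (rule \<phi>)
    have "(\<lambda>n. pderiv_at 2 (pderiv_at 1 (\<phi> n))) = (\<lambda>n. pderiv_at 1 (pderiv_at 2 (\<phi> n)))"
      using pderiv_at_commute[OF \<phi>U] by blast
    then show "l2_lim ?M (\<lambda>n. pderiv_at 2 (pderiv_at 1 (\<phi> n))) (h 2 1)"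
      using \<phi>(2)[of 1 2] by simp
  qed
qed

lemma has_weak_pderiv_zero: "open \<Omega> \<Longrightarrow> has_weak_pderiv \<Omega> i (\<lambda>x. 0) (\<lambda>x. 0)"
  unfolding has_weak_pderiv_def by (simp add: locally_integrable_def)

lemma has_weak_pderiv_AE_zero:
  assumes O: "open \<Omega>" and w: "has_weak_pderiv \<Omega> i f g" and z: "AE x in lebesgue_on \<Omega>. f x = 0"
  shows "AE x in lebesgue_on \<Omega>. g x = 0"
  by (rule has_weak_pderiv_unique[OF O has_weak_pderiv_cong_AE[OF O w z] has_weak_pderiv_zero[OF O]])

lemma abs_integral_quadrant_le:
  fixes w :: "real^2 \<Rightarrow> real"
  assumes "integrable lborel w"
  shows "\<bar>\<integral>x. indicator (quadrant a) x * w x \<partial>lborel\<bar> \<le> (\<integral>x. \<bar>w x\<bar> \<partial>lborel)"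
proof -
  have "\<bar>\<integral>x. indicator (quadrant a) x * w x \<partial>lborel\<bar> \<le> (\<integral>x. \<bar>indicator (quadrant a) x * w x\<bar> \<partial>lborel)"
    by (rule integral_abs_bound)
  also have "\<dots> \<le> (\<integral>x. \<bar>w x\<bar> \<partial>lborel)"
    using integrable_quadrant[OF assms, of a] assms by (intro integral_mono) (auto simp: indicator_def)
  finally show ?thesis .
qed

text \<open>A function in the closure of the test functions is determined by its mixed second derivative,
  since the integral of that derivative over a quadrant is the value at the corner.\<close>

lemma H2_0_jet_zero_if_gradient_zero:
  fixes \<psi> :: "real^2 \<Rightarrow> real"
  assumes O: "open \<Omega>" "\<Omega> \<in> lmeasurable" and H: "H2_0_jet \<Omega> \<psi> g h"
    and z: "AE x in lebesgue_on \<Omega>. g 1 x = 0"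
  shows "AE x in lebesgue_on \<Omega>. \<psi> x = 0"
proof -
  let ?M = "lebesgue_on \<Omega>"
  interpret finite_measure ?M using O(2) by (rule finite_measure_lebesgue_on)
  obtain \<phi> where \<phi>: "\<And>n::nat. \<phi> n \<in> test_functions \<Omega>" "l2_lim ?M \<phi> \<psi>"
     "\<And>i j. l2_lim ?M (\<lambda>n. pderiv_at j (pderiv_at i (\<phi> n))) (h i j)"
    using H2_0_jet_sequence[OF O(1) H] by metis
  have \<phi>U: "\<phi> n \<in> test_functions UNIV" for n by (rule test_mono[OF \<phi>(1)]) simp
  have h0: "AE x in ?M. h 1 2 x = 0"
    by (rule has_weak_pderiv_AE_zero[OF O(1) H2_0_jet_has_weak_pderiv(2)[OF O(1) H] z])
  have "l2_lim ?M (\<lambda>n. pderiv_at 2 (pderiv_at 1 (\<phi> n))) (\<lambda>x. 0)"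
    by (rule l2_lim_cong_AE[OF \<phi>(3) h0]) simp
  from l2_lim_tendsto_L1[OF this, of \<Omega>]
  have lim: "(\<lambda>n. \<integral>x. indicator \<Omega> x * \<bar>pderiv_at 2 (pderiv_at 1 (\<phi> n)) x\<bar> \<partial>?M) \<longlonglongrightarrow> 0"
    using emeasure_finite[of \<Omega>] by (simp add: less_top[symmetric])
  define \<delta> where "\<delta> n = (\<integral>x. \<bar>pderiv_at 2 (pderiv_at 1 (\<phi> n)) x\<bar> \<partial>lborel)" for n
  have "(\<integral>x. indicator \<Omega> x * \<bar>pderiv_at 2 (pderiv_at 1 (\<phi> n)) x\<bar> \<partial>?M) = \<delta> n" for n
  proof -
    have t: "pderiv_at 2 (pderiv_at 1 (\<phi> n)) \<in> test_functions \<Omega>" by (intro test_pderiv_at \<phi>)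
    have "(\<integral>x. indicator \<Omega> x * \<bar>pderiv_at 2 (pderiv_at 1 (\<phi> n)) x\<bar> \<partial>?M) = (\<integral>x. \<bar>pderiv_at 2 (pderiv_at 1 (\<phi> n)) x\<bar> \<partial>?M)"
      by (intro Bochner_Integration.integral_cong) auto
    also have "\<dots> = \<delta> n" unfolding \<delta>_def
      using O(1) test_vanish[OF t] smooth_borel[OF test_smooth[OF t]]
      by (intro integral_lebesgue_on_vanish(1)) auto
    finally show ?thesis .
  qed
  then have \<delta>: "\<delta> \<longlonglongrightarrow> 0" using lim by simp
  have b: "\<bar>\<phi> n x\<bar> \<le> \<delta> n" for n x
    using abs_integral_quadrant_le[OF test_integrable[OF test_pderiv_at[OF test_pderiv_at[OF \<phi>U]]], of x 2 1 n]
    by (simp add: quadrant_mixed_pderiv(1)[OF \<phi>U] \<delta>_def)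
  have "(\<lambda>n. \<integral>x. (0 - \<phi> n x)\<^sup>2 \<partial>?M) \<longlonglongrightarrow> 0"
  proof (rule tendsto_sandwich[OF _ _ tendsto_const])
    show "(\<lambda>n. (\<delta> n)\<^sup>2 * measure ?M (space ?M)) \<longlonglongrightarrow> 0"
      using \<delta> by (auto intro!: tendsto_eq_intros)
    have "(\<integral>x. (0 - \<phi> n x)\<^sup>2 \<partial>?M) \<le> (\<integral>x. (\<delta> n)\<^sup>2 \<partial>?M)" for n
    proof (rule integral_mono)
      show "integrable ?M (\<lambda>x. (0 - \<phi> n x)\<^sup>2)" using test_l2[OF O(1) \<phi>(1), of n] by (simp add: l2_def)
      show "(0 - \<phi> n x)\<^sup>2 \<le> (\<delta> n)\<^sup>2" for x
        using b[of n x] abs_le_square_iff[of "\<phi> n x" "\<delta> n"] by simp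
    qed simp
    then show "\<forall>\<^sub>F n in sequentially. (\<integral>x. (0 - \<phi> n x)\<^sup>2 \<partial>?M) \<le> (\<delta> n)\<^sup>2 * measure ?M (space ?M)"
      by (simp add: mult.commute)
  qed simp
  then have "l2_lim ?M \<phi> (\<lambda>x. 0)"
    using test_l2[OF O(1) \<phi>(1)] by (simp add: l2_lim_def l2_zero)
  from l2_lim_unique[OF \<phi>(2) this] show ?thesis .
qed

section \<open>Borel representatives and extension by zero\<close>

text \<open>Elements of \<open>L\<^sup>2(\<Omega>)\<close> are replaced by Borel functions on the plane which vanish outside \<open>\<Omega>\<close>, in order to
  form convolutions and iterated integrals.\<close>

lemma borel_representative:
  fixes f :: "real^'n \<Rightarrow> real"
  assumes O: "open \<Omega>" and f: "f \<in> l2 (lebesgue_on \<Omega>)"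
  obtains f' where "\<And>x. x \<notin> \<Omega> \<Longrightarrow> f' x = 0" "AE x in lebesgue_on \<Omega>. f x = f' x" "f' \<in> l2 lborel"
proof -
  have S: "\<Omega> \<in> sets lebesgue" using O by auto
  let ?f = "\<lambda>x. if x \<in> \<Omega> then f x else 0"
  have m: "?f \<in> borel_measurable lebesgue"
    using f S by (simp add: borel_measurable_if l2_def)
  obtain f1 where f1: "f1 \<in> borel_measurable lborel" "AE x in lborel. ?f x = f1 x"
    using completion_ex_borel_measurable_real[OF m] by blast
  define f' where "f' x = indicator \<Omega> x * f1 x" for x
  have m': "f' \<in> borel_measurable lborel"
    unfolding f'_def using f1(1) O by (intro borel_measurable_times borel_measurable_indicator) auto
  have ae: "AE x in lebesgue. ?f x = f' x"
    using AE_completion[OF f1(2)] by eventually_elim (auto simp: f'_def split: if_splits)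
  have m2: "(\<lambda>x. (f' x)\<^sup>2) \<in> borel_measurable lborel" using m' by simp
  have "integrable lebesgue (\<lambda>x. if x \<in> \<Omega> then (f x)\<^sup>2 else 0)"
    using f S by (simp add: Lebesgue_Measure.integrable_restrict_UNIV l2_def)
  then have "integrable lebesgue (\<lambda>x. (f' x)\<^sup>2)"
  proof (rule integrable_cong_AE_imp)
    show "(\<lambda>x. (f' x)\<^sup>2) \<in> borel_measurable lebesgue" using measurable_completion[OF m2] .
    show "AE x in lebesgue. (if x \<in> \<Omega> then (f x)\<^sup>2 else 0) = (f' x)\<^sup>2"
      using ae by eventually_elim (auto split: if_splits)
  qed
  then have "f' \<in> l2 lborel" using m2 m' by (simp add: l2_def integrable_completion)
  moreover have "AE x in lebesgue_on \<Omega>. f x = f' x"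
    using ae S by (simp add: AE_restrict_space_iff) (auto elim!: eventually_mono split: if_splits)
  moreover have "f' x = 0" if "x \<notin> \<Omega>" for x using that by (simp add: f'_def)
  ultimately show ?thesis using that by blast
qed

lemma l2_lim_extend_by_zero:
  fixes \<phi> :: "nat \<Rightarrow> real^'n \<Rightarrow> real"
  assumes O: "open \<Omega>" and \<phi>: "\<And>n. \<phi> n \<in> test_functions \<Omega>" and l: "l2_lim (lebesgue_on \<Omega>) \<phi> f"
    and f': "\<And>x. x \<notin> \<Omega> \<Longrightarrow> f' x = 0" "AE x in lebesgue_on \<Omega>. f x = f' x" "f' \<in> l2 lborel"
  shows "l2_lim lborel \<phi> f'"
proof -
  have "l2_lim (lebesgue_on \<Omega>) \<phi> f'"
    using l f'(2) l2_measurable[OF l2_lborel_restrict(1)[OF O f'(3)]] by (rule l2_lim_cong_AE)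
  moreover have "(\<integral>x. (f' x - \<phi> n x)\<^sup>2 \<partial>lebesgue_on \<Omega>) = (\<integral>x. (f' x - \<phi> n x)\<^sup>2 \<partial>lborel)" for n
  proof (rule integral_lebesgue_on_vanish(1))
    show "(\<lambda>x. (f' x - \<phi> n x)\<^sup>2) \<in> borel_measurable borel"
      using l2_measurable[OF f'(3)] smooth_borel[OF test_smooth[OF \<phi>[of n]]] by simp
    show "(f' x - \<phi> n x)\<^sup>2 = 0" if "x \<notin> \<Omega>" for x using f'(1)[OF that] test_vanish[OF \<phi> that] by simp
  qed (use O in auto)
  moreover have "\<phi> n \<in> l2 lborel" for n using cont_csupp_l2(2)[OF test_cont_csupp[OF \<phi>]] .
  ultimately show ?thesis using f'(3) by (simp add: l2_lim_def)
qed

lemma l2_integrable_finite_support: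
  fixes f :: "real^'n \<Rightarrow> real"
  assumes O: "open \<Omega>" "\<Omega> \<in> lmeasurable" and f: "f \<in> l2 lborel" "\<And>x. x \<notin> \<Omega> \<Longrightarrow> f x = 0"
  shows "integrable lborel f"
proof -
  have "emeasure lborel \<Omega> < \<infinity>" using O by (simp add: fmeasurable_def)
  moreover have "(\<lambda>x. (indicator \<Omega> x)\<^sup>2) = (indicator \<Omega> :: _ \<Rightarrow> real)" by (auto simp: indicator_def)
  ultimately have "indicator \<Omega> \<in> l2 lborel"
    using O(1) by (simp add: l2_def)
  from l2_mult_integrable[OF f(1) this] have "integrable lborel (\<lambda>x. f x * indicator \<Omega> x)" .
  also have "(\<lambda>x. f x * indicator \<Omega> x) = f" using f(2) by (force simp: indicator_def)
  finally show ?thesis .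
qed

lemma l2_lim_wderiv:
  assumes \<phi>: "\<And>n. \<phi> n \<in> test_functions UNIV"
    and l: "l2_lim lborel \<phi> f" "l2_lim lborel (\<lambda>n. pderiv_at i (\<phi> n)) g"
    and i: "integrable lborel f" "integrable lborel g"
  shows "wderiv i f g"
  unfolding wderiv_def
proof (intro conjI i ballI)
  fix \<eta> :: "real^'a \<Rightarrow> real" assume \<eta>: "\<eta> \<in> test_functions UNIV"
  have t: "\<eta> \<in> l2 lborel" "pderiv_at i \<eta> \<in> l2 lborel"
    using cont_csupp_l2(2)[OF test_cont_csupp] \<eta> test_pderiv_at[OF \<eta>] by blast+
  have "(\<lambda>n. \<integral>x. \<phi> n x * pderiv_at i \<eta> x \<partial>lborel) \<longlonglongrightarrow> (\<integral>x. f x * pderiv_at i \<eta> x \<partial>lborel)"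
    by (rule l2_lim_inner[OF l(1) l2_lim_const[OF t(2)]])
  moreover have "(\<lambda>n. - (\<integral>x. pderiv_at i (\<phi> n) x * \<eta> x \<partial>lborel)) \<longlonglongrightarrow> - (\<integral>x. g x * \<eta> x \<partial>lborel)"
    by (rule tendsto_minus[OF l2_lim_inner[OF l(2) l2_lim_const[OF t(1)]]])
  ultimately show "(\<integral>x. f x * pderiv_at i \<eta> x \<partial>lborel) = - (\<integral>x. g x * \<eta> x \<partial>lborel)"
    unfolding integral_by_parts_smooth[OF test_smooth[OF \<phi>] \<eta>] by (rule LIMSEQ_unique)
qed

lemma l2_lim_l2_approx:
  assumes \<phi>: "\<And>n. \<phi> n \<in> test_functions UNIV" and l: "l2_lim lborel \<phi> f" and i: "integrable lborel f"
  shows "l2_approx f"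
  unfolding l2_approx_def
proof (intro conjI i allI impI)
  show "f \<in> l2 lborel" using l by (simp add: l2_lim_def)
  fix \<epsilon> :: real assume "\<epsilon> > 0"
  have "(\<lambda>n. \<integral>x. (f x - \<phi> n x)\<^sup>2 \<partial>lborel) \<longlonglongrightarrow> 0" using l by (simp add: l2_lim_def)
  from eventually_small[OF this \<open>\<epsilon> > 0\<close>] obtain n where "(\<integral>x. (f x - \<phi> n x)\<^sup>2 \<partial>lborel) < \<epsilon>"
    by (auto simp: eventually_sequentially)
  then show "\<exists>c. cont_csupp c \<and> (\<integral>x. (f x - c x)\<^sup>2 \<partial>lborel) < \<epsilon>"
    using test_cont_csupp[OF \<phi>] by blast
qed

lemma wderiv_minus: "wderiv i f g \<Longrightarrow> wderiv i (\<lambda>x. - f x) (\<lambda>x. - g x)"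
  by (auto simp: wderiv_def)

lemma l2_approx_minus:
  assumes "l2_approx f" shows "l2_approx (\<lambda>x. - f x)"
  unfolding l2_approx_def
proof (intro conjI allI impI)
  fix \<epsilon> :: real assume "\<epsilon> > 0"
  then obtain c where c: "cont_csupp c" "(\<integral>x. (f x - c x)\<^sup>2 \<partial>lborel) < \<epsilon>"
    using assms unfolding l2_approx_def by meson
  have "cont_csupp (\<lambda>x. c x * (- 1))" by (intro cont_csupp_mult c continuous_intros)
  moreover have "(\<lambda>x. (- f x - c x * (- 1))\<^sup>2) = (\<lambda>x. (f x - c x)\<^sup>2)"
    by (auto simp: power2_eq_square algebra_simps)
  ultimately show "\<exists>c. cont_csupp c \<and> (\<integral>x. (- f x - c x)\<^sup>2 \<partial>lborel) < \<epsilon>"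
    using c(2) by (intro exI[of _ "\<lambda>x. c x * (- 1)"]) simp
qed (use assms in \<open>auto simp: l2_approx_def intro: l2_minus\<close>)

section \<open>The stream function of a divergence-free field\<close>

lemma pt_in_ball:
  assumes "y \<in> ball x d" "\<bar>x $ 1 - s\<bar> \<le> \<bar>x $ 1 - y $ 1\<bar>" "\<bar>x $ 2 - t\<bar> \<le> \<bar>x $ 2 - y $ 2\<bar>"
  shows "pt s t \<in> ball x d"
proof -
  have "norm (x - pt s t) \<le> norm (x - y)"
  proof (rule norm_le_componentwise_cart)
    show "norm ((x - pt s t) $ i) \<le> norm ((x - y) $ i)" for i
      using exhaust_2[of i] assms(2,3) by auto
  qed
  then show ?thesis using assms(1) by (simp add: dist_norm)
qed

text \<open>Here \<open>U\<close> is the divergence-free field, extended by zero, \<open>W j i = \<partial>\<^sub>i U\<^sub>j\<close>, and \<open>\<phi> j\<close> is a sequence of test functions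
  approximating \<open>U\<^sub>j\<close>. The stream function \<open>\<psi> a\<close> is the integral of \<open>\<partial>\<^sub>2U\<^sub>2\<close> over the quadrant with corner \<open>a\<close>. It is
  the uniform limit of \<open>A2 n a\<close>, the integral of \<open>\<phi> 2 n\<close> along the horizontal half-line ending in \<open>a\<close>, and because
  of \<open>\<partial>\<^sub>2U\<^sub>2 = - \<partial>\<^sub>1U\<^sub>1\<close> also of \<open>A1 n a\<close>, minus the integral of \<open>\<phi> 1 n\<close> along the vertical half-line ending in \<open>a\<close>.
  Thus \<open>\<partial>\<^sub>1\<psi> = U\<^sub>2\<close> comes from \<open>A2\<close> and \<open>\<partial>\<^sub>2\<psi> = - U\<^sub>1\<close> from \<open>A1\<close>. Moreover \<open>A2 n\<close> does not change along horizontal segments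
  outside \<open>\<Omega>\<close> and \<open>A1 n\<close> not along vertical ones, so \<open>\<psi>\<close> is locally constant in the exterior. Far away from the
  origin \<open>A2 n a = 0\<close> or \<open>A1 n a = 0\<close>, according to which coordinate of \<open>a\<close> is large, so the constant on an
  unbounded connected part of the complement can only be zero.\<close>

lemma stream_function:
  fixes \<phi> :: "2 \<Rightarrow> nat \<Rightarrow> real^2 \<Rightarrow> real"
  assumes O: "open \<Omega>" "\<Omega> \<in> lmeasurable" and L: "lipschitz_boundary \<Omega>"
    and unb: "\<And>x. x \<notin> \<Omega> \<Longrightarrow> \<exists>S. connected S \<and> S \<subseteq> - \<Omega> \<and> x \<in> S \<and> \<not> bounded S"
    and \<phi>: "\<And>j n. \<phi> j n \<in> test_functions \<Omega>"
    and U: "\<And>j. l2_lim lborel (\<phi> j) (U j)" "\<And>j x. x \<notin> \<Omega> \<Longrightarrow> U j x = 0"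
    and W: "\<And>j i. l2_lim lborel (\<lambda>n. pderiv_at i (\<phi> j n)) (W j i)" "\<And>j i x. x \<notin> \<Omega> \<Longrightarrow> W j i x = 0"
    and div: "AE x in lborel. W 1 1 x + W 2 2 x = 0"
  shows "\<exists>\<psi>. H2_0_jet \<Omega> \<psi> (\<lambda>i x. if i = 1 then U 2 x else - U 1 x) (\<lambda>i j x. if i = 1 then W 2 j x else - W 1 j x)"
proof -
  have l2U: "U j \<in> l2 lborel" and l2W: "W j i \<in> l2 lborel" for j i
    using U(1) W(1) by (auto simp: l2_lim_def)
  have iU: "integrable lborel (U j)" for j by (rule l2_integrable_finite_support[OF O l2U U(2)])
  have iW: "integrable lborel (W j i)" for j i by (rule l2_integrable_finite_support[OF O l2W W(2)])
  have \<phi>U: "\<phi> j n \<in> test_functions UNIV" for j n by (rule test_mono[OF \<phi>]) simp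
  have id\<phi>: "integrable lborel (pderiv_at i (\<phi> j n))" for i j n
    by (rule test_integrable[OF test_pderiv_at[OF \<phi>]])
  have fin: "emeasure lborel \<Omega> < \<infinity>" "\<Omega> \<in> sets lborel" using O by (auto simp: fmeasurable_def)
  define \<epsilon> where "\<epsilon> j n = (\<integral>x. \<bar>W j j x - pderiv_at j (\<phi> j n) x\<bar> \<partial>lborel)" for j n
  have \<epsilon>: "\<epsilon> j \<longlonglongrightarrow> 0" for j
  proof -
    have "(\<lambda>x. indicator \<Omega> x * \<bar>W j j x - pderiv_at j (\<phi> j n) x\<bar>) = (\<lambda>x. \<bar>W j j x - pderiv_at j (\<phi> j n) x\<bar>)" for n
      using W(2)[of _ j j] test_vanish[OF test_pderiv_at[OF \<phi>[of j n]], of _ j] by (force simp: indicator_def)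
    then show ?thesis
      using l2_lim_tendsto_L1[OF W(1)[of j j] fin(2,1)] unfolding \<epsilon>_def by simp
  qed
  define \<psi> where "\<psi> a = (\<integral>x. indicator (quadrant a) x * W 2 2 x \<partial>lborel)" for a
  define A1 where "A1 n a = - (\<integral>x. indicator (quadrant a) x * pderiv_at 1 (\<phi> 1 n) x \<partial>lborel)" for n a
  define A2 where "A2 n a = (\<integral>x. indicator (quadrant a) x * pderiv_at 2 (\<phi> 2 n) x \<partial>lborel)" for n a
  have \<psi>': "\<psi> a = - (\<integral>x. indicator (quadrant a) x * W 1 1 x \<partial>lborel)" for a
  proof -
    have [measurable]: "W i j \<in> borel_measurable borel" for i j using iW by auto
    have "\<psi> a = (\<integral>x. - (indicator (quadrant a) x * W 1 1 x) \<partial>lborel)"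
      unfolding \<psi>_def
    proof (rule integral_cong_AE)
      show "AE x in lborel. indicator (quadrant a) x * W 2 2 x = - (indicator (quadrant a) x * W 1 1 x)"
        using div by eventually_elim (simp add: indicator_def)
    qed auto
    then show ?thesis by simp
  qed
  have close2: "\<bar>A2 n a - \<psi> a\<bar> \<le> \<epsilon> 2 n" for n a
  proof -
    have "\<psi> a - A2 n a = (\<integral>x. indicator (quadrant a) x * (W 2 2 x - pderiv_at 2 (\<phi> 2 n) x) \<partial>lborel)"
      unfolding \<psi>_def A2_def right_diff_distrib
      by (intro Bochner_Integration.integral_diff[symmetric] integrable_quadrant iW id\<phi>)
    then show ?thesis
      using abs_integral_quadrant_le[of "\<lambda>x. W 2 2 x - pderiv_at 2 (\<phi> 2 n) x" a] iW[of 2 2] id\<phi>[of 2 2 n]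
      unfolding \<epsilon>_def by (simp add: abs_minus_commute)
  qed
  have close1: "\<bar>A1 n a - \<psi> a\<bar> \<le> \<epsilon> 1 n" for n a
  proof -
    have "A1 n a - \<psi> a = (\<integral>x. indicator (quadrant a) x * (W 1 1 x - pderiv_at 1 (\<phi> 1 n) x) \<partial>lborel)"
      unfolding \<psi>' A1_def right_diff_distrib
      by (subst Bochner_Integration.integral_diff) (auto intro!: integrable_quadrant iW id\<phi>)
    then show ?thesis
      using abs_integral_quadrant_le[of "\<lambda>x. W 1 1 x - pderiv_at 1 (\<phi> 1 n) x" a] iW[of 1 1] id\<phi>[of 1 1 n]
      unfolding \<epsilon>_def by simp
  qed
  have lim1: "(\<lambda>n. A1 n a) \<longlonglongrightarrow> \<psi> a" for a
    by (rule LIM_zero_cancel, rule tendsto_rabs_zero_cancel, rule tendsto_sandwich[OF _ _ tendsto_const \<epsilon>[of 1]])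
       (use close1 in auto)
  have lim2: "(\<lambda>n. A2 n a) \<longlonglongrightarrow> \<psi> a" for a
    by (rule LIM_zero_cancel, rule tendsto_rabs_zero_cancel, rule tendsto_sandwich[OF _ _ tendsto_const \<epsilon>[of 2]])
       (use close2 in auto)
  have A1: "A1 n a = - (\<integral>t. indicator {..a $ 2} t * \<phi> 1 n (pt (a $ 1) t) \<partial>lborel)" for n a
    unfolding A1_def by (simp add: quadrant_pderiv_1[OF \<phi>U])
  have A2: "A2 n a = (\<integral>s. indicator {..a $ 1} s * \<phi> 2 n (pt s (a $ 2)) \<partial>lborel)" for n a
    unfolding A2_def by (rule quadrant_pderiv_2[OF \<phi>U])
  have c\<psi>: "continuous_on UNIV \<psi>" unfolding \<psi>_def by (rule continuous_quadrant_integral[OF iW])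
  have cA: "continuous_on UNIV (A1 n)" "continuous_on UNIV (A2 n)" for n
    unfolding A1_def A2_def by (intro continuous_on_minus continuous_quadrant_integral id\<phi>)+

  have zero: "\<phi> j n x = 0" if "x \<notin> \<Omega>" for j n x using test_vanish[OF \<phi> that] .
  have exterior: "\<exists>d>0. \<forall>y\<in>ball x d. \<psi> y = \<psi> x" if x: "x \<notin> closure \<Omega>" for x
  proof -
    obtain d where d: "d > 0" "ball x d \<subseteq> - closure \<Omega>"
      using open_contains_ball[of "- closure \<Omega>"] x by auto
    have out: "z \<notin> \<Omega>" if "z \<in> ball x d" for z using that d(2) closure_subset by blast
    have "\<psi> y = \<psi> x" if y: "y \<in> ball x d" for y
    proof -
      define z where "z = pt (y $ 1) (x $ 2)"
      have "A2 n z = A2 n x" for n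
        unfolding A2 z_def pt_nth
      proof (rule Bochner_Integration.integral_cong[OF refl])
        fix s
        show "indicator {..y $ 1} s * \<phi> 2 n (pt s (x $ 2)) = indicator {..x $ 1} s * \<phi> 2 n (pt s (x $ 2))"
        proof (cases "(s \<le> x $ 1) = (s \<le> y $ 1)")
          case False
          then have "pt s (x $ 2) \<in> ball x d" by (intro pt_in_ball[OF y]) auto
          then show ?thesis using zero[OF out] by simp
        qed (auto simp: indicator_def)
      qed
      then have "\<psi> z = \<psi> x" using LIMSEQ_unique[OF lim2[of z]] lim2[of x] by simp
      moreover have "A1 n y = A1 n z" for n
        unfolding A1 z_def pt_nth
      proof (rule arg_cong[where f=uminus], rule Bochner_Integration.integral_cong[OF refl])
        fix t
        show "indicator {..y $ 2} t * \<phi> 1 n (pt (y $ 1) t) = indicator {..x $ 2} t * \<phi> 1 n (pt (y $ 1) t)"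
        proof (cases "(t \<le> x $ 2) = (t \<le> y $ 2)")
          case False
          then have "pt (y $ 1) t \<in> ball x d" by (intro pt_in_ball[OF y]) auto
          then show ?thesis using zero[OF out] by simp
        qed (auto simp: indicator_def)
      qed
      then have "\<psi> y = \<psi> z" using LIMSEQ_unique[OF lim1[of y]] lim1[of z] by simp
      ultimately show ?thesis by simp
    qed
    then show ?thesis using d(1) by blast
  qed
  have \<psi>0: "\<psi> x = 0" if x: "x \<notin> \<Omega>" for x
  proof -
    obtain S where S: "connected S" "S \<subseteq> - \<Omega>" "x \<in> S" "\<not> bounded S" using unb[OF x] by blast
    have const: "\<psi> x = \<psi> y" if y: "y \<in> S" for y
    proof (rule connected_local_const[OF S(1,3) y], intro ballI)
      fix z assume "z \<in> S"
      then have "z \<notin> \<Omega>" using S(2) by blast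
      from locally_constant_complement_lipschitz[OF O(1) L c\<psi> exterior this]
      obtain d where d: "d > 0" "\<forall>y\<in>ball z d - \<Omega>. \<psi> y = \<psi> z" by blast
      have "\<psi> z = \<psi> b" if "b \<in> S" "dist b z < d" for b
        using d(2) that S(2) by (auto simp: dist_commute)
      then show "\<forall>\<^sub>F b in at z within S. \<psi> z = \<psi> b"
        using d(1) unfolding eventually_at by blast
    qed
    have "\<bar>\<psi> x\<bar> \<le> \<epsilon> 1 n + \<epsilon> 2 n" for n
    proof -
      obtain M1 where M1: "\<And>x i. \<bar>x $ i\<bar> > M1 \<Longrightarrow> \<phi> 1 n x = 0" using test_vanish_outside[OF \<phi>U] by metis
      obtain M2 where M2: "\<And>x i. \<bar>x $ i\<bar> > M2 \<Longrightarrow> \<phi> 2 n x = 0" using test_vanish_outside[OF \<phi>U] by metis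
      obtain y where y: "y \<in> S" "norm y > \<bar>M1\<bar> + \<bar>M2\<bar>"
        using S(4) unfolding bounded_iff by (meson not_le)
      have nn: "\<epsilon> j n \<ge> 0" for j by (simp add: \<epsilon>_def)
      have "norm y \<le> \<bar>y $ 1\<bar> + \<bar>y $ 2\<bar>" using norm_le_l1_cart[of y] by (simp add: sum_2)
      then consider "\<bar>y $ 1\<bar> > M1" | "\<bar>y $ 2\<bar> > M2" using y(2) by linarith
      then have "\<bar>\<psi> y\<bar> \<le> \<epsilon> 1 n + \<epsilon> 2 n"
      proof cases
        case 1
        then have "\<phi> 1 n (pt (y $ 1) t) = 0" for t by (intro M1[of _ 1]) simp
        then have "A1 n y = 0" unfolding A1 by simp
        then show ?thesis using close1[of n y] nn[of 2] by simp
      next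
        case 2
        then have "\<phi> 2 n (pt s (y $ 2)) = 0" for s by (intro M2[of _ 2]) simp
        then have "A2 n y = 0" unfolding A2 by simp
        then show ?thesis using close2[of n y] nn[of 1] by simp
      qed
      then show ?thesis using const[OF y(1)] by simp
    qed
    moreover have "(\<lambda>n. \<epsilon> 1 n + \<epsilon> 2 n) \<longlonglongrightarrow> 0 + 0" by (intro tendsto_add \<epsilon>)
    ultimately have "\<bar>\<psi> x\<bar> \<le> 0" by (intro LIMSEQ_le_const[of "\<lambda>n. \<epsilon> 1 n + \<epsilon> 2 n" 0]) auto
    then show ?thesis by simp
  qed

  define C where "C = (\<integral>x. \<bar>W 2 2 x\<bar> \<partial>lborel)"
  have bound: "\<bar>\<psi> x\<bar> \<le> C" for x unfolding \<psi>_def C_def by (rule abs_integral_quadrant_le[OF iW])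
  have m\<psi>: "\<psi> \<in> borel_measurable borel" by (rule borel_measurable_continuous_onI[OF c\<psi>])
  have l2\<psi>: "\<psi> \<in> l2 lborel"
  proof -
    have "integrable lborel (\<lambda>x. (\<psi> x)\<^sup>2)"
    proof (rule Bochner_Integration.integrable_bound[where f="\<lambda>x. C\<^sup>2 * indicator \<Omega> x"])
      have "(\<psi> x)\<^sup>2 \<le> C\<^sup>2 * indicator \<Omega> x" for x
        using \<psi>0[of x] bound[of x] abs_le_square_iff[of "\<psi> x" C] by (cases "x \<in> \<Omega>") auto
      then show "AE x in lborel. norm ((\<psi> x)\<^sup>2) \<le> norm (C\<^sup>2 * indicator \<Omega> x :: real)" by simp
    qed (use fin m\<psi> in auto)
    then show ?thesis using m\<psi> by (simp add: l2_def)
  qed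
  have i\<psi>: "integrable lborel \<psi>" by (rule l2_integrable_finite_support[OF O l2\<psi> \<psi>0])

  have lim_int: "(\<lambda>n. \<integral>x. A n x * \<eta> x \<partial>lborel) \<longlonglongrightarrow> (\<integral>x. \<psi> x * \<eta> x \<partial>lborel)"
    if A: "\<And>n x. \<bar>A n x - \<psi> x\<bar> \<le> \<epsilon> j n" "\<And>n. continuous_on UNIV (A n)" and \<eta>: "\<eta> \<in> test_functions UNIV"
    for A j \<eta>
  proof (rule LIM_zero_cancel, rule tendsto_rabs_zero_cancel, rule tendsto_sandwich[OF _ _ tendsto_const])
    have i\<eta>: "integrable lborel \<eta>" by (rule test_integrable[OF \<eta>])
    show "(\<lambda>n. \<epsilon> j n * (\<integral>x. \<bar>\<eta> x\<bar> \<partial>lborel)) \<longlonglongrightarrow> 0" using \<epsilon>[of j] by (auto intro!: tendsto_eq_intros)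
    have "\<bar>(\<integral>x. A n x * \<eta> x \<partial>lborel) - (\<integral>x. \<psi> x * \<eta> x \<partial>lborel)\<bar> \<le> \<epsilon> j n * (\<integral>x. \<bar>\<eta> x\<bar> \<partial>lborel)" for n
    proof -
      have i: "integrable lborel (\<lambda>x. A n x * \<eta> x)" "integrable lborel (\<lambda>x. \<psi> x * \<eta> x)"
        using cont_csupp_l2(1)[OF cont_csupp_mult[OF test_cont_csupp[OF \<eta>]]] A(2) c\<psi>
        by (simp_all add: mult.commute[of _ "\<eta> _"])
      have "(\<integral>x. A n x * \<eta> x \<partial>lborel) - (\<integral>x. \<psi> x * \<eta> x \<partial>lborel) = (\<integral>x. A n x * \<eta> x - \<psi> x * \<eta> x \<partial>lborel)"
        using i by simp
      also have "\<bar>\<dots>\<bar> \<le> (\<integral>x. \<bar>A n x * \<eta> x - \<psi> x * \<eta> x\<bar> \<partial>lborel)" by (rule integral_abs_bound)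
      also have "\<dots> \<le> (\<integral>x. \<epsilon> j n * \<bar>\<eta> x\<bar> \<partial>lborel)"
      proof (rule integral_mono)
        show "\<bar>A n x * \<eta> x - \<psi> x * \<eta> x\<bar> \<le> \<epsilon> j n * \<bar>\<eta> x\<bar>" for x
          unfolding left_diff_distrib[symmetric] abs_mult by (intro mult_right_mono A(1)) simp
      qed (use i i\<eta> in auto)
      also have "\<dots> = \<epsilon> j n * (\<integral>x. \<bar>\<eta> x\<bar> \<partial>lborel)" by simp
      finally show ?thesis .
    qed
    then show "\<forall>\<^sub>F n in sequentially. \<bar>(\<integral>x. A n x * \<eta> x \<partial>lborel) - (\<integral>x. \<psi> x * \<eta> x \<partial>lborel)\<bar> \<le> \<epsilon> j n * (\<integral>x. \<bar>\<eta> x\<bar> \<partial>lborel)"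
      by simp
  qed simp
  have c\<phi>: "continuous_on UNIV (\<phi> j n)" for j n by (rule smooth_continuous[OF test_smooth[OF \<phi>]])
  have w1: "wderiv 1 \<psi> (U 2)"
    unfolding wderiv_def
  proof (intro conjI i\<psi> iU ballI)
    fix \<eta> :: "real^2 \<Rightarrow> real" assume \<eta>: "\<eta> \<in> test_functions UNIV"
    have parts: "(\<integral>x. A2 n x * pderiv_at 1 \<eta> x \<partial>lborel) = - (\<integral>x. \<phi> 2 n x * \<eta> x \<partial>lborel)" for n
    proof (rule integral_by_parts_test[OF cA(2) c\<phi> _ \<eta>])
      fix x :: "real^2"
      show "((\<lambda>t. A2 n (x + t *\<^sub>R axis 1 1)) has_real_derivative \<phi> 2 n x) (at 0)"
        using DERIV_shift[of "\<lambda>y. \<integral>s. indicator {..y} s * \<phi> 2 n (pt s (x $ 2)) \<partial>lborel" "\<phi> 2 n x" 0 "x $ 1"]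
          test_halfline_has_derivative(1)[OF \<phi>U[of 2 n], of "x $ 2" "x $ 1"]
        by (simp add: A2 axis_def add.commute)
    qed
    have "(\<lambda>n. \<integral>x. A2 n x * pderiv_at 1 \<eta> x \<partial>lborel) \<longlonglongrightarrow> (\<integral>x. \<psi> x * pderiv_at 1 \<eta> x \<partial>lborel)"
      by (rule lim_int[OF close2 cA(2) test_pderiv_at[OF \<eta>]])
    moreover have "(\<lambda>n. - (\<integral>x. \<phi> 2 n x * \<eta> x \<partial>lborel)) \<longlonglongrightarrow> - (\<integral>x. U 2 x * \<eta> x \<partial>lborel)"
      by (intro tendsto_minus l2_lim_inner[OF U(1)] l2_lim_const cont_csupp_l2 test_cont_csupp[OF \<eta>])
    ultimately show "(\<integral>x. \<psi> x * pderiv_at 1 \<eta> x \<partial>lborel) = - (\<integral>x. U 2 x * \<eta> x \<partial>lborel)"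
      unfolding parts by (rule LIMSEQ_unique)
  qed
  have w2: "wderiv 2 \<psi> (\<lambda>x. - U 1 x)"
    unfolding wderiv_def
  proof (intro conjI i\<psi> Bochner_Integration.integrable_minus iU ballI)
    fix \<eta> :: "real^2 \<Rightarrow> real" assume \<eta>: "\<eta> \<in> test_functions UNIV"
    have parts: "(\<integral>x. A1 n x * pderiv_at 2 \<eta> x \<partial>lborel) = - (\<integral>x. - \<phi> 1 n x * \<eta> x \<partial>lborel)" for n
    proof (rule integral_by_parts_test[OF cA(1) continuous_on_minus[OF c\<phi>] _ \<eta>])
      fix x :: "real^2"
      show "((\<lambda>t. A1 n (x + t *\<^sub>R axis 2 1)) has_real_derivative - \<phi> 1 n x) (at 0)"
        using DERIV_shift[of "\<lambda>y. \<integral>t. indicator {..y} t * \<phi> 1 n (pt (x $ 1) t) \<partial>lborel" "\<phi> 1 n x" 0 "x $ 2"]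
          test_halfline_has_derivative(2)[OF \<phi>U[of 1 n], of "x $ 1" "x $ 2"]
        by (simp add: A1 axis_def add.commute DERIV_minus)
    qed
    have "(\<lambda>n. \<integral>x. A1 n x * pderiv_at 2 \<eta> x \<partial>lborel) \<longlonglongrightarrow> (\<integral>x. \<psi> x * pderiv_at 2 \<eta> x \<partial>lborel)"
      by (rule lim_int[OF close1 cA(1) test_pderiv_at[OF \<eta>]])
    moreover have "(\<lambda>n. - (\<integral>x. - \<phi> 1 n x * \<eta> x \<partial>lborel)) \<longlonglongrightarrow> - (\<integral>x. - U 1 x * \<eta> x \<partial>lborel)"
      by (intro tendsto_minus l2_lim_inner[OF l2_lim_minus[OF U(1)]] l2_lim_const cont_csupp_l2 test_cont_csupp[OF \<eta>])
    ultimately show "(\<integral>x. \<psi> x * pderiv_at 2 \<eta> x \<partial>lborel) = - (\<integral>x. - U 1 x * \<eta> x \<partial>lborel)"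
      unfolding parts by (rule LIMSEQ_unique)
  qed
  have wU: "wderiv i (U j) (W j i)" for i j by (rule l2_lim_wderiv[OF \<phi>U U(1) W(1) iU iW])
  have aU: "l2_approx (U j)" for j by (rule l2_lim_l2_approx[OF \<phi>U U(1) iU])
  have aW: "l2_approx (W j i)" for i j by (rule l2_lim_l2_approx[OF test_pderiv_at[OF \<phi>U] W(1) iW])
  have "H2_0_jet \<Omega> \<psi> (\<lambda>i x. if i = 1 then U 2 x else - U 1 x) (\<lambda>i j x. if i = 1 then W 2 j x else - W 1 j x)"
  proof (rule H2_0_jet_if_inward[OF O(1) inward_at_lipschitz_boundary[OF O(1) L] c\<psi> \<psi>0 l2\<psi>])
    fix i j :: 2
    show "l2_approx (\<lambda>x. if i = 1 then U 2 x else - U 1 x)"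
      using aU l2_approx_minus[OF aU] by (cases "i = 1") simp_all
    show "l2_approx (\<lambda>x. if i = 1 then W 2 j x else - W 1 j x)"
      using aW l2_approx_minus[OF aW] by (cases "i = 1") simp_all
    show "wderiv i \<psi> (\<lambda>x. if i = 1 then U 2 x else - U 1 x)"
      using exhaust_2[of i] w1 w2 by auto
    show "wderiv j (\<lambda>x. if i = 1 then U 2 x else - U 1 x) (\<lambda>x. if i = 1 then W 2 j x else - W 1 j x)"
      using wU wderiv_minus[OF wU] by (cases "i = 1") simp_all
  qed
  then show ?thesis by blast
qed

text \<open>The characterisation of simply connected open sets by the components of the complement concerns the
  complex plane, to which the set is carried by the obvious isometry.\<close>

lemma simply_connected_complement_unbounded:
  fixes \<Omega> :: "(real^2) set"
  assumes O: "open \<Omega>" and sc: "simply_connected \<Omega>" and x: "x \<notin> \<Omega>"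
  shows "\<exists>S. connected S \<and> S \<subseteq> - \<Omega> \<and> x \<in> S \<and> \<not> bounded S"
proof -
  define T where "T y = Complex (y $ 1) (y $ 2)" for y :: "real^2"
  define R where "R z = pt (Re z) (Im z)" for z
  have RT: "R (T y) = y" and TR: "T (R z) = z" for y z by (simp_all add: T_def R_def)
  have T_alt: "T = (\<lambda>y. of_real (y $ 1) + \<i> * of_real (y $ 2))" by (auto simp: T_def complex_eq_iff)
  have cT: "continuous_on S T" for S unfolding T_alt by (intro continuous_intros)
  have cR: "continuous_on S R" for S unfolding R_def by (intro continuous_intros)
  have img: "T ` \<Omega> = R -` \<Omega>" using RT TR by (auto simp: image_iff) (metis TR)
  have oT: "open (T ` \<Omega>)" unfolding img by (rule open_vimage[OF O cR])
  have "\<Omega> homeomorphic T ` \<Omega>"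
    unfolding homeomorphic_def homeomorphism_def
    by (rule exI[of _ T], rule exI[of _ R]) (auto simp: RT TR cT cR image_image)
  then have scT: "simply_connected (T ` \<Omega>)" using homeomorphic_simply_connected sc by blast
  define S where "S = connected_component_set (- T ` \<Omega>) (T x)"
  have "T x \<in> - T ` \<Omega>" using x RT by (metis ComplI imageE)
  then have "S \<in> components (- T ` \<Omega>)" "T x \<in> S"
    unfolding S_def by (auto intro: componentsI)
  then have S: "\<not> bounded S" "connected S" "S \<subseteq> - T ` \<Omega>" "T x \<in> S"
    using simply_connected_eq_unbounded_complement_components[OF oT] scT
      in_components_connected in_components_subset by blast+
  show ?thesis
  proof (intro exI[of _ "R ` S"] conjI)
    show "connected (R ` S)" by (rule connected_continuous_image[OF cR S(2)])
    show "R ` S \<subseteq> - \<Omega>" using S(3) img by auto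
    show "x \<in> R ` S" using S(4) RT by (metis imageI)
    show "\<not> bounded (R ` S)"
    proof
      assume "bounded (R ` S)"
      then obtain B where B: "\<And>z. z \<in> S \<Longrightarrow> norm (R z) \<le> B" by (auto simp: bounded_iff)
      have "norm z \<le> B + B" if "z \<in> S" for z
        using B[OF that] component_le_norm_cart[of "R z" 1] component_le_norm_cart[of "R z" 2] cmod_le[of z]
        by (simp add: R_def)
      then show False using S(1) by (auto simp: bounded_iff)
    qed
  qed
qed

section \<open>The two Rayleigh quotients\<close>

lemma buckling_quotient_eq:
  assumes O: "open \<Omega>" and H: "H2_0_jet \<Omega> \<psi> g h"
  shows "buckling_quotient \<Omega> \<psi> = (\<Sum>i\<in>UNIV. \<Sum>j\<in>UNIV. \<integral>x. (h i j x)\<^sup>2 \<partial>lebesgue_on \<Omega>) /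
    (\<Sum>i\<in>UNIV. \<integral>x. (g i x)\<^sup>2 \<partial>lebesgue_on \<Omega>)"
proof -
  let ?M = "lebesgue_on \<Omega>"
  have l: "g i \<in> l2 ?M" "h i j \<in> l2 ?M" for i j using H unfolding H2_0_jet_def by blast+
  have g: "AE x in ?M. weak_pderiv \<Omega> i \<psi> x = g i x" for i
    by (rule weak_pderiv(2)[OF O H2_0_jet_has_weak_pderiv(1)[OF O H]])
  have h: "AE x in ?M. weak_pderiv \<Omega> i (weak_pderiv \<Omega> i \<psi>) x = h i i x" for i
  proof (rule weak_pderiv(2)[OF O has_weak_pderiv_cong_AE[OF O H2_0_jet_has_weak_pderiv(2)[OF O H]]])
    show "AE x in ?M. g i x = weak_pderiv \<Omega> i \<psi> x" using g[of i] by eventually_elim simp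
  qed
  have "AE x in ?M. weak_laplacian \<Omega> \<psi> x = h 1 1 x + h 2 2 x"
    using h[of 1] h[of 2] by eventually_elim (simp add: weak_laplacian_def sum_2)
  from integral_square_cong_AE_on[OF O l2_add[OF l(2) l(2)] this]
  have num: "(\<integral>x. (weak_laplacian \<Omega> \<psi> x)\<^sup>2 \<partial>?M) = (\<Sum>i\<in>UNIV. \<Sum>j\<in>UNIV. \<integral>x. (h i j x)\<^sup>2 \<partial>?M)"
    by (simp only: H2_0_jet_energy_identity(1)[OF O H])
  have w: "weak_pderiv \<Omega> i \<psi> \<in> l2 ?M" for i
    by (rule l2_cong_AE_on[OF O l(1)[of i]]) (use g[of i] in \<open>auto elim!: eventually_mono\<close>)
  have "(\<integral>x. (\<Sum>i\<in>UNIV. (weak_pderiv \<Omega> i \<psi> x)\<^sup>2) \<partial>?M) = (\<Sum>i\<in>UNIV. \<integral>x. (weak_pderiv \<Omega> i \<psi> x)\<^sup>2 \<partial>?M)"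
    by (rule Bochner_Integration.integral_sum) (use w in \<open>simp add: l2_def\<close>)
  also have "\<dots> = (\<Sum>i\<in>UNIV. \<integral>x. (g i x)\<^sup>2 \<partial>?M)"
    by (intro sum.cong refl integral_square_cong_AE_on[OF O l(1) g])
  finally show ?thesis by (simp add: buckling_quotient_def num)
qed

lemma stokes_quotient_eq:
  assumes O: "open \<Omega>" and H: "\<And>j. H1_0_jet \<Omega> (\<lambda>x. u x $ j) (G j)"
  shows "stokes_quotient \<Omega> u = (\<Sum>j\<in>UNIV. \<Sum>i\<in>UNIV. \<integral>x. (G j i x)\<^sup>2 \<partial>lebesgue_on \<Omega>) /
    (\<Sum>j\<in>UNIV. \<integral>x. (u x $ j)\<^sup>2 \<partial>lebesgue_on \<Omega>)"
    and "AE x in lebesgue_on \<Omega>. weak_divergence \<Omega> u x = G 1 1 x + G 2 2 x"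
proof -
  let ?M = "lebesgue_on \<Omega>"
  have l: "(\<lambda>x. u x $ j) \<in> l2 ?M" "G j i \<in> l2 ?M" for i j using H unfolding H1_0_jet_def by blast+
  have g: "AE x in ?M. weak_pderiv \<Omega> i (\<lambda>y. u y $ j) x = G j i x" for i j
    by (rule weak_pderiv(2)[OF O H1_0_jet_has_weak_pderiv[OF O H]])
  have w: "weak_pderiv \<Omega> i (\<lambda>y. u y $ j) \<in> l2 ?M" for i j
    by (rule l2_cong_AE_on[OF O l(2)[of j i]]) (use g[of i j] in \<open>auto elim!: eventually_mono\<close>)
  have "(\<integral>x. (\<Sum>j\<in>UNIV. \<Sum>i\<in>UNIV. (weak_pderiv \<Omega> i (\<lambda>y. u y $ j) x)\<^sup>2) \<partial>?M)
      = (\<Sum>j\<in>UNIV. \<Sum>i\<in>UNIV. \<integral>x. (weak_pderiv \<Omega> i (\<lambda>y. u y $ j) x)\<^sup>2 \<partial>?M)"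
    using w by (subst Bochner_Integration.integral_sum; (subst Bochner_Integration.integral_sum)?) (auto simp: l2_def)
  also have "\<dots> = (\<Sum>j\<in>UNIV. \<Sum>i\<in>UNIV. \<integral>x. (G j i x)\<^sup>2 \<partial>?M)"
    by (intro sum.cong refl integral_square_cong_AE_on[OF O l(2) g])
  finally have num: "(\<integral>x. (\<Sum>j\<in>UNIV. \<Sum>i\<in>UNIV. (weak_pderiv \<Omega> i (\<lambda>y. u y $ j) x)\<^sup>2) \<partial>?M)
      = (\<Sum>j\<in>UNIV. \<Sum>i\<in>UNIV. \<integral>x. (G j i x)\<^sup>2 \<partial>?M)" .
  have "(norm (u x))\<^sup>2 = (\<Sum>j\<in>UNIV. (u x $ j)\<^sup>2)" for x
    by (simp add: norm_vec_def L2_set_def sum_nonneg)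
  then have "(\<integral>x. (norm (u x))\<^sup>2 \<partial>?M) = (\<Sum>j\<in>UNIV. \<integral>x. (u x $ j)\<^sup>2 \<partial>?M)"
    using l(1) by (simp add: l2_def)
  then show "stokes_quotient \<Omega> u = (\<Sum>j\<in>UNIV. \<Sum>i\<in>UNIV. \<integral>x. (G j i x)\<^sup>2 \<partial>lebesgue_on \<Omega>) /
    (\<Sum>j\<in>UNIV. \<integral>x. (u x $ j)\<^sup>2 \<partial>lebesgue_on \<Omega>)"
    by (simp add: stokes_quotient_def num)
  show "AE x in ?M. weak_divergence \<Omega> u x = G 1 1 x + G 2 2 x"
    using g[of 1 1] g[of 2 2] by eventually_elim (simp add: weak_divergence_def sum_2)
qed

definition buckling_values :: "(real^2) set \<Rightarrow> real set" where
  "buckling_values \<Omega> = {buckling_quotient \<Omega> \<psi> |\<psi>. \<psi> \<in> sobolev0 \<Omega> 2 \<and> \<not> (AE x in lebesgue_on \<Omega>. \<psi> x = 0)}"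

definition stokes_values :: "(real^2) set \<Rightarrow> real set" where
  "stokes_values \<Omega> = {stokes_quotient \<Omega> u |u.
            (\<forall>j. (\<lambda>x. u x $ j) \<in> sobolev0 \<Omega> 1) \<and> \<not> (AE x in lebesgue_on \<Omega>. u x = 0) \<and>
            (AE x in lebesgue_on \<Omega>. weak_divergence \<Omega> u x = 0)}"

text \<open>The witness is the perpendicular gradient \<open>u = (- \<partial>\<^sub>2\<psi>, \<partial>\<^sub>1\<psi>)\<close>, whose components have the same norm as the
  gradient of \<open>\<psi>\<close> and whose derivatives are the entries of the Hessian of \<open>\<psi>\<close> up to sign.\<close>

lemma buckling_values_subset:
  assumes O: "open \<Omega>" "\<Omega> \<in> lmeasurable"
  shows "buckling_values \<Omega> \<subseteq> stokes_values \<Omega>"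
proof
  fix q assume "q \<in> buckling_values \<Omega>"
  then obtain \<psi> where q: "q = buckling_quotient \<Omega> \<psi>" and \<psi>: "\<psi> \<in> sobolev0 \<Omega> 2"
    and nz: "\<not> (AE x in lebesgue_on \<Omega>. \<psi> x = 0)" by (auto simp: buckling_values_def)
  let ?M = "lebesgue_on \<Omega>"
  obtain g h where H: "H2_0_jet \<Omega> \<psi> g h" using \<psi> sobolev0_2_iff[OF O(1)] by blast
  obtain \<phi> where \<phi>: "\<And>n::nat. \<phi> n \<in> test_functions \<Omega>"
    "\<And>i. l2_lim ?M (\<lambda>n. pderiv_at i (\<phi> n)) (g i)"
    "\<And>i j. l2_lim ?M (\<lambda>n. pderiv_at j (pderiv_at i (\<phi> n))) (h i j)"
    using H2_0_jet_sequence[OF O(1) H] by metis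
  have gH: "H1_0_jet \<Omega> (g i) (h i)" for i
    by (rule H1_0_jetI_sequence[OF test_pderiv_at[OF \<phi>(1)] \<phi>(2,3)])
  have mH: "H1_0_jet \<Omega> (\<lambda>x. - g i x) (\<lambda>j x. - h i j x)" for i
  proof (rule H1_0_jetI_sequence)
    show "(\<lambda>x. - pderiv_at i (\<phi> n) x) \<in> test_functions \<Omega>" for n by (intro test_minus test_pderiv_at \<phi>)
    show "l2_lim ?M (\<lambda>n x. - pderiv_at i (\<phi> n) x) (\<lambda>x. - g i x)" by (rule l2_lim_minus[OF \<phi>(2)])
    have "pderiv_at j (\<lambda>x. - pderiv_at i (\<phi> n) x) = (\<lambda>x. - pderiv_at j (pderiv_at i (\<phi> n)) x)" for j n
      using pderiv_at_cmult[OF smooth_differentiable[OF smooth_pderiv_at[OF test_smooth[OF \<phi>(1)]]], of j "- 1" i n] by auto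
    then show "l2_lim ?M (\<lambda>n. pderiv_at j (\<lambda>x. - pderiv_at i (\<phi> n) x)) (\<lambda>x. - h i j x)" for j
      using l2_lim_minus[OF \<phi>(3)] by simp
  qed
  define u where "u x = pt (- g 2 x) (g 1 x)" for x
  define G where "G j = (if j = (1::2) then (\<lambda>i x. - h 2 i x) else h 1)" for j
  have uH: "H1_0_jet \<Omega> (\<lambda>x. u x $ j) (G j)" for j
    using exhaust_2[of j] gH[of 1] mH[of 2] by (auto simp: u_def G_def)
  have "stokes_quotient \<Omega> u = q"
    unfolding q stokes_quotient_eq(1)[OF O(1) uH] buckling_quotient_eq[OF O(1) H]
    by (simp add: sum_2 G_def u_def add.commute)
  moreover have "(\<lambda>x. u x $ j) \<in> sobolev0 \<Omega> 1" for j using uH sobolev0_1_iff[OF O(1)] by blast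
  moreover have "AE x in ?M. weak_divergence \<Omega> u x = 0"
    using stokes_quotient_eq(2)[OF O(1) uH] H2_0_jet_energy_identity(2)[OF O(1) H]
    by eventually_elim (simp add: G_def)
  moreover have "\<not> (AE x in ?M. u x = 0)"
  proof
    assume "AE x in ?M. u x = 0"
    then have "AE x in ?M. g 1 x = 0"
      by eventually_elim (use pt_nth(2) in \<open>metis u_def zero_index\<close>)
    then show False using nz H2_0_jet_zero_if_gradient_zero[OF O H] by blast
  qed
  ultimately show "q \<in> stokes_values \<Omega>" unfolding stokes_values_def by blast
qed

text \<open>The stream function inverts the perpendicular gradient, so the two sets of quotients agree.\<close>

lemma stokes_values_subset:
  assumes O: "open \<Omega>" "\<Omega> \<in> lmeasurable" and L: "lipschitz_boundary \<Omega>" and sc: "simply_connected \<Omega>"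
  shows "stokes_values \<Omega> \<subseteq> buckling_values \<Omega>"
proof
  fix q assume "q \<in> stokes_values \<Omega>"
  then obtain u where q: "q = stokes_quotient \<Omega> u" and u: "\<And>j. (\<lambda>x. u x $ j) \<in> sobolev0 \<Omega> 1"
    and nz: "\<not> (AE x in lebesgue_on \<Omega>. u x = 0)" and div: "AE x in lebesgue_on \<Omega>. weak_divergence \<Omega> u x = 0"
    by (auto simp: stokes_values_def)
  let ?M = "lebesgue_on \<Omega>"
  have S: "\<Omega> \<in> sets lebesgue" using O by auto
  have "\<forall>j. \<exists>G. H1_0_jet \<Omega> (\<lambda>x. u x $ j) G" using u sobolev0_1_iff[OF O(1)] by blast
  then obtain G where G: "\<And>j. H1_0_jet \<Omega> (\<lambda>x. u x $ j) (G j)" by metis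
  let ?P = "\<lambda>j \<phi>. (\<forall>n::nat. \<phi> n \<in> test_functions \<Omega>) \<and> l2_lim ?M \<phi> (\<lambda>x. u x $ j) \<and>
    (\<forall>i. l2_lim ?M (\<lambda>n. pderiv_at i (\<phi> n)) (G j i))"
  have "\<forall>j. \<exists>\<phi>. ?P j \<phi>"
  proof
    fix j show "\<exists>\<phi>. ?P j \<phi>" by (rule H1_0_jet_sequence[OF O(1) G[of j]]) blast
  qed
  from choice[OF this] obtain \<phi> where "\<And>j. ?P j (\<phi> j)" by blast
  then have \<phi>: "\<And>j n. \<phi> j n \<in> test_functions \<Omega>" "\<And>j. l2_lim ?M (\<phi> j) (\<lambda>x. u x $ j)"
    "\<And>i j. l2_lim ?M (\<lambda>n. pderiv_at i (\<phi> j n)) (G j i)" by blast+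
  have l: "(\<lambda>x. u x $ j) \<in> l2 ?M" "G j i \<in> l2 ?M" for i j using G unfolding H1_0_jet_def by blast+
  have "\<exists>U. (\<forall>x. x \<notin> \<Omega> \<longrightarrow> U x = 0) \<and> (AE x in ?M. u x $ j = U x) \<and> U \<in> l2 lborel" for j
    by (rule borel_representative[OF O(1) l(1)[of j]]) blast
  then have "\<exists>U. \<forall>j. (\<forall>x. x \<notin> \<Omega> \<longrightarrow> U j x = 0) \<and> (AE x in ?M. u x $ j = U j x) \<and> U j \<in> l2 lborel"
    by (intro choice allI)
  then obtain U where U: "\<And>j x. x \<notin> \<Omega> \<Longrightarrow> U j x = 0" "\<And>j. AE x in ?M. u x $ j = U j x" "\<And>j. U j \<in> l2 lborel"
    by blast
  have "\<exists>W. (\<forall>x. x \<notin> \<Omega> \<longrightarrow> W x = 0) \<and> (AE x in ?M. G j i x = W x) \<and> W \<in> l2 lborel" for j i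
    by (rule borel_representative[OF O(1) l(2)[of j i]]) blast
  then have "\<exists>W. \<forall>j i. (\<forall>x. x \<notin> \<Omega> \<longrightarrow> W j i x = 0) \<and> (AE x in ?M. G j i x = W j i x) \<and> W j i \<in> l2 lborel"
    by (intro choice allI)
  then obtain W where W: "\<And>j i x. x \<notin> \<Omega> \<Longrightarrow> W j i x = 0" "\<And>j i. AE x in ?M. G j i x = W j i x"
    "\<And>j i. W j i \<in> l2 lborel"
    by blast
  have lU: "l2_lim lborel (\<phi> j) (U j)" for j
    by (rule l2_lim_extend_by_zero[OF O(1) \<phi>(1,2) U(1,2,3)])
  have lW: "l2_lim lborel (\<lambda>n. pderiv_at i (\<phi> j n)) (W j i)" for j i
    by (rule l2_lim_extend_by_zero[OF O(1) test_pderiv_at[OF \<phi>(1)] \<phi>(3) W(1,2,3)])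
  have "AE x in ?M. W 1 1 x + W 2 2 x = 0"
    using div stokes_quotient_eq(2)[OF O(1) G] W(2)[of 1 1] W(2)[of 2 2] by eventually_elim simp
  then have "AE x in lebesgue. x \<in> \<Omega> \<longrightarrow> W 1 1 x + W 2 2 x = 0" using S by (simp add: AE_restrict_space_iff)
  then have "AE x in lebesgue. W 1 1 x + W 2 2 x = 0"
    by eventually_elim (use W(1) in fastforce)
  then have divW: "AE x in lborel. W 1 1 x + W 2 2 x = 0" by (simp add: AE_completion_iff)
  from stream_function[OF O L simply_connected_complement_unbounded[OF O(1) sc] \<phi>(1) lU U(1) lW W(1) divW]
  obtain \<psi> where H: "H2_0_jet \<Omega> \<psi> (\<lambda>i x. if i = 1 then U 2 x else - U 1 x) (\<lambda>i j x. if i = 1 then W 2 j x else - W 1 j x)"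
    by blast
  have eqU: "(\<integral>x. (u x $ j)\<^sup>2 \<partial>?M) = (\<integral>x. (U j x)\<^sup>2 \<partial>?M)" for j
    by (rule integral_square_cong_AE_on[OF O(1) l2_lborel_restrict(1)[OF O(1) U(3)] U(2)])
  have eqW: "(\<integral>x. (G j i x)\<^sup>2 \<partial>?M) = (\<integral>x. (W j i x)\<^sup>2 \<partial>?M)" for j i
    by (rule integral_square_cong_AE_on[OF O(1) l2_lborel_restrict(1)[OF O(1) W(3)] W(2)])
  have "buckling_quotient \<Omega> \<psi> = q"
    unfolding q stokes_quotient_eq(1)[OF O(1) G] buckling_quotient_eq[OF O(1) H]
    by (simp add: sum_2 eqU eqW add.commute)
  moreover have "\<psi> \<in> sobolev0 \<Omega> 2" using H sobolev0_2_iff[OF O(1)] by blast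
  moreover have "\<not> (AE x in ?M. \<psi> x = 0)"
  proof
    assume z: "AE x in ?M. \<psi> x = 0"
    have "AE x in ?M. U 2 x = 0" "AE x in ?M. - U 1 x = 0"
      using has_weak_pderiv_AE_zero[OF O(1) H2_0_jet_has_weak_pderiv(1)[OF O(1) H, of 1] z]
        has_weak_pderiv_AE_zero[OF O(1) H2_0_jet_has_weak_pderiv(1)[OF O(1) H, of 2] z] by simp_all
    then have "AE x in ?M. u x = 0"
      using U(2)[of 1] U(2)[of 2] by eventually_elim (simp add: vec_eq_iff forall_2)
    then show False using nz by blast
  qed
  ultimately show "q \<in> buckling_values \<Omega>" unfolding buckling_values_def by blast
qed

lemma buckling_values_nonempty:
  assumes O: "open \<Omega>" "\<Omega> \<noteq> {}"
  shows "buckling_values \<Omega> \<noteq> {}"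
proof -
  obtain p r where r: "r > 0" "cball p r \<subseteq> \<Omega>" using O open_contains_cball by blast
  obtain \<rho> where \<rho>: "\<rho> \<in> test_functions UNIV" "(\<integral>x. \<rho> x \<partial>lborel) = 1" "\<And>x. x \<notin> ball p r \<Longrightarrow> \<rho> x = 0"
    using mollifier_exists[OF r(1), of p] by metis
  have t: "\<rho> \<in> test_functions \<Omega>"
    by (rule test_functionsI[OF test_smooth[OF \<rho>(1)] compact_cball r(2)]) (auto intro: \<rho>(3))
  have "\<rho> \<in> sobolev0 \<Omega> 2" using test_H2_0_jet[OF O(1) t] sobolev0_2_iff[OF O(1)] by blast
  moreover have "\<not> (AE x in lebesgue_on \<Omega>. \<rho> x = 0)"
  proof
    assume "AE x in lebesgue_on \<Omega>. \<rho> x = 0"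
    then have "(\<integral>x. \<rho> x \<partial>lebesgue_on \<Omega>) = 0" by (rule integral_eq_zero_AE)
    moreover have "(\<integral>x. \<rho> x \<partial>lebesgue_on \<Omega>) = (\<integral>x. \<rho> x \<partial>lborel)"
      using O(1) test_vanish[OF t] smooth_borel[OF test_smooth[OF t]]
      by (intro integral_lebesgue_on_vanish(1)) auto
    ultimately show False using \<rho>(2) by simp
  qed
  ultimately show ?thesis unfolding buckling_values_def by blast
qed

theorem proposition3:
  fixes \<Omega> :: "(real^2) set"
  assumes "open \<Omega>" and "\<Omega> \<in> lmeasurable" and "lipschitz_boundary \<Omega>"
  shows "buckling_eigenvalue \<Omega> \<ge> stokes_eigenvalue \<Omega> \<and>
         (simply_connected \<Omega> \<longrightarrow> buckling_eigenvalue \<Omega> = stokes_eigenvalue \<Omega>)"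
proof -
  have B: "buckling_eigenvalue \<Omega> = Inf (buckling_values \<Omega>)"
    by (simp add: buckling_eigenvalue_def buckling_values_def)
  have S: "stokes_eigenvalue \<Omega> = Inf (stokes_values \<Omega>)"
    by (simp add: stokes_eigenvalue_def stokes_values_def)
  have sub: "buckling_values \<Omega> \<subseteq> stokes_values \<Omega>" by (rule buckling_values_subset[OF assms(1,2)])
  have "stokes_quotient \<Omega> u \<ge> 0" for u
    by (auto simp: stokes_quotient_def intro!: divide_nonneg_nonneg Bochner_Integration.integral_nonneg sum_nonneg)
  then have bdd: "bdd_below (stokes_values \<Omega>)"
    by (intro bdd_belowI[of _ 0]) (auto simp: stokes_values_def)
  have "Inf (stokes_values \<Omega>) \<le> Inf (buckling_values \<Omega>)"
  proof (cases "\<Omega> = {}")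
    \<comment> \<open>Neither problem has an admissible function then, and both eigenvalues are the same unspecified \<open>Inf {}\<close>.\<close>
    case True
    then have "AE x in lebesgue_on \<Omega>. P x" for P by (auto intro!: AE_I2)
    then show ?thesis by (simp add: stokes_values_def buckling_values_def)
  next
    case False
    show ?thesis by (rule cInf_superset_mono[OF buckling_values_nonempty[OF assms(1) False] bdd sub])
  qed
  moreover have "buckling_values \<Omega> = stokes_values \<Omega>" if "simply_connected \<Omega>"
    using sub stokes_values_subset[OF assms that] by blast
  ultimately show ?thesis unfolding B S by simp
qed

end
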